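(* With the notation of the context, let $a_n,b_n,c_n,d_n,e_n$ be the numbers of vertices of type $A,B,C,D,E$ on level $n$ (all zero for $n=0,1$), and let $s_n$ be the total number of vertices on level $n$, so $s_0=1$ and $s_n=a_n+b_n+c_n+d_n+e_n+3$ for $n\ge1$. Then each of the sequences $(a_n),(b_n),(c_n),(d_n),(e_n),(s_n)$ satisfies \[x_n=12x_{n-1}-37x_{n-2}+37x_{n-3}-12x_{n-4}+x_{n-5}\qquad (n\ge 6),\] and the sequences $(a_n),(b_n)$ also satisfy \[x_n=4x_{n-1}-4x_{n-2}+x_{n-3}\qquad (n\ge 4).\] Moreover, with $\alpha_1=(3+\sqrt5)/2$, $\alpha_2=(3-\sqrt5)/2$, $\alpha_3=4+\sqrt{15}$, $\alpha_4=4-\sqrt{15}$, for all $n\ge 1$: \[ \begin{aligned} a_n&=\left(-\tfrac{9}{2}+\tfrac{21}{10}\sqrt{5}\right)\alpha_1^n+\left(-\tfrac{9}{2}-\tfrac{21}{10}\sqrt{5}\right)\alpha_2^n+3,\\ b_n&=\left(3-\tfrac{6}{5}\sqrt{5}\right)\alpha_1^n+\left(3+\tfrac{6}{5}\sqrt{5}\right)\alpha_2^n-3,\\ c_n&=\left(-\tfrac{33}{10}+\tfrac{3}{2}\sqrt{5}\right)\alpha_1^n+\left(-\tfrac{33}{10}-\tfrac{3}{2}\sqrt{5}\right)\alpha_2^n+ \left(\tfrac{122}{15}-\tfrac{21}{10}\sqrt{15}\right)\alpha_3^n+\left(\tfrac{122}{15}+\tfrac{21}{10}\sqrt{15}\right)\alpha_4^n+\tfrac13,\\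 d_n&=\left(\tfrac{27}{5}-\tfrac{12}{5}\sqrt{5}\right)\alpha_1^n+\left(\tfrac{27}{5}+\tfrac{12}{5}\sqrt{5}\right)\alpha_2^n+ \left(-\tfrac{213}{20}+\tfrac{11}{4}\sqrt{15}\right)\alpha_3^n+\left(-\tfrac{213}{20}-\tfrac{11}{4}\sqrt{15}\right)\alpha_4^n-\tfrac32,\\ e_n&=\left(-\tfrac{21}{10}+\tfrac{9}{10}\sqrt{5}\right)\alpha_1^n+\left(-\tfrac{21}{10}-\tfrac{9}{10}\sqrt{5}\right)\alpha_2^n+ \left(\tfrac{31}{10}-\tfrac{4}{5}\sqrt{15}\right)\alpha_3^n+\left(\tfrac{31}{10}+\tfrac{4}{5}\sqrt{15}\right)\alpha_4^n+1,\\ s_n&=\left(-\tfrac{3}{2}+\tfrac{9}{10}\sqrt{5}\right)\alpha_1^n+\left(-\tfrac{3}{2}-\tfrac{9}{10}\sqrt{5}\right)\alpha_2^n+ \left(\tfrac{7}{12}-\tfrac{3}{20}\sqrt{15}\right)\alpha_3^n+\left(\tfrac{7}{12}+\tfrac{3}{20}\sqrt{15}\right)\alpha_4^n+\tfrac{17}6 . \end{aligned} \]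
   Context: Consider the regular cubic honeycomb $\{4,3,5\}$ of hyperbolic 3-space (congruent cubes, five around each edge, icosahedral vertex figure). Fix a cube $Q_0$ and a vertex $V_0$ of it; $\mathcal P$ is the union of the cubes of the honeycomb lying in the closed region bounded by the three pairwise perpendicular honeycomb planes through $V_0$ containing the faces of $Q_0$ at $V_0$ (the side containing $Q_0$). $G_{\mathcal P}$ is the graph of vertices and edges of the honeycomb in $\mathcal P$. Level $n$ is the set of vertices at graph distance $n$ from $V_0$ in $G_{\mathcal P}$; ascendants of a vertex on level $n\ge1$ are its neighbours on level $n-1$. On level $n\ge1$: vertices on an intersection line of two bounding planes (exactly 3 per level) have type "1"; other vertices on a bounding plane have type $A$ (2 ascendants) or $B$ (1 ascendant); vertices off the bounding planes have type $C$, $D$, $E$ (3, 2, 1 ascendants).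
   Formalization: Planes containing the faces of Q_0 at V_0 meet at 72°, so cannot be pairwise perpendicular; the bounding planes are instead taken as the non-geodesic {4,5} sheets of honeycomb squares through these faces, bounding the layers along the three perpendicular midplanes of Q_0. *)

theory Defs
  imports "HOL-Analysis.Analysis"
begin

section \<open>The hyperboloid model of hyperbolic 3-space\<close>

type_synonym point = "(real ^ 3) \<times> real"

definition lorentz :: "point \<Rightarrow> point \<Rightarrow> real" where
  "lorentz p q = fst p \<bullet> fst q - snd p * snd q"

definition hyperbolic_space :: "point set" where
  "hyperbolic_space = {p. lorentz p p = -1 \<and> snd p > 0}"

text \<open>Reflection in the plane Lorentz-orthogonal to \<open>n\<close>, for \<open>lorentz n n > 0\<close>.\<close>

definition reflection :: "point \<Rightarrow> point \<Rightarrow> point" where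
  "reflection n p = p - (2 * lorentz p n / lorentz n n) *\<^sub>R n"

text \<open>For points of hyperbolic space, \<open>- lorentz p q\<close> is the hyperbolic cosine of their
  distance, so a larger value of \<open>lorentz\<close> means a smaller distance.\<close>

definition nearer :: "point \<Rightarrow> point \<Rightarrow> point set" where
  "nearer x y = {p \<in> hyperbolic_space. lorentz p x > lorentz p y}"

definition bisector :: "point \<Rightarrow> point \<Rightarrow> point set" where
  "bisector x y = {p \<in> hyperbolic_space. lorentz p x = lorentz p y}"


section \<open>The regular cubic honeycomb with five cubes around each edge\<close>

text \<open>The base cube is centred at \<open>(0, 1)\<close> and its faces lie in the planes
  \<open>fst p $ i = \<plusminus> half_width * snd p\<close>. Adjacent faces of such a cube with parameter \<open>h\<close> have a dihedral
  angle with cosine \<open>h\<^sup>2 / (1 - h\<^sup>2)\<close>; the value of \<open>half_width\<close> makes this angle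
  \<open>2 * pi / 5\<close>, as proved below, so that five cubes fit around each edge.\<close>

definition half_width :: real where
  "half_width = sqrt (cos (2 * pi / 5) / (1 + cos (2 * pi / 5)))"

definition face_normals :: "point set" where
  "face_normals = {(\<sigma> *\<^sub>R axis i 1, half_width) | \<sigma> i. \<sigma> = 1 \<or> \<sigma> = -1}"

definition base_cube :: "point set" where
  "base_cube = {p \<in> hyperbolic_space. \<forall>n\<in>face_normals. lorentz p n \<le> 0}"

definition base_vertices :: "point set" where
  "base_vertices = {p \<in> hyperbolic_space. \<forall>i. \<bar>fst p $ i\<bar> = half_width * snd p}"

definition base_edges :: "(point \<times> point) set" where
  "base_edges = {(p, q). p \<in> base_vertices \<and> q \<in> base_vertices \<and>
     card {i. fst p $ i \<noteq> fst q $ i} = 1}"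

definition base_faces :: "point set set" where
  "base_faces = {{p \<in> base_cube. lorentz p n = 0} | n. n \<in> face_normals}"

text \<open>The group generated by the reflections in the six face planes of the base cube. The cube
  adjacent to \<open>g ` base_cube\<close> across the face with normal \<open>g n\<close> is
  \<open>(g \<circ> reflection n) ` base_cube\<close>, so the orbit of the base cube is the whole honeycomb.\<close>

inductive_set face_group :: "(point \<Rightarrow> point) set" where
  id: "id \<in> face_group"
| refl: "g \<in> face_group \<Longrightarrow> n \<in> face_normals \<Longrightarrow> g \<circ> reflection n \<in> face_group"

definition cubes :: "point set set" where
  "cubes = {g ` base_cube | g. g \<in> face_group}"

definition cube_vertices :: "point set \<Rightarrow> point set" where
  "cube_vertices Q = \<Union> {g ` base_vertices | g. g \<in> face_group \<and> g ` base_cube = Q}"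

text \<open>Edges are given by both of their orientations.\<close>

definition cube_edges :: "point set \<Rightarrow> (point \<times> point) set" where
  "cube_edges Q = \<Union> {map_prod g g ` base_edges | g. g \<in> face_group \<and> g ` base_cube = Q}"

definition cube_faces :: "point set \<Rightarrow> point set set" where
  "cube_faces Q = \<Union> {(`) g ` base_faces | g. g \<in> face_group \<and> g ` base_cube = Q}"

lemma cos_two_pi_fifths: "0 < cos (2 * pi / 5)" "cos (2 * pi / 5) < 1 / 2"
proof -
  show "0 < cos (2 * pi / 5)"
    by (rule cos_gt_zero) auto
  have "cos (2 * pi / 5) < cos (pi / 3)"
    by (rule cos_monotone_0_pi) auto
  then show "cos (2 * pi / 5) < 1 / 2"
    by (simp add: cos_60)
qed

lemma half_width_square: "half_width\<^sup>2 = cos (2 * pi / 5) / (1 + cos (2 * pi / 5))"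
  using cos_two_pi_fifths by (simp add: half_width_def)

text \<open>The vertices of the base cube are proper points of hyperbolic space.\<close>

lemma half_width_bound: "3 * half_width\<^sup>2 < 1"
  using cos_two_pi_fifths by (simp add: half_width_square field_simps)

lemma dihedral_angle:
  fixes i j :: 3
  assumes "i \<noteq> j" "\<sigma> = 1 \<or> \<sigma> = -1" "\<tau> = 1 \<or> \<tau> = -1"
  defines "m \<equiv> (\<sigma> *\<^sub>R axis i 1, half_width)" and "n \<equiv> (\<tau> *\<^sub>R axis j 1, half_width)"
  shows "- lorentz m n / sqrt (lorentz m m * lorentz n n) = cos (2 * pi / 5)"
proof -
  have mn: "lorentz m n = - half_width\<^sup>2"
    using assms(1) by (simp add: m_def n_def lorentz_def inner_axis_axis power2_eq_square)
  have mm: "lorentz m m = 1 - half_width\<^sup>2" "lorentz n n = 1 - half_width\<^sup>2"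
    using assms(2,3) by (auto simp: m_def n_def lorentz_def inner_axis_axis power2_eq_square)
  have "half_width\<^sup>2 < 1"
    using half_width_bound zero_le_power2[of half_width] by linarith
  then have "sqrt (lorentz m m * lorentz n n) = 1 - half_width\<^sup>2"
    by (simp add: mm)
  then have "- lorentz m n / sqrt (lorentz m m * lorentz n n) = half_width\<^sup>2 / (1 - half_width\<^sup>2)"
    by (simp only: mn minus_minus)
  also have "\<dots> = cos (2 * pi / 5)"
    using cos_two_pi_fifths by (simp add: half_width_square divide_simps)
  finally show ?thesis .
qed


section \<open>Honeycomb planes and the region that they bound\<close>

text \<open>The perpendicular bisector of an edge of a cube is a midplane of that cube. A midplane cuts
  the honeycomb in a layer of cubes, and meets each of these in a square; these squares form a
  regular tiling with five squares around each vertex. The two boundary components of the layer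
  are tiled by honeycomb squares in the same pattern, one on each side of the midplane. These are
  the honeycomb planes below. They are not totally geodesic: two cubes of the layer meet at each
  of their edges, so that adjacent squares form the angle \<open>4 * pi / 5\<close> measured through the layer.
  The totally geodesic planes through the faces of a cube do not serve here: they meet at the
  angle \<open>2 * pi / 5\<close>, are not tiled by squares of the honeycomb, and cut through cubes.\<close>

definition midplanes :: "point set \<Rightarrow> point set set" where
  "midplanes Q = {bisector x y | x y. (x, y) \<in> cube_edges Q}"

definition layer :: "point set \<Rightarrow> point set set" where
  "layer M = {Q \<in> cubes. M \<in> midplanes Q}"

text \<open>If \<open>(V, W)\<close> is an edge of \<open>Q\<close>, then \<open>honeycomb_plane V W\<close> is the honeycomb plane through
  \<open>V\<close> that contains the face of \<open>Q\<close> at \<open>V\<close> without \<open>W\<close>, and \<open>inner_cubes V W\<close> consists of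
  the cubes on the same side of it as \<open>Q\<close>. The three planes obtained from the edges of \<open>Q\<close> at
  \<open>V\<close> belong to the three pairwise perpendicular midplanes of \<open>Q\<close>.\<close>

definition honeycomb_plane :: "point \<Rightarrow> point \<Rightarrow> point set" where
  "honeycomb_plane V W =
     \<Union> {F. F \<subseteq> nearer V W \<and> (\<exists>Q\<in>layer (bisector V W). F \<in> cube_faces Q)}"

definition inner_cubes :: "point \<Rightarrow> point \<Rightarrow> point set set" where
  "inner_cubes V W = {Q \<in> cubes. Q \<in> layer (bisector V W) \<or> Q \<subseteq> nearer W V}"

definition pyramid :: "point set \<Rightarrow> point \<Rightarrow> point set set" where
  "pyramid Q V = {C \<in> cubes. \<forall>W. (V, W) \<in> cube_edges Q \<longrightarrow> C \<in> inner_cubes V W}"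


section \<open>The graph, its levels, and the types of vertices\<close>

definition pyramid_vertices :: "point set \<Rightarrow> point \<Rightarrow> point set" where
  "pyramid_vertices Q V = (\<Union>C\<in>pyramid Q V. cube_vertices C)"

definition pyramid_edges :: "point set \<Rightarrow> point \<Rightarrow> (point \<times> point) set" where
  "pyramid_edges Q V = (\<Union>C\<in>pyramid Q V. cube_edges C)"

text \<open>The points at graph distance \<open>n\<close> from \<open>V\<close>.\<close>

definition level :: "point set \<Rightarrow> point \<Rightarrow> nat \<Rightarrow> point set" where
  "level Q V n = {u \<in> pyramid_vertices Q V.
     (V, u) \<in> pyramid_edges Q V ^^ n \<and> (\<forall>m<n. (V, u) \<notin> pyramid_edges Q V ^^ m)}"

definition ascendants :: "point set \<Rightarrow> point \<Rightarrow> nat \<Rightarrow> point \<Rightarrow> point set" where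
  "ascendants Q V n u = {w \<in> level Q V (n - 1). (w, u) \<in> pyramid_edges Q V}"

definition on_wall :: "point set \<Rightarrow> point \<Rightarrow> point \<Rightarrow> bool" where
  "on_wall Q V u \<longleftrightarrow> (\<exists>W. (V, W) \<in> cube_edges Q \<and> u \<in> honeycomb_plane V W)"

definition on_axis :: "point set \<Rightarrow> point \<Rightarrow> point \<Rightarrow> bool" where
  "on_axis Q V u \<longleftrightarrow> (\<exists>W W'. W \<noteq> W' \<and> (V, W) \<in> cube_edges Q \<and> (V, W') \<in> cube_edges Q \<and>
     u \<in> honeycomb_plane V W \<inter> honeycomb_plane V W')"

text \<open>The types are meant for \<open>n \<ge> 1\<close>; the sets for \<open>A\<close>, \<dots>, \<open>E\<close> are empty for \<open>n = 0\<close>, since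
  \<open>V\<close> has no ascendants.\<close>

definition type_1 :: "point set \<Rightarrow> point \<Rightarrow> nat \<Rightarrow> point set" where
  "type_1 Q V n = {u \<in> level Q V n. on_axis Q V u}"

definition type_A :: "point set \<Rightarrow> point \<Rightarrow> nat \<Rightarrow> point set" where
  "type_A Q V n = {u \<in> level Q V n. on_wall Q V u \<and> \<not> on_axis Q V u \<and>
     card (ascendants Q V n u) = 2}"

definition type_B :: "point set \<Rightarrow> point \<Rightarrow> nat \<Rightarrow> point set" where
  "type_B Q V n = {u \<in> level Q V n. on_wall Q V u \<and> \<not> on_axis Q V u \<and>
     card (ascendants Q V n u) = 1}"

definition type_C :: "point set \<Rightarrow> point \<Rightarrow> nat \<Rightarrow> point set" where
  "type_C Q V n = {u \<in> level Q V n. \<not> on_wall Q V u \<and> card (ascendants Q V n u) = 3}"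

definition type_D :: "point set \<Rightarrow> point \<Rightarrow> nat \<Rightarrow> point set" where
  "type_D Q V n = {u \<in> level Q V n. \<not> on_wall Q V u \<and> card (ascendants Q V n u) = 2}"

definition type_E :: "point set \<Rightarrow> point \<Rightarrow> nat \<Rightarrow> point set" where
  "type_E Q V n = {u \<in> level Q V n. \<not> on_wall Q V u \<and> card (ascendants Q V n u) = 1}"

end

theory Submission
  imports Defs
begin

text \<open>
  The midplanes of the cubes cut hyperbolic space into right-angled dodecahedra, one around each
  vertex of the honeycomb. Hence the reflections in the twelve midplanes next to a vertex \<open>V\<close> generate
  a right-angled Coxeter group that acts simply transitively on the vertices, and the graph of the
  honeycomb is the Cayley graph of this group: the distance of \<open>w V\<close> from \<open>V\<close> is the length of \<open>w\<close>, and
  the ascendants of \<open>w V\<close> correspond to the right descents of \<open>w\<close>, which form a clique of the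
  icosahedron graph. The vertex \<open>w V\<close> belongs to the pyramid iff each of the three midplanes of the
  cube \<open>Q\<close> either separates it from \<open>V\<close> or is fixed by \<open>w\<close>; in the latter case \<open>w V\<close> lies on the
  corresponding honeycomb plane. Since this condition is inherited by ascendants, counting the
  pairs of a vertex and an ascendant in two ways yields linear recurrences for the numbers of
  vertices with given numbers of walls and of ascendants.
\<close>

text \<open>The honeycomb is defined through reflections in cube faces. These fix vertices, so word
  length in them does not measure graph distance; a midplane reflection moves a vertex along an edge
  instead. The link is that every symmetry used below is a midplane word followed on the right by a
  symmetry that fixes \<open>apex\<close> and permutes the twelve normals. The properties of the
  Coxeter group are read off the signs of \<open>lorentz m (w apex)\<close> by induction on word
  length. The essential geometric input is that two distinct normals are either orthogonal or have
  Lorentz product below -1, and in the latter case their positive half-spaces are disjoint. After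
  rescaling the last coordinate, the normals have entries in Z[phi], so this and all incidence
  tables are integer computations. That \<open>w i = i\<close> describes a honeycomb plane rests on
  a fact about right-angled groups: no element takes one of the twelve normals to another. So the
  mirrors can be labelled consistently, and the state of a vertex is finite data.\<close>

declare split_paired_All [simp del] split_paired_Ex [simp del]

section \<open>Lorentz geometry\<close>

lemma lorentz_simps:
  "lorentz (p + q) r = lorentz p r + lorentz q r"
  "lorentz r (p + q) = lorentz r p + lorentz r q"
  "lorentz (p - q) r = lorentz p r - lorentz q r"
  "lorentz r (p - q) = lorentz r p - lorentz r q"
  "lorentz (c *\<^sub>R p) r = c * lorentz p r"
  "lorentz r (c *\<^sub>R p) = c * lorentz r p"
  "lorentz (- p) r = - lorentz p r"
  "lorentz r (- p) = - lorentz r p"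
  by (auto simp: lorentz_def inner_add_left inner_add_right inner_diff_left inner_diff_right
      algebra_simps)

lemma lorentz_commute: "lorentz p q = lorentz q p"
  by (simp add: lorentz_def inner_commute mult.commute)

lemma timelike_norm:
  assumes "lorentz p p \<le> 0"
  shows "norm (fst p) \<le> \<bar>snd p\<bar>"
proof -
  have "(norm (fst p))\<^sup>2 \<le> (snd p)\<^sup>2"
    using assms by (simp add: lorentz_def power2_norm_eq_inner power2_eq_square[of "snd p"])
  then show ?thesis by (metis abs_le_square_iff abs_norm_cancel)
qed

lemma hyperbolic_space_norm:
  assumes "p \<in> hyperbolic_space"
  shows "norm (fst p) < snd p"
proof -
  have "(norm (fst p))\<^sup>2 < (snd p)\<^sup>2" "0 < snd p"
    using assms by (auto simp: hyperbolic_space_def lorentz_def power2_norm_eq_inner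
        power2_eq_square[of "snd p"])
  then show ?thesis by (meson less_eq_real_def power_less_imp_less_base)
qed

text \<open>Cauchy-Schwarz in the spatial part, both vectors being causal and future-directed.
  Applied to the sum of two normals it yields disjoint half-spaces.\<close>

lemma lorentz_future_nonpos:
  assumes "lorentz z z \<le> 0" "0 \<le> snd z" "p \<in> hyperbolic_space"
  shows "lorentz z p \<le> 0"
proof -
  have "fst z \<bullet> fst p \<le> norm (fst z) * norm (fst p)"
    by (rule norm_cauchy_schwarz)
  also have "\<dots> \<le> snd z * snd p"
    using timelike_norm[OF assms(1)] hyperbolic_space_norm[OF assms(3)] assms(2)
    by (intro mult_mono) auto
  finally show ?thesis by (simp add: lorentz_def)
qed

text \<open>The reversed Cauchy--Schwarz inequality, as far as it is needed: it decides on which sheet of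
  the hyperboloid a point lies.\<close>

lemma hyperbolic_spaceI:
  assumes "p \<in> hyperbolic_space" "lorentz q q = -1" "lorentz p q < 0"
  shows "q \<in> hyperbolic_space"
proof (rule ccontr)
  assume "q \<notin> hyperbolic_space"
  then have "0 \<le> snd (- q)"
    using assms(2) by (simp add: hyperbolic_space_def)
  moreover have "lorentz (- q) (- q) \<le> 0"
    by (simp only: lorentz_simps minus_minus assms(2))
  ultimately have "lorentz (- q) p \<le> 0"
    using lorentz_future_nonpos assms(1) by blast
  then show False
    using assms(3) by (simp only: lorentz_simps lorentz_commute[of q p])
qed

lemma lorentz_hyperbolic_le:
  assumes p: "p \<in> hyperbolic_space" and q: "q \<in> hyperbolic_space"
  shows "lorentz p q < 0"
proof -
  have "fst p \<bullet> fst q \<le> norm (fst p) * norm (fst q)"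
    by (rule norm_cauchy_schwarz)
  also have "\<dots> < snd p * snd q"
    using hyperbolic_space_norm[OF p] hyperbolic_space_norm[OF q]
    by (intro mult_strict_mono) (auto intro: order_le_less_trans[OF norm_ge_zero])
  finally show ?thesis by (simp add: lorentz_def)
qed

text \<open>The sum of two points is timelike, and rescaling it gives their hyperbolic midpoint. It
  supplies a point of a mirror when two mirrors are compared.\<close>

lemma midpoint_in_hyperbolic_space:
  assumes p: "p \<in> hyperbolic_space" and q: "q \<in> hyperbolic_space"
  obtains c where "c > 0" "c *\<^sub>R (p + q) \<in> hyperbolic_space"
proof -
  define k where "k = 2 - 2 * lorentz p q"
  have k: "k > 0" using lorentz_hyperbolic_le[OF p q] by (simp add: k_def)
  have eq: "lorentz (p + q) (p + q) = - k"
    using p q by (simp add: lorentz_simps k_def hyperbolic_space_def lorentz_commute)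
  define c where "c = 1 / sqrt k"
  have "c * (c * k) = 1" using k by (simp add: c_def)
  then have "lorentz (c *\<^sub>R (p + q)) (c *\<^sub>R (p + q)) = -1"
    by (simp only: lorentz_simps(5,6) eq)
  moreover have "c > 0" using k by (simp add: c_def)
  moreover have "snd (c *\<^sub>R (p + q)) > 0"
    using p q \<open>c > 0\<close> by (simp add: hyperbolic_space_def)
  ultimately show thesis
    by (intro that[of c]) (simp_all add: hyperbolic_space_def del: fst_scaleR snd_scaleR)
qed

section \<open>Reflections in spacelike normals\<close>

lemma reflection_add: "reflection n (p + q) = reflection n p + reflection n q"
proof -
  have "2 * lorentz (p + q) n / lorentz n n
      = 2 * lorentz p n / lorentz n n + 2 * lorentz q n / lorentz n n"
    by (simp only: lorentz_simps(1) distrib_left add_divide_distrib)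
  then show ?thesis
    by (simp only: reflection_def scaleR_add_left add_diff_add)
qed

lemma reflection_scale: "reflection n (c *\<^sub>R p) = c *\<^sub>R reflection n p"
  by (simp only: reflection_def lorentz_simps(5) scaleR_diff_right scaleR_scaleR mult.left_commute
      times_divide_eq_right)

lemma linear_reflection: "linear (reflection n)"
  by (rule linearI) (rule reflection_add reflection_scale)+

lemma lorentz_reflection_normal:
  assumes "lorentz n n > 0"
  shows "lorentz (reflection n p) n = - lorentz p n"
  using assms by (simp add: reflection_def lorentz_simps)

lemma reflection_involutive:
  assumes "lorentz n n > 0"
  shows "reflection n (reflection n p) = p"
proof -
  define c where "c = 2 * lorentz p n / lorentz n n"
  have "reflection n (reflection n p) = reflection n p - (- c) *\<^sub>R n"
    unfolding reflection_def[of n "reflection n p"] lorentz_reflection_normal[OF assms]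
    by (simp add: c_def)
  also have "\<dots> = p"
    unfolding reflection_def[of n p] c_def[symmetric] by simp
  finally show ?thesis .
qed

lemma lorentz_reflection:
  assumes "lorentz n n > 0"
  shows "lorentz (reflection n p) (reflection n q) = lorentz p q"
proof -
  have "lorentz (reflection n p) (reflection n q)
      = lorentz (reflection n p) q
        - 2 * lorentz q n / lorentz n n * lorentz (reflection n p) n"
    by (simp only: reflection_def[of n q] lorentz_simps)
  also have "\<dots> = lorentz p q"
    using assms by (simp add: lorentz_reflection_normal)
      (simp add: reflection_def lorentz_simps lorentz_commute[of n q])
  finally show ?thesis .
qed

lemma reflection_hyperbolic_space:
  assumes "lorentz n n > 0" "p \<in> hyperbolic_space"
  shows "reflection n p \<in> hyperbolic_space"
proof (rule hyperbolic_spaceI[OF assms(2)])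
  show "lorentz (reflection n p) (reflection n p) = -1"
    using assms by (simp add: lorentz_reflection hyperbolic_space_def)
  \<comment> \<open>Since \<open>x\<close> is nonnegative, the product -1 - x is negative and the
    image stays on the upper sheet.\<close>
  define x where "x = 2 * (lorentz p n)\<^sup>2 / lorentz n n"
  have "lorentz p (reflection n p) = -1 - x"
    using assms by (simp add: reflection_def lorentz_simps hyperbolic_space_def power2_eq_square
        x_def)
  moreover have "0 \<le> x"
    using assms(1) by (simp add: x_def)
  ultimately show "lorentz p (reflection n p) < 0" by simp
qed

lemma reflection_uminus: "reflection (- n) = reflection n"
  by (rule ext) (simp only: reflection_def lorentz_simps(7,8) mult_minus_right minus_divide_left
      [symmetric] scaleR_minus_left scaleR_minus_right minus_minus)

lemma reflection_self:
  assumes "lorentz n n > 0"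
  shows "reflection n n = - n"
proof -
  have "n - 2 *\<^sub>R n = (1 - 2) *\<^sub>R n"
    by (simp only: scaleR_diff_left scaleR_one)
  then show ?thesis using assms by (simp add: reflection_def)
qed

lemma reflection_orthogonal:
  assumes "lorentz m n = 0"
  shows "reflection n m = m"
  using assms by (simp add: reflection_def)


section \<open>Linear Lorentz isometries preserving hyperbolic space\<close>

definition isometries :: "(point \<Rightarrow> point) set" where
  "isometries = {g. linear g \<and> bij g \<and> (\<forall>p q. lorentz (g p) (g q) = lorentz p q)
     \<and> g ` hyperbolic_space = hyperbolic_space}"

lemma isometriesD:
  assumes "g \<in> isometries"
  shows "linear g" "bij g" "inj g" "lorentz (g p) (g q) = lorentz p q"
    "g ` hyperbolic_space = hyperbolic_space" "g p \<in> hyperbolic_space \<longleftrightarrow> p \<in> hyperbolic_space"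
proof -
  show *: "linear g" "bij g" "lorentz (g p) (g q) = lorentz p q"
    "g ` hyperbolic_space = hyperbolic_space"
    using assms by (auto simp: isometries_def)
  then show "inj g" by (simp add: bij_is_inj)
  then show "g p \<in> hyperbolic_space \<longleftrightarrow> p \<in> hyperbolic_space"
    using *(4) inj_image_mem_iff[of g p hyperbolic_space] by simp
qed

lemma isometry_simps:
  assumes "g \<in> isometries"
  shows "g (p + q) = g p + g q" "g (p - q) = g p - g q" "g (- p) = - g p"
    "g (c *\<^sub>R p) = c *\<^sub>R g p"
  using isometriesD(1)[OF assms]
  by (auto simp: linear_add linear_diff linear_neg linear_scale)

lemma reflection_isometry:
  assumes n: "lorentz n n > 0"
  shows "reflection n \<in> isometries"
proof -
  have inv: "reflection n \<circ> reflection n = id"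
    using reflection_involutive[OF n] by auto
  then have "bij (reflection n)" by (rule o_bij) (rule inv)
  moreover have "reflection n ` hyperbolic_space = hyperbolic_space"
  proof (intro subset_antisym subsetI)
    fix p assume "p \<in> hyperbolic_space"
    then have "reflection n p \<in> hyperbolic_space" by (rule reflection_hyperbolic_space[OF n])
    then show "p \<in> reflection n ` hyperbolic_space"
      using reflection_involutive[OF n, of p] by (metis image_eqI)
  qed (auto intro: reflection_hyperbolic_space[OF n])
  ultimately show ?thesis
    by (simp add: isometries_def linear_reflection lorentz_reflection[OF n])
qed

lemma id_isometry: "id \<in> isometries"
  by (simp add: isometries_def real_vector.linear_id)

lemma comp_isometry:
  assumes "g \<in> isometries" "h \<in> isometries"
  shows "g \<circ> h \<in> isometries"
proof -
  have "(g \<circ> h) ` hyperbolic_space = hyperbolic_space"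
    by (simp only: image_comp[symmetric] isometriesD(5)[OF assms(1)] isometriesD(5)[OF assms(2)])
  then show ?thesis
    using assms by (simp add: isometries_def bij_comp linear_compose)
qed

text \<open>A reflection is built from linear operations and the Lorentz form alone. This is the
  rule by which reflections are moved past group elements throughout.\<close>

lemma isometry_reflection:
  assumes "g \<in> isometries"
  shows "g \<circ> reflection n = reflection (g n) \<circ> g"
  by (rule ext) (simp add: reflection_def isometry_simps[OF assms] isometriesD(4)[OF assms])

lemma isometry_bisector:
  assumes "g \<in> isometries"
  shows "bisector (g x) (g y) = g ` bisector x y"
proof -
  have "p \<in> g ` bisector x y" if "p \<in> bisector (g x) (g y)" for p
  proof -
    from that isometriesD(5)[OF assms] obtain q where q: "q \<in> hyperbolic_space" "p = g q"
      unfolding bisector_def by blast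
    with that show ?thesis by (auto simp: bisector_def isometriesD(4)[OF assms])
  qed
  then show ?thesis
    by (auto simp: bisector_def isometriesD[OF assms])
qed

lemma isometry_nearer:
  assumes "g \<in> isometries"
  shows "nearer (g x) (g y) = g ` nearer x y"
proof -
  have "p \<in> g ` nearer x y" if "p \<in> nearer (g x) (g y)" for p
  proof -
    from that isometriesD(5)[OF assms] obtain q where q: "q \<in> hyperbolic_space" "p = g q"
      unfolding nearer_def by blast
    with that show ?thesis by (auto simp: nearer_def isometriesD(4)[OF assms])
  qed
  then show ?thesis
    by (auto simp: nearer_def isometriesD[OF assms])
qed


section \<open>Coordinates over the ring generated by the golden ratio\<close>

definition phi :: real where "phi = (1 + sqrt 5) / 2"

lemma phi_mult: "phi * phi = phi + 1" "phi * (phi * x) = (phi + 1) * x"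
proof -
  show *: "phi * phi = phi + 1"
    by (simp add: phi_def field_simps)
  then show "phi * (phi * x) = (phi + 1) * x"
    by (metis mult.assoc)
qed

lemma phi_gt: "8 / 5 < phi" "phi < 2"
proof -
  have "sqrt 5 > 11/5" by (rule real_less_rsqrt) (simp add: power2_eq_square)
  moreover have "sqrt 5 < 3" by (rule real_less_lsqrt) auto
  ultimately show "8 / 5 < phi" "phi < 2" by (auto simp: phi_def)
qed

text \<open>The angle t = 2 pi / 5 satisfies cos (3 t) = cos (2 t). As a polynomial in x = cos t
  this has the factor x - 1; the other factor is quadratic and gives x = (phi - 1) / 2.\<close>

lemma half_width_phi: "half_width\<^sup>2 = 2 * phi - 3"
proof -
  define x where "x = cos (2 * pi / 5)"
  have "3 * (2 * pi / 5) = 2 * pi - 2 * (2 * pi / 5)" by simp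
  then have "cos (3 * (2 * pi / 5)) = cos (2 * pi - 2 * (2 * pi / 5))" by (simp only:)
  also have "\<dots> = cos (2 * (2 * pi / 5))" by (simp only: cos_diff) simp
  finally have "4 * x ^ 3 - 3 * x = 2 * x\<^sup>2 - 1"
    unfolding cos_treble_cos cos_double_cos x_def .
  then have "(x - 1) * (4 * x\<^sup>2 + 2 * x - 1) = 0"
    by (simp add: algebra_simps power3_eq_cube power2_eq_square)
  then have x: "4 * x\<^sup>2 + 2 * x - 1 = 0" and pos: "x > 0"
    using cos_two_pi_fifths by (auto simp: x_def)
  have "(4 * x + 1)\<^sup>2 = 5"
    using x by (simp add: power2_eq_square algebra_simps)
  then have "4 * x + 1 = sqrt 5" using pos by (simp add: real_sqrt_unique)
  then have "x = (phi - 1) / 2" by (simp add: phi_def)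
  moreover have "half_width\<^sup>2 = x / (1 + x)" by (simp add: half_width_square x_def)
  moreover have "(phi - 1) / 2 / (1 + (phi - 1) / 2) = (phi - 1) / (phi + 1)"
    using phi_gt by (simp add: divide_simps) (simp add: algebra_simps)
  ultimately have "half_width\<^sup>2 = (phi - 1) / (phi + 1)"
    by (simp only:)
  also have "\<dots> = 2 * phi - 3"
    using phi_gt by (simp add: field_simps phi_mult)
  finally show ?thesis .
qed

lemma half_width_pos: "half_width > 0"
  using cos_two_pi_fifths by (simp add: half_width_def)

text \<open>With the last coordinate rescaled in this way, everything below has coordinates in
  \<open>\<int>[phi]\<close>.\<close>

definition pt :: "real \<Rightarrow> real \<Rightarrow> real \<Rightarrow> real \<Rightarrow> point" where
  "pt a b c d = (vector [a, b, c], d / half_width)"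

text \<open>The weight \<open>2 * phi + 1\<close> is the inverse of the square of
  \<open>half_width\<close>, because (2 phi - 3) (2 phi + 1) = 1.\<close>

lemma lorentz_pt:
  "lorentz (pt a b c d) (pt a' b' c' d') = a * a' + b * b' + c * c' - (2 * phi + 1) * (d * d')"
proof -
  have "d / half_width * (d' / half_width) = d * d' / half_width\<^sup>2"
    by (simp add: power2_eq_square)
  also have "\<dots> = (2 * phi + 1) * (d * d')"
    using phi_gt by (simp add: half_width_phi field_simps phi_mult)
  finally show ?thesis
    by (simp add: lorentz_def pt_def inner_vec_def sum_3)
qed

lemma pt_eq_iff: "pt a b c d = pt a' b' c' d' \<longleftrightarrow> a = a' \<and> b = b' \<and> c = c' \<and> d = d'"
  using half_width_pos by (auto simp: pt_def vec_eq_iff forall_3)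

lemma pt_cases: obtains a b c d where "p = pt a b c d"
proof -
  have "p = pt (fst p $ 1) (fst p $ 2) (fst p $ 3) (half_width * snd p)"
    using half_width_pos by (simp add: pt_def prod_eq_iff vec_eq_iff forall_3)
  then show thesis by (rule that)
qed

lemma pt_arith:
  "pt a b c d + pt a' b' c' d' = pt (a + a') (b + b') (c + c') (d + d')"
  "pt a b c d - pt a' b' c' d' = pt (a - a') (b - b') (c - c') (d - d')"
  "- pt a b c d = pt (- a) (- b) (- c) (- d)"
  "x *\<^sub>R pt a b c d = pt (x * a) (x * b) (x * c) (x * d)"
  by (auto simp: pt_def prod_eq_iff vec_eq_iff forall_3 add_divide_distrib diff_divide_distrib)

lemma fst_pt: "fst (pt a b c d) $ 1 = a" "fst (pt a b c d) $ 2 = b" "fst (pt a b c d) $ 3 = c"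
  by (auto simp: pt_def)

lemma snd_pt: "half_width * snd (pt a b c d) = d" "snd (pt a b c d) > 0 \<longleftrightarrow> d > 0"
    "snd (pt a b c d) \<ge> 0 \<longleftrightarrow> d \<ge> 0"
  using half_width_pos by (auto simp: pt_def zero_le_divide_iff zero_less_divide_iff)

lemma face_normals_eq:
  "face_normals = range (\<lambda>i. (axis i 1, half_width)) \<union> range (\<lambda>i. (- axis i 1, half_width))"
proof (rule subset_antisym)
  show "face_normals \<subseteq> range (\<lambda>i. (axis i 1, half_width)) \<union> range (\<lambda>i. (- axis i 1, half_width))"
    by (auto simp: face_normals_def)
  have "(axis i 1, half_width) \<in> face_normals" for i
    unfolding face_normals_def by (rule CollectI, rule exI[of _ 1], rule exI[of _ i]) simp
  moreover have "(- axis i 1, half_width) \<in> face_normals" for i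
    unfolding face_normals_def by (rule CollectI, rule exI[of _ "-1"], rule exI[of _ i]) simp
  ultimately show "range (\<lambda>i. (axis i 1, half_width)) \<union> range (\<lambda>i. (- axis i 1, half_width)) \<subseteq> face_normals"
    by blast
qed

lemma base_cube_pt:
  "pt a b c d \<in> base_cube \<longleftrightarrow>
     pt a b c d \<in> hyperbolic_space \<and> \<bar>a\<bar> \<le> d \<and> \<bar>b\<bar> \<le> d \<and> \<bar>c\<bar> \<le> d"
proof -
  have "half_width * (d / half_width) = d" using half_width_pos by simp
  then have "lorentz (pt a b c d) (\<sigma> *\<^sub>R axis i 1, half_width) \<le> 0
      \<longleftrightarrow> \<sigma> * fst (pt a b c d) $ i \<le> d" for \<sigma> and i :: 3
    by (simp add: lorentz_def inner_axis pt_def mult.commute)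
  from this[of 1] this[of "-1"] have *:
    "lorentz (pt a b c d) (axis i 1, half_width) \<le> 0 \<longleftrightarrow> fst (pt a b c d) $ i \<le> d"
    "lorentz (pt a b c d) (- axis i 1, half_width) \<le> 0 \<longleftrightarrow> - (fst (pt a b c d) $ i) \<le> d"
    for i :: 3
    by simp_all
  have "(\<forall>n\<in>face_normals. lorentz (pt a b c d) n \<le> 0)
      \<longleftrightarrow> (\<forall>i. fst (pt a b c d) $ i \<le> d) \<and> (\<forall>i. - (fst (pt a b c d) $ i) \<le> d)"
    by (simp add: face_normals_eq ball_Un *)
  then show ?thesis
    by (auto simp: base_cube_def forall_3 fst_pt)
qed

text \<open>The pair \<open>(a, b)\<close> stands for \<open>a + b * phi\<close>.\<close>

type_synonym zphi = "int \<times> int"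

definition zval :: "zphi \<Rightarrow> real" where
  "zval z = of_int (fst z) + of_int (snd z) * phi"

fun zadd :: "zphi \<Rightarrow> zphi \<Rightarrow> zphi" where
  "zadd (a, b) (c, d) = (a + c, b + d)"

fun zmul :: "zphi \<Rightarrow> zphi \<Rightarrow> zphi" where
  "zmul (a, b) (c, d) = (a * c + b * d, a * d + b * c + b * d)"

type_synonym zvec = "zphi \<times> zphi \<times> zphi \<times> zphi"

text \<open>The pair (-1, -2) is - (2 phi + 1), the weight of the last coordinate in
  \<open>lorentz_pt\<close>.\<close>

fun zform :: "zvec \<Rightarrow> zvec \<Rightarrow> zphi" where
  "zform (a, b, c, d) (a', b', c', d') =
     zadd (zmul a a') (zadd (zmul b b') (zadd (zmul c c') (zmul (-1, -2) (zmul d d'))))"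

fun zpt :: "zvec \<Rightarrow> point" where
  "zpt (a, b, c, d) = pt (zval a) (zval b) (zval c) (zval d)"

lemma zval_zadd: "zval (zadd x y) = zval x + zval y"
  by (cases x; cases y) (simp add: zval_def algebra_simps)

lemma zval_zmul: "zval (zmul x y) = zval x * zval y"
  by (cases x; cases y) (simp add: zval_def algebra_simps phi_mult)

lemma lorentz_zpt: "lorentz (zpt u) (zpt v) = zval (zform u v)"
  by (cases u rule: prod_cases4; cases v rule: prod_cases4)
    (simp add: lorentz_pt zval_zadd zval_zmul zval_def[of "(-1, -2)"] algebra_simps)

text \<open>The normals of the bisectors of the twelve edges at the vertex \<open>apex\<close> of the base cube; the
  first three belong to the edges of the base cube.\<close>

definition normal_table :: "zvec list" where
  "normal_table =
    [((1, 0), (0, 0), (0, 0), (0, 0)),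
     ((0, 0), (1, 0), (0, 0), (0, 0)),
     ((0, 0), (0, 0), (1, 0), (0, 0)),
     ((0, -1), (0, 0), (0, 0), (-1, 1)),
     ((0, 0), (0, -1), (0, 0), (-1, 1)),
     ((0, 0), (0, 0), (0, -1), (-1, 1)),
     ((0, 0), (0, -1), (0, -1), (1, 0)),
     ((0, -1), (0, 0), (0, -1), (1, 0)),
     ((0, -1), (0, -1), (0, 0), (1, 0)),
     ((-1, -1), (0, -1), (0, -1), (0, 1)),
     ((0, -1), (-1, -1), (0, -1), (0, 1)),
     ((0, -1), (0, -1), (-1, -1), (0, 1))]"

text \<open>The icosahedron graph: orthogonality of the normals.\<close>

definition neighbours :: "nat list list" where
  "neighbours =
    [[1, 2, 4, 5, 6], [0, 2, 3, 5, 7], [0, 1, 3, 4, 8], [1, 2, 7, 8, 9], [0, 2, 6, 8, 10],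
     [0, 1, 6, 7, 11], [0, 4, 5, 10, 11], [1, 3, 5, 9, 11], [2, 3, 4, 9, 10], [3, 7, 8, 10, 11],
     [4, 6, 8, 9, 11], [5, 6, 7, 9, 10]]"

definition adjacent :: "nat \<Rightarrow> nat \<Rightarrow> bool" where
  "adjacent i j \<longleftrightarrow> List.member (neighbours ! i) j"

definition nrm :: "nat \<Rightarrow> point" where
  "nrm i = zpt (normal_table ! i)"

definition normals :: "point set" where
  "normals = nrm ` {..<12}"

text \<open>The factor normalizes the vector (-1, -1, -1, 1), whose Lorentz square is 3 - (2 phi +
  1) = 2 - 2 phi.\<close>

definition apex :: point where
  "apex = (1 / sqrt (2 * phi - 2)) *\<^sub>R pt (-1) (-1) (-1) 1"

text \<open>The nested conditional expresses that non-adjacent normals have product - phi or - phi -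
  1, the values at distance 2 and at antipodes of the icosahedron. Both are below -1.\<close>

lemma gram_table:
  "\<forall>i\<in>set [0..<12]. \<forall>j\<in>set [0..<12]. zform (normal_table ! i) (normal_table ! j) =
     (if i = j then (1, 0) else if adjacent i j then (0, 0)
      else if zform (normal_table ! i) (normal_table ! j) = (0, -1) then (0, -1) else (-1, -1))"
  by code_simp

lemma apex_table:
  "\<forall>i\<in>set [0..<12].
     zform ((-1, 0), (-1, 0), (-1, 0), (1, 0)) (normal_table ! i) = (-1, 0)"
  by code_simp

text \<open>The last coordinates 0, phi - 1, 1 and phi are nonnegative, so that sums of normals are
  future-directed.\<close>

lemma height_table:
  "\<forall>i\<in>set [0..<12]. snd (snd (snd (normal_table ! i))) \<in> {(0, 0), (-1, 1), (1, 0), (0, 1)}"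
  by code_simp

lemma lorentz_nrm:
  assumes "i < 12" "j < 12"
  shows "i = j \<Longrightarrow> lorentz (nrm i) (nrm j) = 1"
    and "i \<noteq> j \<Longrightarrow> adjacent i j \<Longrightarrow> lorentz (nrm i) (nrm j) = 0"
    and "i \<noteq> j \<Longrightarrow> \<not> adjacent i j \<Longrightarrow> lorentz (nrm i) (nrm j) < -1"
  using gram_table[rule_format, of i j] assms phi_gt
  by (auto simp: nrm_def lorentz_zpt zval_def split: if_splits)

lemma nrm_eq_iff: "i < 12 \<Longrightarrow> j < 12 \<Longrightarrow> nrm i = nrm j \<longleftrightarrow> i = j"
  using lorentz_nrm(1)[of i i] lorentz_nrm(2,3)[of i j] by fastforce

lemma lorentz_nrm_0:
  assumes "i < 12" "j < 12"
  shows "lorentz (nrm i) (nrm j) = 0 \<longleftrightarrow> i \<noteq> j \<and> adjacent i j"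
  using lorentz_nrm[OF assms] by (cases "i = j"; cases "adjacent i j") auto

lemma normals_unit: "n \<in> normals \<Longrightarrow> lorentz n n = 1"
  by (auto simp: normals_def lorentz_nrm(1))

lemma normals_cases:
  assumes "m \<in> normals" "n \<in> normals"
  obtains "m = n" | "m \<noteq> n" "lorentz m n = 0" | "m \<noteq> n" "lorentz m n < -1"
proof -
  obtain i j where ij: "i < 12" "j < 12" "m = nrm i" "n = nrm j"
    using assms by (auto simp: normals_def)
  show thesis
    using lorentz_nrm[OF ij(1,2)] nrm_eq_iff[OF ij(1,2)] that ij(3,4) by blast
qed

lemma finite_normals: "finite normals"
  by (simp add: normals_def)

lemma snd_normals: "n \<in> normals \<Longrightarrow> snd n \<ge> 0"
proof -
  assume "n \<in> normals"
  then obtain i where i: "i < 12" "n = nrm i" by (auto simp: normals_def)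
  obtain a b c d where t: "normal_table ! i = (a, b, c, d)" by (cases "normal_table ! i")
  have "d \<in> {(0, 0), (-1, 1), (1, 0), (0, 1)}"
    using height_table[rule_format, of i] i t by simp
  then have "zval d \<ge> 0" using phi_gt by (auto simp: zval_def)
  then show "snd n \<ge> 0" by (simp add: i(2) nrm_def t snd_pt)
qed

text \<open>The value is the same for all twelve normals: \<open>apex\<close> is the centre of its
  dodecahedron.\<close>

lemma lorentz_normal_apex:
  assumes "n \<in> normals"
  shows "lorentz n apex = - (1 / sqrt (2 * phi - 2))"
proof -
  obtain i where i: "i < 12" "n = nrm i" using assms by (auto simp: normals_def)
  have "pt (-1) (-1) (-1) 1 = zpt ((-1, 0), (-1, 0), (-1, 0), (1, 0))"
    by (simp add: zval_def)
  moreover have "zform ((-1, 0), (-1, 0), (-1, 0), (1, 0)) (normal_table ! i) = (-1, 0)"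
    using apex_table i(1) by simp
  ultimately have "lorentz (pt (-1) (-1) (-1) 1) n = zval (-1, 0)"
    by (simp only: i(2) nrm_def lorentz_zpt)
  then have "lorentz (pt (-1) (-1) (-1) 1) n = -1"
    by (simp add: zval_def)
  then show ?thesis
    by (simp add: apex_def lorentz_simps lorentz_commute[of n "pt _ _ _ _"])
qed

lemma lorentz_normal_apex_neg: "n \<in> normals \<Longrightarrow> lorentz n apex < 0"
  using phi_gt by (simp add: lorentz_normal_apex)

lemma apex_in_hyperbolic_space: "apex \<in> hyperbolic_space"
proof -
  define c where "c = 1 / sqrt (2 * phi - 2)"
  have c: "c * c = 1 / (2 * phi - 2)" "c > 0"
    using phi_gt by (auto simp: c_def)
  have "lorentz apex apex = (c * c) * (2 - 2 * phi)"
    by (simp only: apex_def c_def[symmetric] lorentz_pt pt_arith) (simp add: algebra_simps)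
  also have "\<dots> = -1" using phi_gt by (simp add: c divide_simps)
  finally show ?thesis
    using c by (simp add: hyperbolic_space_def apex_def c_def[symmetric] pt_arith snd_pt)
qed

text \<open>The mirrors are ultraparallel: \<open>m + n\<close> has Lorentz square 2 + 2
  \<open>lorentz m n\<close> < 0 and is future-directed, so its product with every point of
  hyperbolic space is nonpositive.\<close>

lemma halfspaces_disjoint:
  assumes "m \<in> normals" "n \<in> normals" "lorentz m n < -1" "p \<in> hyperbolic_space"
    "lorentz m p > 0"
  shows "lorentz n p < 0"
proof -
  have "lorentz (m + n) (m + n) \<le> 0"
    using assms(1-3) by (simp add: lorentz_simps normals_unit lorentz_commute[of n m])
  moreover have "snd (m + n) \<ge> 0"
    using snd_normals[OF assms(1)] snd_normals[OF assms(2)] by simp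
  ultimately have "lorentz (m + n) p \<le> 0"
    using lorentz_future_nonpos assms(4) by blast
  then show ?thesis using assms(5) by (simp add: lorentz_simps)
qed

lemma lorentz_reflection_normal_left:
  assumes "n \<in> normals"
  shows "lorentz m (reflection n p) = lorentz m p - 2 * lorentz m n * lorentz n p"
  using normals_unit[OF assms]
  by (simp add: reflection_def lorentz_simps lorentz_commute[of p n])

lemma reflection_normal_isometry: "n \<in> normals \<Longrightarrow> reflection n \<in> isometries"
  by (simp add: reflection_isometry normals_unit)

lemma reflection_normal_involutive:
  "n \<in> normals \<Longrightarrow> reflection n (reflection n p) = p"
  "n \<in> normals \<Longrightarrow> reflection n \<circ> reflection n = id"
  "n \<in> normals \<Longrightarrow> reflection n \<circ> (reflection n \<circ> w) = w"
  "n \<in> normals \<Longrightarrow> w \<circ> reflection n \<circ> reflection n = w"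
  by (auto simp: reflection_involutive normals_unit fun_eq_iff)


lemma inv_reflection: "lorentz n n > 0 \<Longrightarrow> inv (reflection n) = reflection n"
  by (rule inv_unique_comp) (auto simp: reflection_involutive fun_eq_iff)

lemma inv_reflection_normal: "n \<in> normals \<Longrightarrow> inv (reflection n) = reflection n"
  by (simp add: inv_reflection normals_unit)

lemma lorentz_normal_reflected_apex: "n \<in> normals \<Longrightarrow> lorentz n (reflection n apex) > 0"
  using lorentz_normal_apex_neg
  by (simp add: lorentz_reflection_normal_left normals_unit)

section \<open>The right-angled Coxeter group acting simply transitively on the vertices\<close>

primrec words :: "nat \<Rightarrow> (point \<Rightarrow> point) set" where
  "words 0 = {id}"
| "words (Suc k) = {reflection n \<circ> w | n w. n \<in> normals \<and> w \<in> words k}"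

definition weyl :: "(point \<Rightarrow> point) set" where
  "weyl = (\<Union>k. words k)"

definition len :: "(point \<Rightarrow> point) \<Rightarrow> nat" where
  "len w = (LEAST k. w \<in> words k)"

lemma words_comp: "u \<in> words j \<Longrightarrow> v \<in> words k \<Longrightarrow> u \<circ> v \<in> words (j + k)"
proof (induction j arbitrary: u)
  case (Suc j)
  then obtain n w where nw: "n \<in> normals" "w \<in> words j" "u = reflection n \<circ> w" by auto
  have "u \<circ> v = reflection n \<circ> (w \<circ> v)" by (simp only: nw(3) comp_assoc)
  with Suc.IH[OF nw(2) Suc.prems(2)] nw(1) show ?case
    unfolding words.simps add_Suc by blast
qed simp

lemma words_1: "n \<in> normals \<Longrightarrow> reflection n \<in> words 1"
  by auto

lemma words_isometry: "w \<in> words k \<Longrightarrow> w \<in> isometries"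
  by (induction k arbitrary: w)
    (auto intro: id_isometry comp_isometry reflection_normal_isometry)

lemma words_inv: "w \<in> words k \<Longrightarrow> inv w \<in> words k"
proof (induction k arbitrary: w)
  case (Suc k)
  then obtain n v where nv: "n \<in> normals" "v \<in> words k" "w = reflection n \<circ> v"
    by auto
  have "inv w = inv v \<circ> inv (reflection n)"
    using nv(3) o_inv_distrib[of "reflection n" v]
      isometriesD(2)[OF words_isometry[OF nv(2)]]
      isometriesD(2)[OF reflection_normal_isometry[OF nv(1)]] by simp
  also have "inv (reflection n) = reflection n" by (rule inv_reflection_normal[OF nv(1)])
  finally show ?case
    using words_comp[OF Suc.IH[OF nv(2)] words_1[OF nv(1)]] by (simp only: Suc_eq_plus1)
qed simp

lemma len_words: "w \<in> weyl \<Longrightarrow> w \<in> words (len w)"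
  unfolding len_def weyl_def by (auto intro: LeastI)

lemma len_le: "w \<in> words k \<Longrightarrow> len w \<le> k"
  unfolding len_def by (rule Least_le)

lemma weylI: "w \<in> words k \<Longrightarrow> w \<in> weyl"
  by (auto simp: weyl_def)

lemma weyl_id: "id \<in> weyl"
  by (rule weylI[of _ 0]) simp

lemma len_id: "len id = 0"
  using len_le[of id 0] by simp

lemma weyl_isometry: "w \<in> weyl \<Longrightarrow> w \<in> isometries"
  using words_isometry by (auto simp: weyl_def)

lemma weyl_comp: "u \<in> weyl \<Longrightarrow> v \<in> weyl \<Longrightarrow> u \<circ> v \<in> weyl"
  using words_comp by (fastforce simp: weyl_def)

lemma weyl_reflection: "n \<in> normals \<Longrightarrow> reflection n \<in> weyl"
  using words_1 weylI by blast

lemma weyl_inv: "w \<in> weyl \<Longrightarrow> inv w \<in> weyl"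
  using words_inv by (auto simp: weyl_def)

lemma weyl_inv_comp:
  assumes "w \<in> weyl"
  shows "inv w (w p) = p" "w (inv w p) = p"
  using isometriesD(2)[OF weyl_isometry[OF assms]]
  by (auto simp: bij_is_inj bij_is_surj surj_f_inv_f)

lemma inv_inv_weyl: "w \<in> weyl \<Longrightarrow> inv (inv w) = w"
  using isometriesD(2)[OF weyl_isometry] by (simp add: inv_inv_eq)

lemma len_inv: "w \<in> weyl \<Longrightarrow> len (inv w) = len w"
  using len_le[OF words_inv[OF len_words]] inv_inv_weyl weyl_inv by (metis le_antisym)

lemma len_left: "w \<in> weyl \<Longrightarrow> n \<in> normals \<Longrightarrow> len (reflection n \<circ> w) \<le> Suc (len w)"
  by (rule len_le) (auto dest: len_words)

lemma len_right: "w \<in> weyl \<Longrightarrow> n \<in> normals \<Longrightarrow> len (w \<circ> reflection n) \<le> Suc (len w)"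
  using len_le[OF words_comp[OF len_words words_1]] by simp

lemma len_0: "w \<in> weyl \<Longrightarrow> len w = 0 \<longleftrightarrow> w = id"
  using len_words[of w] len_id by auto

lemma weyl_left_factor:
  assumes "w \<in> weyl" "len w = Suc k"
  obtains n v where "n \<in> normals" "v \<in> weyl" "w = reflection n \<circ> v" "len v = k"
proof -
  obtain n v where nv: "n \<in> normals" "v \<in> words k" "w = reflection n \<circ> v"
    using len_words[OF assms(1)] assms(2) by auto
  have "len v = k"
    using len_le[OF nv(2)] len_left[OF weylI[OF nv(2)] nv(1)] assms(2) nv(3) by simp
  then show thesis using that nv weylI by blast
qed

lemma lorentz_weyl: "w \<in> weyl \<Longrightarrow> lorentz (w p) (w q) = lorentz p q"
  by (rule isometriesD(4)[OF weyl_isometry])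

lemma lorentz_weyl_inv: "w \<in> weyl \<Longrightarrow> lorentz p (w q) = lorentz (inv w p) q"
  using lorentz_weyl[of w "inv w p" q] by (simp add: weyl_inv_comp)

lemma weyl_hyperbolic: "w \<in> weyl \<Longrightarrow> w apex \<in> hyperbolic_space"
  using isometriesD(6)[OF weyl_isometry] apex_in_hyperbolic_space by blast

text \<open>Split off a first letter, \<open>w = reflection n \<circ> v\<close>. Minimality puts
  \<open>v apex\<close> on the negative side of \<open>n\<close>, hence \<open>w apex\<close> on the
  positive side. If \<open>m\<close> is orthogonal to \<open>n\<close>, the reflections commute and
  the claim passes to \<open>v\<close>; if the mirrors are ultraparallel, the positive half-spaces
  are disjoint and \<open>w apex\<close> is negative for \<open>m\<close>.\<close>

lemma left_descent:
  assumes "w \<in> weyl" "m \<in> normals"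
  shows "lorentz m (w apex) \<noteq> 0 \<and> (lorentz m (w apex) > 0 \<longrightarrow> len (reflection m \<circ> w) < len w)"
  using assms
proof (induction "len w" arbitrary: w m rule: less_induct)
  case less
  show ?case
  proof (cases "len w")
    case 0
    then have "w = id" using less.prems len_0 by blast
    then show ?thesis using lorentz_normal_apex_neg[OF less.prems(2)] by simp
  next
    case (Suc k)
    obtain n v where nv: "n \<in> normals" "v \<in> weyl" "w = reflection n \<circ> v" "len v = k"
      using weyl_left_factor[OF less.prems(1) Suc] .
    have nw: "reflection n \<circ> w = v" using nv by (simp add: reflection_normal_involutive)
    have IH: "lorentz i (v apex) \<noteq> 0"
        "lorentz i (v apex) > 0 \<Longrightarrow> len (reflection i \<circ> v) < k" if "i \<in> normals" for i
      using less.hyps[OF _ nv(2) that] nv(4) Suc by auto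
    have "\<not> lorentz n (v apex) > 0"
      using IH(2)[OF nv(1)] nv(3) Suc by auto
    then have pos: "lorentz n (w apex) > 0"
      using IH(1)[OF nv(1)] nv(3) by (simp add: lorentz_reflection_normal_left nv(1) normals_unit)
    show ?thesis
    proof (cases rule: normals_cases[OF less.prems(2) nv(1)])
      case 1
      then show ?thesis using pos nw nv(4) Suc by simp
    next
      case 2
      have eq: "lorentz m (w apex) = lorentz m (v apex)"
        using 2 nv(3) by (simp add: lorentz_reflection_normal_left nv(1))
      have "len (reflection m \<circ> w) < len w" if "lorentz m (v apex) > 0"
      proof -
        have "reflection m n = n"
          using 2 by (simp add: reflection_orthogonal lorentz_commute)
        then have "reflection m \<circ> w = reflection n \<circ> (reflection m \<circ> v)"
          using isometry_reflection[OF reflection_normal_isometry[OF less.prems(2)], of n] nv(3)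
          by (simp add: comp_assoc[symmetric])
        then have "len (reflection m \<circ> w) \<le> Suc (len (reflection m \<circ> v))"
          using len_left[OF weyl_comp[OF weyl_reflection[OF less.prems(2)] nv(2)] nv(1)] by simp
        then show ?thesis using IH(2)[OF less.prems(2) that] Suc by simp
      qed
      then show ?thesis using eq IH(1)[OF less.prems(2)] by simp
    next
      case 3
      then have "lorentz m (w apex) < 0"
        using halfspaces_disjoint[OF nv(1) less.prems(2) _ weyl_hyperbolic[OF less.prems(1)] pos]
        by (simp add: lorentz_commute)
      then show ?thesis by simp
    qed
  qed
qed

lemmas vertex_not_on_wall = left_descent[THEN conjunct1]

lemma len_left_descent:
  assumes "w \<in> weyl" "m \<in> normals"
  shows "lorentz m (w apex) > 0 \<Longrightarrow> len w = Suc (len (reflection m \<circ> w))"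
    and "lorentz m (w apex) < 0 \<Longrightarrow> len (reflection m \<circ> w) = Suc (len w)"
proof -
  have w': "reflection m \<circ> w \<in> weyl" using assms weyl_comp weyl_reflection by blast
  have *: "len w \<le> Suc (len (reflection m \<circ> w))" "len (reflection m \<circ> w) \<le> Suc (len w)"
    using len_left[OF w' assms(2)] len_left[OF assms] assms(2)
    by (simp_all add: reflection_normal_involutive)
  show "len w = Suc (len (reflection m \<circ> w))" if "lorentz m (w apex) > 0"
    using left_descent[OF assms] that * by simp
  show "len (reflection m \<circ> w) = Suc (len w)" if "lorentz m (w apex) < 0"
    using left_descent[OF w' assms(2)] that * assms(2)
    by (simp add: lorentz_reflection_normal_left normals_unit reflection_normal_involutive)
qed

lemma inv_comp_reflection:
  assumes "w \<in> weyl" "n \<in> normals"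
  shows "inv (w \<circ> reflection n) = reflection n \<circ> inv w"
  using o_inv_distrib[OF isometriesD(2)[OF weyl_isometry[OF assms(1)]]
      isometriesD(2)[OF reflection_normal_isometry[OF assms(2)]]] inv_reflection_normal[OF assms(2)]
  by simp

lemma len_right_descent:
  assumes "w \<in> weyl" "m \<in> normals"
  shows "lorentz (w m) apex > 0 \<Longrightarrow> len w = Suc (len (w \<circ> reflection m))"
    and "lorentz (w m) apex < 0 \<Longrightarrow> len (w \<circ> reflection m) = Suc (len w)"
    and "lorentz (w m) apex \<noteq> 0"
proof -
  have l: "len (w \<circ> reflection m) = len (reflection m \<circ> inv w)" "len (inv w) = len w"
    using len_inv[OF weyl_comp[OF assms(1) weyl_reflection[OF assms(2)]]] len_inv[OF assms(1)]
    by (simp_all add: inv_comp_reflection[OF assms])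
  have e: "lorentz (w m) apex = lorentz m (inv w apex)"
    using lorentz_weyl_inv[OF weyl_inv[OF assms(1)], of m apex] inv_inv_weyl[OF assms(1)]
    by (simp add: lorentz_commute)
  show "lorentz (w m) apex > 0 \<Longrightarrow> len w = Suc (len (w \<circ> reflection m))"
    and "lorentz (w m) apex < 0 \<Longrightarrow> len (w \<circ> reflection m) = Suc (len w)"
    and "lorentz (w m) apex \<noteq> 0"
    using len_left_descent[OF weyl_inv[OF assms(1)] assms(2)]
      vertex_not_on_wall[OF weyl_inv[OF assms(1)] assms(2)] by (simp_all add: l e)
qed

text \<open>A shortest word for \<open>w \<noteq> id\<close> begins with some \<open>n\<close>, and
  then \<open>w apex\<close> is positive for \<open>n\<close>. So only \<open>id\<close> keeps
  \<open>apex\<close> in its dodecahedron, which makes the action on the vertices free.\<close>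

lemma weyl_free:
  assumes "w \<in> weyl" "\<And>m. m \<in> normals \<Longrightarrow> lorentz m (w apex) \<le> 0"
  shows "w = id"
proof (rule ccontr)
  assume "w \<noteq> id"
  then obtain k where k: "len w = Suc k" using len_0[OF assms(1)] not0_implies_Suc by blast
  obtain n v where nv: "n \<in> normals" "v \<in> weyl" "w = reflection n \<circ> v" "len v = k"
    using weyl_left_factor[OF assms(1) k] .
  then have "len (reflection n \<circ> w) < len w"
    using k by (simp add: reflection_normal_involutive)
  moreover have "lorentz n (w apex) < 0"
    using assms(2)[OF nv(1)] vertex_not_on_wall[OF assms(1) nv(1)] by simp
  ultimately show False
    using len_left_descent(2)[OF assms(1) nv(1)] by simp
qed

lemma weyl_apex_inj:
  assumes "v \<in> weyl" "w \<in> weyl" "v apex = w apex"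
  shows "v = w"
proof -
  have "inv v (w apex) = apex"
    using weyl_inv_comp(1)[OF assms(1), of apex] by (simp add: assms(3))
  then have "inv v \<circ> w = id"
    using lorentz_normal_apex_neg
    by (intro weyl_free weyl_comp weyl_inv assms) (auto intro: less_imp_le)
  then show ?thesis
    using weyl_inv_comp(2)[OF assms(1)] by (metis comp_apply eq_id_iff ext)
qed

text \<open>Neighbouring vertices are separated by the midplane of their edge only. Comparing
  lengths gives \<open>len x < len (x \<circ> reflection s)\<close>; then the first letter of
  \<open>x\<close> is stripped.\<close>

lemma separating_wall_aux:
  assumes "x \<in> weyl" "m \<in> normals" "s \<in> normals"
    "lorentz m (x apex) < 0" "lorentz m (x (reflection s apex)) > 0"
  shows "x \<circ> reflection s = reflection m \<circ> x"
  using assms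
proof (induction "len x" arbitrary: x m rule: less_induct)
  case less
  note x = less.prems(1) and m = less.prems(2) and s = less.prems(3)
  have y: "x \<circ> reflection s \<in> weyl" using weyl_comp[OF x weyl_reflection[OF s]] .
  have "len (reflection m \<circ> (x \<circ> reflection s)) < len (x \<circ> reflection s)"
    using len_left_descent(1)[OF y m] less.prems(5) by simp
  moreover have "Suc (len x) = len (reflection m \<circ> x)"
    using len_left_descent(2)[OF x m] less.prems(4) by simp
  moreover have "len (reflection m \<circ> x) \<le> Suc (len (reflection m \<circ> (x \<circ> reflection s)))"
    using len_right[OF weyl_comp[OF weyl_reflection[OF m] y] s] s
    by (simp add: comp_assoc reflection_normal_involutive)
  ultimately have longer: "len x < len (x \<circ> reflection s)" by simp
  show ?case
  proof (cases "len x")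
    case 0
    then have "x = id" using x len_0 by blast
    then have "lorentz m (reflection s apex) > 0" using less.prems by simp
    moreover have "lorentz m (reflection s apex) < 0" if "m \<noteq> s"
    proof (cases rule: normals_cases[OF m s])
      case 2
      then show ?thesis
        using lorentz_normal_apex_neg[OF m] by (simp add: lorentz_reflection_normal_left s)
    next
      case 3
      show ?thesis
        using lorentz_normal_reflected_apex[OF s] halfspaces_disjoint[OF s m] 3 weyl_hyperbolic[OF weyl_reflection[OF s]]
        by (simp add: lorentz_commute[of s m])
    qed (use that in simp)
    ultimately have "m = s" by fastforce
    then show ?thesis using \<open>x = id\<close> by simp
  next
    case (Suc k)
    obtain n v where nv: "n \<in> normals" "v \<in> weyl" "x = reflection n \<circ> v" "len v = k"
      using weyl_left_factor[OF x Suc] .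
    have nx: "reflection n \<circ> x = v" using nv by (simp add: reflection_normal_involutive)
    have pos: "lorentz n (x apex) > 0"
      using len_left_descent(2)[OF x nv(1)] vertex_not_on_wall[OF x nv(1)] nx nv(4) Suc
      by (metis lessI linorder_cases not_less_iff_gr_or_eq Suc_lessD)
    show ?thesis
    proof (cases rule: normals_cases[OF m nv(1)])
      case 1
      then show ?thesis using pos less.prems(4) by simp
    next
      case 2
      have "lorentz m (v apex) < 0" "lorentz m (v (reflection s apex)) > 0"
        using less.prems(4,5) 2 nv(3) by (simp_all add: lorentz_reflection_normal_left nv(1))
      then have IH: "v \<circ> reflection s = reflection m \<circ> v"
        using less.hyps[OF _ nv(2) m s] nv(4) Suc by simp
      have "reflection n \<circ> reflection m = reflection m \<circ> reflection n"
        using isometry_reflection[OF reflection_normal_isometry[OF nv(1)], of m] 2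
        by (simp add: reflection_orthogonal)
      then show ?thesis
        using IH nv(3) by (metis comp_assoc)
    next
      case 3
      \<comment> \<open>Here \<open>n\<close> separates the two vertices as well. The induction
        hypothesis for \<open>n\<close> in place of \<open>m\<close> would turn
        \<open>x \<circ> reflection s\<close> into the shorter \<open>v\<close>.\<close>
      have "lorentz n (x (reflection s apex)) < 0"
        using halfspaces_disjoint[OF m nv(1) 3(2) weyl_hyperbolic[OF y]] less.prems(5) by simp
      then have "lorentz n (v apex) < 0" "lorentz n (v (reflection s apex)) > 0"
        using pos nv(3) by (simp_all add: lorentz_reflection_normal_left nv(1) normals_unit)
      then have "v \<circ> reflection s = x"
        using less.hyps[OF _ nv(2) nv(1) s] nv(3,4) Suc by simp
      then have "x \<circ> reflection s = v"
        using s by (metis comp_assoc reflection_normal_involutive(4))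
      then show ?thesis using longer nv(4) Suc by simp
    qed
  qed
qed

text \<open>No vertex lies on a mirror, so the equivalence says that the two signs differ. Equality
  of the two reflections then determines the unit normal up to sign.\<close>

lemma separating_wall:
  assumes "x \<in> weyl" "m \<in> normals" "s \<in> normals"
    "lorentz m (x apex) < 0 \<longleftrightarrow> lorentz m (x (reflection s apex)) > 0"
  shows "x s = m \<or> x s = - m"
proof -
  have y: "x \<circ> reflection s \<in> weyl" using weyl_comp[OF assms(1) weyl_reflection[OF assms(3)]] .
  have "x \<circ> reflection s = reflection m \<circ> x"
  proof (cases "lorentz m (x apex) < 0")
    case True
    then show ?thesis using separating_wall_aux[OF assms(1-3)] assms(4) by simp
  next
    case False
    then have "lorentz m ((x \<circ> reflection s) (reflection s apex)) > 0"
      "lorentz m ((x \<circ> reflection s) apex) < 0"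
      using assms(4) vertex_not_on_wall[OF assms(1,2)] vertex_not_on_wall[OF y assms(2)]
      by (auto simp: reflection_normal_involutive(1)[OF assms(3)])
    then have "x \<circ> reflection s \<circ> reflection s = reflection m \<circ> (x \<circ> reflection s)"
      by (intro separating_wall_aux[OF y assms(2,3)])
    then show ?thesis
      by (metis assms(2,3) reflection_normal_involutive(3,4))
  qed
  then have "reflection (x s) (x p) = reflection m (x p)" for p
    using isometry_reflection[OF weyl_isometry[OF assms(1)], of s] by (metis comp_apply)
  \<comment> \<open>Evaluated at the preimage of \<open>m\<close>, the equality of reflections shows
    that the reflection in \<open>x s\<close> negates \<open>m\<close>.\<close>
  from this[of "inv x m"] have "reflection (x s) m = - m"
    using weyl_inv_comp[OF assms(1)] normals_unit[OF assms(2)] by (simp add: reflection_self)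
  moreover have u: "lorentz (x s) (x s) = 1"
    using lorentz_weyl[OF assms(1)] normals_unit[OF assms(3)] by simp
  ultimately have e: "2 *\<^sub>R m = (2 * lorentz m (x s)) *\<^sub>R x s"
    by (simp add: reflection_def scaleR_2 algebra_simps)
  then have e: "m = lorentz m (x s) *\<^sub>R x s"
    by (metis (no_types, lifting) real_vector.scale_left_imp_eq scaleR_scaleR zero_neq_numeral)
  then have "lorentz m m = (lorentz m (x s))\<^sup>2"
    using u by (metis lorentz_simps(5) lorentz_commute power2_eq_square)
  then have "lorentz m (x s) = 1 \<or> lorentz m (x s) = -1"
    using normals_unit[OF assms(2)] by (simp add: power2_eq_1_iff)
  then show ?thesis using e by (metis minus_equation_iff scaleR_minus1_left scaleR_one)
qed

section \<open>Right descents\<close>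

definition descents :: "(point \<Rightarrow> point) \<Rightarrow> point set" where
  "descents w = {n \<in> normals. lorentz n (inv w apex) > 0}"

lemma descents_iff:
  assumes "w \<in> weyl" "n \<in> normals"
  shows "n \<in> descents w \<longleftrightarrow> lorentz (w n) apex > 0" "n \<notin> descents w \<longleftrightarrow> lorentz (w n) apex < 0"
  using lorentz_weyl_inv[OF weyl_inv[OF assms(1)], of n apex] inv_inv_weyl[OF assms(1)]
    len_right_descent(3)[OF assms] assms(2)
  by (auto simp: descents_def)

lemma descents_not_iff:
  assumes "w \<in> weyl" "n \<in> normals"
  shows "n \<notin> descents w \<longleftrightarrow> lorentz n (inv w apex) < 0"
  using vertex_not_on_wall[OF weyl_inv[OF assms(1)] assms(2)] assms(2)
  by (auto simp: descents_def)

lemma len_descent: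
  assumes "w \<in> weyl" "n \<in> normals"
  shows "n \<in> descents w \<Longrightarrow> len w = Suc (len (w \<circ> reflection n))"
    "n \<notin> descents w \<Longrightarrow> len (w \<circ> reflection n) = Suc (len w)"
  using len_right_descent[OF assms] descents_iff[OF assms] by auto

lemma finite_descents: "finite (descents w)"
  using finite_normals by (simp add: descents_def)

lemma descents_normals: "descents w \<subseteq> normals"
  by (auto simp: descents_def)

lemma inv_id_point: "inv (id :: point \<Rightarrow> point) = id"
  by (rule inv_id)

lemma descents_id: "descents id = {}"
  using lorentz_normal_apex_neg by (force simp: descents_def inv_id_point)

lemma descents_nonempty:
  assumes "w \<in> weyl" "w \<noteq> id"
  shows "descents w \<noteq> {}"
proof
  assume "descents w = {}"
  then have "inv w = id"
    by (intro weyl_free weyl_inv assms(1)) (auto simp: descents_def not_less)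
  then show False
    using inv_inv_weyl[OF assms(1)] inv_id_point assms(2) by simp
qed

lemma inv_weyl_hyperbolic: "w \<in> weyl \<Longrightarrow> inv w apex \<in> hyperbolic_space"
  by (rule weyl_hyperbolic[OF weyl_inv])

text \<open>The point \<open>inv w apex\<close> lies in the positive half-spaces of all descents at
  once, which ultraparallel normals do not permit.\<close>

lemma descents_orthogonal:
  assumes "w \<in> weyl" "m \<in> descents w" "n \<in> descents w" "m \<noteq> n"
  shows "lorentz m n = 0"
proof -
  have mn: "m \<in> normals" "n \<in> normals" "lorentz m (inv w apex) > 0" "lorentz n (inv w apex) > 0"
    using assms by (auto simp: descents_def)
  show ?thesis
  proof (cases rule: normals_cases[OF mn(1,2)])
    case 3
    then show ?thesis
      using halfspaces_disjoint[OF mn(1,2) 3(2) inv_weyl_hyperbolic[OF assms(1)] mn(3)] mn(4)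
      by simp
  qed (use assms(4) in simp_all)
qed

text \<open>After the reflection the point lies in the positive half-space of \<open>n\<close>. This
  rules out every normal ultraparallel to \<open>n\<close>, while signs for orthogonal normals are
  unchanged.\<close>

lemma descents_step:
  assumes w: "w \<in> weyl" and n: "n \<in> normals" "n \<notin> descents w"
  shows "descents (w \<circ> reflection n) = insert n {t \<in> descents w. lorentz t n = 0}"
proof -
  define p where "p = inv w apex"
  have np: "lorentz n p < 0" using descents_not_iff[OF w n(1)] n(2) by (simp add: p_def)
  have p: "reflection n p \<in> hyperbolic_space"
    using reflection_hyperbolic_space inv_weyl_hyperbolic[OF w] normals_unit[OF n(1)]
    by (simp add: p_def)
  have nn: "lorentz n n = 1" "lorentz n (reflection n p) > 0"
    using np normals_unit[OF n(1)] by (simp_all add: lorentz_reflection_normal_left[OF n(1)])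
  have "lorentz t (reflection n p) > 0 \<longleftrightarrow> t = n \<or> lorentz t p > 0 \<and> lorentz t n = 0"
    if t: "t \<in> normals" for t
  proof (cases rule: normals_cases[OF t n(1)])
    case 1
    then show ?thesis using nn by simp
  next
    case 2
    then show ?thesis by (simp add: lorentz_reflection_normal_left[OF n(1)])
  next
    case 3
    then show ?thesis
      using halfspaces_disjoint[OF n(1) t _ p nn(2)] by (simp add: lorentz_commute[of n t])
  qed
  then show ?thesis
    using n(1) by (auto simp: descents_def inv_comp_reflection[OF w n(1)] p_def[symmetric])
qed

text \<open>If \<open>m\<close> were ultraparallel to \<open>n\<close>, it would separate
  \<open>inv w apex\<close> from its neighbour across the mirror of \<open>n\<close>, although the
  mirror of \<open>n\<close> is the only one between them.\<close>

lemma fixed_normal_orthogonal_aux: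
  assumes w: "w \<in> weyl" and n: "n \<in> normals" "n' \<in> normals" "w n = n'" and m: "m \<in> descents w"
  shows "lorentz m n = 0"
proof -
  define x where "x = inv w"
  have x: "x \<in> weyl" unfolding x_def by (rule weyl_inv[OF w])
  have xn: "x n' = n" using weyl_inv_comp(1)[OF w, of n] n(3) by (simp add: x_def)
  have m': "m \<in> normals" "lorentz m (x apex) > 0"
    using m by (auto simp: descents_def x_def)
  define p where "p = x (reflection n' apex)"
  have p: "p = (x \<circ> reflection n') apex" "x \<circ> reflection n' \<in> weyl"
    using weyl_comp[OF x weyl_reflection[OF n(2)]] by (simp_all add: p_def)
  have "lorentz n p > 0"
    using lorentz_weyl[OF x, of n' "reflection n' apex"] xn lorentz_normal_apex_neg[OF n(2)]
    by (simp add: p_def lorentz_reflection_normal_left[OF n(2)] normals_unit[OF n(2)])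
  show ?thesis
  proof (cases rule: normals_cases[OF m'(1) n(1)])
    case 1
    then show ?thesis
      using descents_iff(1)[OF w n(1)] m n(3) lorentz_normal_apex_neg[OF n(2)] by simp
  next
    case 3
    have "\<not> lorentz m p > 0"
      using halfspaces_disjoint[OF m'(1) n(1) 3(2) weyl_hyperbolic[OF p(2)]] \<open>lorentz n p > 0\<close> p(1)
      by auto
    then have "x n' = m \<or> x n' = - m"
      using m'(2) by (intro separating_wall[OF x m'(1) n(2)]) (auto simp: p_def)
    then have "n = - m" using xn 3(1) by auto
    then show ?thesis
      using lorentz_normal_apex_neg[OF n(1)] lorentz_normal_apex_neg[OF m'(1)]
      by (simp add: lorentz_simps)
  qed simp
qed

text \<open>Distinct generators of a right-angled Coxeter group are not conjugate. Every descent of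
  \<open>w\<close> is orthogonal to \<open>n\<close>, so removing it does not change
  \<open>w n\<close>, and the induction ends at \<open>id\<close>.\<close>

lemma normal_type_preserved:
  assumes "w \<in> weyl" "n \<in> normals" "n' \<in> normals" "w n = n'"
  shows "n = n'"
  using assms
proof (induction "len w" arbitrary: w rule: less_induct)
  case less
  show ?case
  proof (cases "w = id")
    case True
    then show ?thesis using less.prems by simp
  next
    case False
    then obtain m where m: "m \<in> descents w" using descents_nonempty less.prems(1) by blast
    then have mN: "m \<in> normals" by (simp add: descents_def)
    have "lorentz n m = 0"
      using fixed_normal_orthogonal_aux[OF less.prems m] by (simp add: lorentz_commute)
    then have "(w \<circ> reflection m) n = n'"
      using less.prems(4) by (simp add: reflection_orthogonal)
    then show ?thesis
      using less.hyps[OF _ weyl_comp[OF less.prems(1) weyl_reflection[OF mN]]]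
        len_descent(1)[OF less.prems(1) mN m] less.prems(2,3) by simp
  qed
qed


section \<open>The vertices of the pyramid\<close>

definition axes :: "point set" where
  "axes = nrm ` {..<3}"

text \<open>The vertex \<open>w apex\<close> lies on the honeycomb plane along the midplane with normal \<open>i\<close> iff \<open>w\<close>
  fixes \<open>i\<close>; see \<open>honeycomb_plane_iff\<close>.\<close>

definition walls :: "(point \<Rightarrow> point) \<Rightarrow> point set" where
  "walls w = {i \<in> axes. w i = i}"

definition pyr :: "(point \<Rightarrow> point) set" where
  "pyr = {w \<in> weyl. \<forall>i\<in>axes. lorentz i (w apex) > 0 \<or> i \<in> walls w}"

lemma axes_normals: "axes \<subseteq> normals"
  by (auto simp: axes_def normals_def)

lemma pyr_weyl: "w \<in> pyr \<Longrightarrow> w \<in> weyl"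
  by (simp add: pyr_def)

lemma walls_iff:
  assumes "w \<in> pyr" "i \<in> axes"
  shows "i \<in> walls w \<longleftrightarrow> lorentz i (w apex) < 0" "i \<notin> walls w \<longleftrightarrow> lorentz i (w apex) > 0"
proof -
  have "lorentz i (w apex) < 0" if "i \<in> walls w"
  proof -
    have "lorentz i (w apex) = lorentz (w i) (w apex)" using that by (simp add: walls_def)
    also have "\<dots> = lorentz i apex" by (rule lorentz_weyl[OF pyr_weyl[OF assms(1)]])
    also have "\<dots> < 0" using lorentz_normal_apex_neg assms(2) axes_normals by blast
    finally show ?thesis .
  qed
  then show "i \<in> walls w \<longleftrightarrow> lorentz i (w apex) < 0" "i \<notin> walls w \<longleftrightarrow> lorentz i (w apex) > 0"
    using assms by (auto simp: pyr_def)
qed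

lemma walls_orthogonal_descents:
  assumes "w \<in> weyl" "i \<in> walls w" "n \<in> descents w"
  shows "lorentz n i = 0"
proof -
  have "i \<in> normals" "w i = i" using assms(2) axes_normals by (auto simp: walls_def)
  then show ?thesis using fixed_normal_orthogonal_aux[OF assms(1) _ _ _ assms(3)] by blast
qed

text \<open>The only mirror crossed by the step is that of \<open>w n\<close>; the sign is
  determined by \<open>w n\<close> being negative at \<open>w apex\<close>.\<close>

lemma crossing_wall:
  assumes w: "w \<in> weyl" and n: "n \<in> normals" and i: "i \<in> normals"
    and "lorentz i (w apex) > 0" "\<not> lorentz i (w (reflection n apex)) > 0"
  shows "w n = - i"
proof -
  have "w n = i \<or> w n = - i"
    using assms(4,5) by (intro separating_wall[OF w i n]) auto
  moreover have "w n \<noteq> i"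
    using lorentz_weyl[OF w, of n apex] assms(4) lorentz_normal_apex_neg[OF n] by auto
  ultimately show ?thesis by simp
qed

text \<open>A descent can spoil the condition for \<open>i\<close> only by crossing its midplane
  back. Then \<open>w n = - i\<close>, so \<open>w \<circ> reflection n\<close> takes
  \<open>n\<close> to \<open>i\<close>; this forces \<open>n = i\<close>, and the ascendant lies on
  the honeycomb plane of \<open>i\<close>.\<close>

lemma pyr_descent:
  assumes "w \<in> pyr" "n \<in> descents w"
  shows "w \<circ> reflection n \<in> pyr"
proof -
  note w = pyr_weyl[OF assms(1)]
  have n: "n \<in> normals" using assms(2) descents_normals by blast
  have w': "w \<circ> reflection n \<in> weyl" using weyl_comp[OF w weyl_reflection[OF n]] .
  have "i \<in> walls (w \<circ> reflection n)"
    if i: "i \<in> axes" and neg: "\<not> lorentz i (w (reflection n apex)) > 0" for i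
  proof (cases "i \<in> walls w")
    case True
    then have "lorentz i n = 0"
      using walls_orthogonal_descents[OF w True assms(2)] by (simp add: lorentz_commute)
    then show ?thesis using True by (simp add: walls_def reflection_orthogonal)
  next
    case False
    have iN: "i \<in> normals" using i axes_normals by blast
    have "w n = - i"
      using crossing_wall[OF w n iN _ neg] walls_iff(2)[OF assms(1) i] False by simp
    then have *: "(w \<circ> reflection n) n = i"
      by (simp add: reflection_self normals_unit[OF n] isometry_simps[OF weyl_isometry[OF w]])
    then have "n = i" using normal_type_preserved[OF w' n iN] by simp
    then show ?thesis using * i by (simp add: walls_def)
  qed
  then show ?thesis using w' by (auto simp: pyr_def)
qed

text \<open>A step with \<open>n = i\<close> leaves the plane of \<open>i\<close> towards the
  inside, a step with \<open>n\<close> orthogonal to \<open>i\<close> stays on that plane, and any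
  other step leaves the pyramid. An ascent never crosses back a midplane that is already behind
  it.\<close>

lemma pyr_ascent:
  assumes "w \<in> pyr" "n \<in> normals" "n \<notin> descents w"
  shows "w \<circ> reflection n \<in> pyr \<longleftrightarrow> (\<forall>i\<in>walls w. n = i \<or> lorentz n i = 0)" (is "?L \<longleftrightarrow> ?R")
    and "w \<circ> reflection n \<in> pyr \<Longrightarrow> walls (w \<circ> reflection n) = walls w - {n}"
proof -
  note w = pyr_weyl[OF assms(1)] and n = assms(2)
  have w': "w \<circ> reflection n \<in> weyl" using weyl_comp[OF w weyl_reflection[OF n]] .
  have nd: "n \<in> descents (w \<circ> reflection n)"
    using descents_step[OF w n assms(3)] by simp
  have off: "i \<notin> walls (w \<circ> reflection n)" if "lorentz i (w (reflection n apex)) > 0" "i \<in> axes" for i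
    using that lorentz_weyl[OF w', of i apex] lorentz_normal_apex_neg[of i] axes_normals
    by (auto simp: walls_def)
  \<comment> \<open>Crossing the midplane of \<open>i\<close> back would make \<open>n\<close> a
    descent.\<close>
  have other: "lorentz i (w (reflection n apex)) > 0" if i: "i \<in> axes" "i \<notin> walls w" for i
  proof (rule ccontr)
    assume "\<not> lorentz i (w (reflection n apex)) > 0"
    moreover have iN: "i \<in> normals" using i axes_normals by blast
    ultimately have "w n = - i"
      using crossing_wall[OF w n iN] walls_iff(2)[OF assms(1) i(1)] i(2) by simp
    then show False
      using descents_iff(2)[OF w n] assms(3) lorentz_normal_apex_neg[OF iN]
      by (simp add: lorentz_simps)
  qed
  \<comment> \<open>As \<open>w\<close> fixes \<open>i\<close>, the sign after the step is that of
    \<open>lorentz i (reflection n apex)\<close>, which does not involve \<open>w\<close>.\<close>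
  have on: "(n = i \<longrightarrow> lorentz i (w (reflection n apex)) > 0)
      \<and> (lorentz n i = 0 \<longrightarrow> i \<in> walls (w \<circ> reflection n))
      \<and> (lorentz i (w (reflection n apex)) > 0 \<longrightarrow> n = i)"
    if i: "i \<in> walls w" for i
  proof -
    have wi: "w i = i" and ia: "i \<in> axes" and iN: "i \<in> normals"
      using i axes_normals by (auto simp: walls_def)
    have eq: "lorentz i (w (reflection n apex)) = lorentz i (reflection n apex)"
      using lorentz_weyl[OF w, of i "reflection n apex"] wi by simp
    have "lorentz i (reflection n apex) < 0" if "n \<noteq> i"
    proof (cases rule: normals_cases[OF n iN])
      case 2
      then show ?thesis using lorentz_normal_apex_neg[OF iN]
        by (simp add: lorentz_reflection_normal_left[OF n] lorentz_commute[of i n])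
    next
      case 3
      show ?thesis
        using lorentz_normal_reflected_apex[OF n]
          halfspaces_disjoint[OF n iN 3(2) weyl_hyperbolic[OF weyl_reflection[OF n]]] by simp
    qed (use that in simp)
    moreover have "lorentz i (reflection n apex) > 0" if "n = i"
      unfolding that[symmetric] by (rule lorentz_normal_reflected_apex[OF n])
    moreover have "i \<in> walls (w \<circ> reflection n)" if "lorentz n i = 0"
      using that i by (simp add: walls_def reflection_orthogonal lorentz_commute[of i n])
    ultimately show ?thesis using eq by force
  qed
  have orth: "lorentz n i = 0" if "i \<in> walls (w \<circ> reflection n)" for i
    using walls_orthogonal_descents[OF w' that nd] .
  have LR: ?R if ?L
  proof
    fix i assume i: "i \<in> walls w"
    then have "lorentz i (w (reflection n apex)) > 0 \<or> i \<in> walls (w \<circ> reflection n)"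
      using that by (auto simp: pyr_def walls_def)
    then show "n = i \<or> lorentz n i = 0" using on[OF i] orth by blast
  qed
  moreover have ?L if ?R
  proof -
    have "lorentz i (w (reflection n apex)) > 0 \<or> i \<in> walls (w \<circ> reflection n)" if "i \<in> axes" for i
      using other[OF that] on[of i] \<open>?R\<close> by blast
    then show ?thesis using w' by (simp add: pyr_def)
  qed
  ultimately show "?L \<longleftrightarrow> ?R" by blast
  show "walls (w \<circ> reflection n) = walls w - {n}" if ?L
  proof -
    have R: ?R using LR[OF that] .
    have "i \<in> walls (w \<circ> reflection n) \<longleftrightarrow> i \<in> walls w \<and> i \<noteq> n" if "i \<in> axes" for i
      using other[OF that] off[OF _ that] on[of i] R by blast
    then show ?thesis by (auto simp: walls_def)
  qed
qed

lemma pyr_id: "id \<in> pyr" "walls id = axes"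
  by (auto simp: pyr_def walls_def weyl_id)

section \<open>Counting the vertices of the pyramid\<close>

text \<open>The successors of a vertex depend only on its walls and its descents, which form a clique of
  the icosahedron graph; \<open>transition p q\<close> is the number of successors in state \<open>q\<close> of a vertex in
  state \<open>p\<close>, where a state consists of the numbers of walls and of descents.\<close>

definition cliques :: "nat list list" where
  "cliques = [] # map (\<lambda>a. [a]) [0..<12]
     @ concat (map (\<lambda>a. map (\<lambda>b. [a, b]) (filter (\<lambda>b. a < b \<and> adjacent a b) [0..<12])) [0..<12])
     @ concat (map (\<lambda>a. concat (map (\<lambda>b. map (\<lambda>c. [a, b, c])
         (filter (\<lambda>c. b < c \<and> adjacent a c \<and> adjacent b c) [0..<12]))
         (filter (\<lambda>b. a < b \<and> adjacent a b) [0..<12]))) [0..<12])"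

text \<open>\<open>I\<close> and \<open>T\<close> hold the indices of the walls and of the descents.
  The filter is the condition of \<open>pyr_ascent\<close>, and the pairs are the new states
  according to \<open>pyr_ascent\<close> and \<open>descents_step\<close>.\<close>

definition outcomes :: "nat list \<Rightarrow> nat list \<Rightarrow> (nat \<times> nat) list" where
  "outcomes I T = map
     (\<lambda>m. (length (filter (\<lambda>x. x \<noteq> m) I), Suc (length (filter (\<lambda>t. adjacent t m) T))))
     (filter (\<lambda>m. \<not> List.member T m \<and> list_all (\<lambda>x. m = x \<or> adjacent m x) I) [0..<12])"

text \<open>In this order: the starting vertex, then the types 1, B, A, E, D, C.\<close>

definition states :: "(nat \<times> nat) list" where
  "states = [(3, 0), (2, 1), (1, 1), (1, 2), (0, 1), (0, 2), (0, 3)]"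

definition transition :: "nat \<times> nat \<Rightarrow> nat \<times> nat \<Rightarrow> nat" where
  "transition p q = (case map_of
     [(((3, 0), (2, 1)), 3),
      (((2, 1), (2, 1)), 1), (((2, 1), (1, 2)), 2),
      (((1, 1), (1, 1)), 2), (((1, 1), (1, 2)), 2), (((1, 1), (0, 2)), 1),
      (((1, 2), (1, 1)), 1), (((1, 2), (1, 2)), 2), (((1, 2), (0, 3)), 1),
      (((0, 1), (0, 1)), 6), (((0, 1), (0, 2)), 5),
      (((0, 2), (0, 1)), 4), (((0, 2), (0, 2)), 4), (((0, 2), (0, 3)), 2),
      (((0, 3), (0, 1)), 3), (((0, 3), (0, 2)), 3), (((0, 3), (0, 3)), 3)]
     (p, q) of None \<Rightarrow> 0 | Some c \<Rightarrow> c)"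

definition transitions_ok :: "(nat \<times> nat) list \<Rightarrow> nat \<times> nat \<Rightarrow> bool" where
  "transitions_ok os p \<longleftrightarrow> List.member states p \<and>
     list_all (\<lambda>q. count_list os q = transition p q) states"

text \<open>The premises hold in the pyramid: descents are orthogonal to walls, and only the
  starting vertex has no descent. They exclude pairs outside \<open>states\<close>, such as (0,
  0).\<close>

lemma transition_table:
  "list_all (\<lambda>I. list_all (\<lambda>T.
     list_all (\<lambda>x. list_all (\<lambda>t. adjacent t x) T) I \<longrightarrow> (T = [] \<longrightarrow> I = [0, 1, 2]) \<longrightarrow>
     transitions_ok (outcomes I T) (length I, length T)) cliques) (subseqs [0, 1, 2])"
  by code_simp

lemma no_four_clique:
  "list_all (\<lambda>T. length T = 3 \<longrightarrow> \<not> list_ex (\<lambda>d. list_all (\<lambda>t. adjacent t d) T) [0..<12]) cliques"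
  by code_simp

lemma triangles_in_cliques:
  assumes "a < b" "b < c" "c < 12" "adjacent a b" "adjacent a c" "adjacent b c"
  shows "[a, b, c] \<in> set cliques"
  using assms by (simp add: cliques_def image_iff)

text \<open>The icosahedron graph has no clique of four vertices, and a longer list would extend one
  of its triangles to such a clique.\<close>

lemma cliques_sorted:
  assumes "sorted_wrt (<) T" "set T \<subseteq> {..<12}"
    and adj: "\<And>s t. s \<in> set T \<Longrightarrow> t \<in> set T \<Longrightarrow> s \<noteq> t \<Longrightarrow> adjacent s t"
  shows "T \<in> set cliques"
proof -
  consider "T = []" | a where "T = [a]" | a b where "T = [a, b]" | a b c where "T = [a, b, c]"
    | a b c d U where "T = a # b # c # d # U"
    by (metis neq_Nil_conv)
  then show ?thesis
  proof cases
    case 1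
    then show ?thesis by (simp add: cliques_def)
  next
    case (2 a)
    then show ?thesis using assms(2) by (auto simp: cliques_def)
  next
    case (3 a b)
    then show ?thesis using assms(1,2) adj[of a b] by (auto simp: cliques_def)
  next
    case (4 a b c)
    then show ?thesis using assms(1,2) adj[of a b] adj[of a c] adj[of b c]
      by (auto intro!: triangles_in_cliques)
  next
    case (5 a b c d U)
    have "[a, b, c] \<in> set cliques"
      using 5 assms(1,2) adj[of a b] adj[of a c] adj[of b c]
      by (auto intro!: triangles_in_cliques)
    moreover have "adjacent a d" "adjacent b d" "adjacent c d" "d < 12"
      using 5 assms(1,2) adj[of a d] adj[of b d] adj[of c d] by auto
    ultimately have False
      using no_four_clique[unfolded list_all_iff, rule_format, of "[a, b, c]"]
      by (auto simp: list_ex_iff)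
    then show ?thesis ..
  qed
qed

section \<open>Levels of the pyramid and the double count\<close>

definition shell :: "nat \<Rightarrow> (point \<Rightarrow> point) set" where
  "shell n = {w \<in> pyr. len w = n}"

definition state :: "(point \<Rightarrow> point) \<Rightarrow> nat \<times> nat" where
  "state w = (card (walls w), card (descents w))"

lemma finite_words: "finite (words k)"
proof (induction k)
  case (Suc k)
  have "words (Suc k) = (\<lambda>(n, w). reflection n \<circ> w) ` (normals \<times> words k)"
    by (auto simp: image_iff)
  then show ?case using Suc finite_normals by simp
qed simp

lemma finite_shell: "finite (shell n)"
proof (rule finite_subset)
  show "shell n \<subseteq> words n"
    using len_words pyr_weyl by (auto simp: shell_def)
qed (rule finite_words)

lemma shell_0: "shell 0 = {id}"
  using len_0 pyr_weyl pyr_id(1) len_id by (auto simp: shell_def)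

text \<open>Multiplication by \<open>reflection m\<close> is its own inverse, so the same map turns
  a vertex with a descent into an ascendant with an ascent and back.\<close>

lemma shell_ascent_bij:
  "bij_betw (\<lambda>(w, m). (w \<circ> reflection m, m))
     (SIGMA w:{w \<in> shell (Suc n). state w = q}. descents w)
     (SIGMA w:shell n. {m \<in> normals - descents w. w \<circ> reflection m \<in> pyr \<and>
        state (w \<circ> reflection m) = q})"
proof (rule bij_betw_byWitness[where f' = "\<lambda>(w, m). (w \<circ> reflection m, m)"])
  show "(\<lambda>(w, m). (w \<circ> reflection m, m)) ` (SIGMA w:{w \<in> shell (Suc n). state w = q}. descents w)
      \<subseteq> (SIGMA w:shell n. {m \<in> normals - descents w. w \<circ> reflection m \<in> pyr \<and>
        state (w \<circ> reflection m) = q})"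
  proof (clarsimp, intro conjI)
    fix w m assume w: "w \<in> shell (Suc n)" and m: "m \<in> descents w"
    have wP: "w \<in> pyr" "len w = Suc n" using w by (auto simp: shell_def)
    note wW = pyr_weyl[OF wP(1)]
    show mN: "m \<in> normals" using m descents_normals by blast
    note len = len_descent(1)[OF wW mN m]
    show "w \<circ> reflection m \<in> shell n"
      using pyr_descent[OF wP(1) m] len wP(2) by (simp add: shell_def)
    have "w \<circ> reflection m \<in> weyl" using weyl_comp[OF wW weyl_reflection[OF mN]] .
    then show "m \<notin> descents (w \<circ> reflection m)"
      using len_descent(1)[of "w \<circ> reflection m" m] mN len
      by (auto simp: reflection_normal_involutive(4)[OF mN])
    show "w \<circ> reflection m \<circ> reflection m \<in> pyr"
      "state (w \<circ> reflection m \<circ> reflection m) = state w"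
      using wP by (simp_all only: reflection_normal_involutive(4)[OF mN])
  qed
  show "(\<lambda>(w, m). (w \<circ> reflection m, m)) ` (SIGMA w:shell n. {m \<in> normals - descents w.
        w \<circ> reflection m \<in> pyr \<and> state (w \<circ> reflection m) = q})
      \<subseteq> (SIGMA w:{w \<in> shell (Suc n). state w = q}. descents w)"
    using len_descent(2) descents_step pyr_weyl by (auto simp: shell_def)
qed (use descents_normals in \<open>auto simp: reflection_normal_involutive(4) subset_iff\<close>)

lemma shell_double_count:
  "snd q * card {w \<in> shell (Suc n). state w = q} =
     (\<Sum>w\<in>shell n. card {m \<in> normals - descents w. w \<circ> reflection m \<in> pyr \<and>
        state (w \<circ> reflection m) = q})"
proof -
  have "snd q * card {w \<in> shell (Suc n). state w = q}
      = (\<Sum>w\<in>{w \<in> shell (Suc n). state w = q}. card (descents w))"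
  proof -
    have "(\<Sum>w\<in>{w \<in> shell (Suc n). state w = q}. card (descents w))
        = (\<Sum>w\<in>{w \<in> shell (Suc n). state w = q}. snd q)"
      by (rule sum.cong) (auto simp: state_def)
    then show ?thesis by simp
  qed
  also have "\<dots> = card (SIGMA w:{w \<in> shell (Suc n). state w = q}. descents w)"
    using finite_shell finite_descents by (subst card_SigmaI) auto
  also have "\<dots> = card (SIGMA w:shell n. {m \<in> normals - descents w. w \<circ> reflection m \<in> pyr \<and>
        state (w \<circ> reflection m) = q})"
    using shell_ascent_bij by (rule bij_betw_same_card)
  also have "\<dots> = (\<Sum>w\<in>shell n. card {m \<in> normals - descents w. w \<circ> reflection m \<in> pyr \<and>
        state (w \<circ> reflection m) = q})"
    using finite_shell finite_normals by (subst card_SigmaI) auto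
  finally show ?thesis .
qed

lemma normals_indices:
  assumes "S \<subseteq> normals"
  obtains J where "J \<subseteq> {..<12}" "S = nrm ` J"
  using assms unfolding normals_def by (meson subset_imageE)

lemma inj_nrm: "inj_on nrm {..<12}"
  by (auto simp: inj_on_def nrm_eq_iff)

text \<open>Carries the geometric set of admissible steps over to index lists, the form in which
  \<open>transition_table\<close> is evaluated.\<close>

lemma successors_indices:
  assumes I: "I \<subseteq> {..<12}" and T: "T \<subseteq> {..<12}" "set T' = T" "set I' = I" "distinct T'" "distinct I'"
  shows "card {m \<in> normals - nrm ` T. (\<forall>x\<in>nrm ` I. m = x \<or> lorentz m x = 0) \<and>
      (card (nrm ` I - {m}), card (insert m {t \<in> nrm ` T. lorentz t m = 0})) = q}
    = count_list (outcomes I' T') q"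
proof -
  have fin: "finite I" "finite T" using I T finite_subset by blast+
  have "{m \<in> normals - nrm ` T. (\<forall>x\<in>nrm ` I. m = x \<or> lorentz m x = 0) \<and>
      (card (nrm ` I - {m}), card (insert m {t \<in> nrm ` T. lorentz t m = 0})) = q}
    = nrm ` {m \<in> {..<12} - T. (\<forall>x\<in>I. m = x \<or> adjacent m x) \<and>
      (card (I - {m}), Suc (card {t \<in> T. adjacent t m})) = q}" (is "?A = nrm ` ?B")
  proof -
    have "nrm m \<in> nrm ` T \<longleftrightarrow> m \<in> T" "(\<forall>x\<in>nrm ` I. nrm m = x \<or> lorentz (nrm m) x = 0)
          \<longleftrightarrow> (\<forall>x\<in>I. m = x \<or> adjacent m x)"
        "card (nrm ` I - {nrm m}) = card (I - {m})"
        "m \<notin> T \<Longrightarrow> card (insert (nrm m) {t \<in> nrm ` T. lorentz t (nrm m) = 0})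
          = Suc (card {t \<in> T. adjacent t m})"
      if m: "m < 12" for m
    proof -
      show mT: "nrm m \<in> nrm ` T \<longleftrightarrow> m \<in> T"
        using m T(1) by (auto simp: nrm_eq_iff subset_iff)
      show "(\<forall>x\<in>nrm ` I. nrm m = x \<or> lorentz (nrm m) x = 0) \<longleftrightarrow> (\<forall>x\<in>I. m = x \<or> adjacent m x)"
        using m I by (auto simp: nrm_eq_iff lorentz_nrm_0 subset_iff)
      have "nrm ` I - {nrm m} = nrm ` (I - {m})"
        using m I by (auto simp: nrm_eq_iff subset_iff)
      then show "card (nrm ` I - {nrm m}) = card (I - {m})"
        using inj_on_subset[OF inj_nrm, of "I - {m}"] I by (simp add: card_image subset_iff)
      assume mn: "m \<notin> T"
      have "{t \<in> nrm ` T. lorentz t (nrm m) = 0} = nrm ` {t \<in> T. adjacent t m}"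
        using m T(1) mn by (auto simp: lorentz_nrm_0 subset_iff)
      moreover have "card (nrm ` {t \<in> T. adjacent t m}) = card {t \<in> T. adjacent t m}"
        using inj_on_subset[OF inj_nrm, of "{t \<in> T. adjacent t m}"] T(1)
        by (simp add: card_image subset_iff)
      moreover have "nrm m \<notin> nrm ` {t \<in> T. adjacent t m}" using mT mn by blast
      ultimately show "card (insert (nrm m) {t \<in> nrm ` T. lorentz t (nrm m) = 0})
          = Suc (card {t \<in> T. adjacent t m})"
        using fin by simp
    qed
    then have iff: "nrm m \<in> ?A \<longleftrightarrow> m \<in> ?B" if "m < 12" for m
      using that by (cases "m \<in> T") (simp_all add: normals_def)
    show ?thesis
    proof (intro subset_antisym subsetI)
      fix p assume p: "p \<in> ?A"
      then obtain m where "m < 12" "p = nrm m" by (auto simp: normals_def)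
      then show "p \<in> nrm ` ?B" using p iff by blast
    next
      fix p assume "p \<in> nrm ` ?B"
      then show "p \<in> ?A" using iff by fast
    qed
  qed
  then have "card {m \<in> normals - nrm ` T. (\<forall>x\<in>nrm ` I. m = x \<or> lorentz m x = 0) \<and>
      (card (nrm ` I - {m}), card (insert m {t \<in> nrm ` T. lorentz t m = 0})) = q} = card ?B"
    using inj_on_subset[OF inj_nrm, of ?B] by (simp add: card_image subset_iff)
  also have "\<dots> = length (filter (\<lambda>m. (length (filter (\<lambda>x. x \<noteq> m) I'),
        Suc (length (filter (\<lambda>t. adjacent t m) T'))) = q)
      (filter (\<lambda>m. \<not> List.member T' m \<and> list_all (\<lambda>x. m = x \<or> adjacent m x) I') [0..<12]))"
  proof -
    have "length (filter (\<lambda>x. x \<noteq> m) I') = card (I - {m})" for m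
    proof -
      have "set (filter (\<lambda>x. x \<noteq> m) I') = I - {m}" using T(3) by auto
      then show ?thesis using distinct_card[of "filter (\<lambda>x. x \<noteq> m) I'"] T(5) by simp
    qed
    moreover have "length (filter (\<lambda>t. adjacent t m) T') = card {t \<in> T. adjacent t m}" for m
    proof -
      have "set (filter (\<lambda>t. adjacent t m) T') = {t \<in> T. adjacent t m}" using T(2) by auto
      then show ?thesis using distinct_card[of "filter (\<lambda>t. adjacent t m) T'"] T(4) by simp
    qed
    ultimately have "set (filter (\<lambda>m. (length (filter (\<lambda>x. x \<noteq> m) I'),
        Suc (length (filter (\<lambda>t. adjacent t m) T'))) = q)
      (filter (\<lambda>m. \<not> List.member T' m \<and> list_all (\<lambda>x. m = x \<or> adjacent m x) I') [0..<12])) = ?B"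
      using T(2,3) by (auto simp: list_all_iff)
    then show ?thesis
      using distinct_card[of "filter (\<lambda>m. (length (filter (\<lambda>x. x \<noteq> m) I'),
        Suc (length (filter (\<lambda>t. adjacent t m) T'))) = q)
      (filter (\<lambda>m. \<not> List.member T' m \<and> list_all (\<lambda>x. m = x \<or> adjacent m x) I') [0..<12])"]
      by simp
  qed
  also have "\<dots> = count_list (outcomes I' T') q"
    by (simp add: outcomes_def count_list_eq_length_filter filter_map comp_def eq_commute)
  finally show ?thesis .
qed

lemma pyr_transitions:
  assumes w: "w \<in> pyr"
  shows "state w \<in> set states"
    and "q \<in> set states \<Longrightarrow> card {m \<in> normals - descents w. w \<circ> reflection m \<in> pyr \<and>
        state (w \<circ> reflection m) = q} = transition (state w) q"
proof -
  note wW = pyr_weyl[OF w]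
  obtain T where T: "T \<subseteq> {..<12}" "descents w = nrm ` T"
    using normals_indices[OF descents_normals] .
  define I where "I = {i. i < 3 \<and> nrm i \<in> walls w}"
  have I: "I \<subseteq> {..<3}" "walls w = nrm ` I"
    by (auto simp: I_def walls_def axes_def)
  have I12: "I \<subseteq> {..<12}" using I(1) by force
  define T' where "T' = sorted_list_of_set T"
  define I' where "I' = sorted_list_of_set I"
  have fin: "finite T" "finite I" using T(1) I(1) finite_subset by blast+
  have T': "set T' = T" "distinct T'" "sorted_wrt (<) T'" "length T' = card T"
    and I': "set I' = I" "distinct I'" "length I' = card I"
    using fin by (simp_all add: T'_def I'_def)
  have "T' \<in> set cliques"
  proof (rule cliques_sorted)
    fix s t assume st: "s \<in> set T'" "t \<in> set T'" "s \<noteq> t"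
    then have "s < 12" "t < 12" using T' T(1) by auto
    moreover have "lorentz (nrm s) (nrm t) = 0"
      using descents_orthogonal[OF wW, of "nrm s" "nrm t"] st T' T(2) nrm_eq_iff calculation
      by simp
    ultimately show "adjacent s t" using lorentz_nrm_0 by blast
  qed (use T' T(1) in auto)
  moreover have "I' \<in> set (subseqs [0, 1, 2])"
  proof -
    have "I \<in> Pow {0, 1, 2}" using I(1) by (auto simp: lessThan_Suc numeral_eq_Suc)
    moreover have "\<forall>J\<in>Pow {0, 1, 2::nat}. sorted_list_of_set J \<in> set (subseqs [0, 1, 2])"
      by (simp add: Pow_insert)
    ultimately show ?thesis by (simp add: I'_def)
  qed
  moreover have "\<forall>x\<in>set I'. \<forall>t\<in>set T'. adjacent t x"
  proof (intro ballI)
    fix x t assume xt: "x \<in> set I'" "t \<in> set T'"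
    then have lt: "x < 12" "t < 12" using T' I' T(1) I12 by auto
    have "lorentz (nrm t) (nrm x) = 0"
      using walls_orthogonal_descents[OF wW] xt I' T' I(2) T(2) by simp
    then show "adjacent t x" using lorentz_nrm_0 lt by blast
  qed
  moreover have "I' = [0, 1, 2]" if "T' = []"
  proof -
    have "w = id" using that T(2) T'(1) descents_nonempty[OF wW] by auto
    then have "I = {..<3}" using pyr_id(2) by (auto simp: I_def axes_def)
    also have "{..<3} = set [0, 1, 2::nat]" by auto
    finally show ?thesis by (simp add: I'_def)
  qed
  ultimately have ok: "transitions_ok (outcomes I' T') (length I', length T')"
    using transition_table unfolding list_all_iff by blast
  have st: "state w = (length I', length T')"
    using card_image[OF inj_on_subset[OF inj_nrm T(1)]] card_image[OF inj_on_subset[OF inj_nrm I12]]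
    by (simp add: state_def T(2) I(2) T' I')
  show "state w \<in> set states"
    using ok by (simp add: transitions_ok_def st)
  assume q: "q \<in> set states"
  have "{m \<in> normals - descents w. w \<circ> reflection m \<in> pyr \<and> state (w \<circ> reflection m) = q}
      = {m \<in> normals - nrm ` T. (\<forall>x\<in>nrm ` I. m = x \<or> lorentz m x = 0) \<and>
      (card (nrm ` I - {m}), card (insert m {t \<in> nrm ` T. lorentz t m = 0})) = q}"
    using pyr_ascent[OF w] descents_step[OF wW]
    by (auto simp: state_def I(2)[symmetric] T(2)[symmetric])
  then have "card {m \<in> normals - descents w. w \<circ> reflection m \<in> pyr \<and> state (w \<circ> reflection m) = q}
      = count_list (outcomes I' T') q"
    using successors_indices[OF I12 T(1) T'(1) I'(1) T'(2) I'(2)] by simp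
  also have "\<dots> = transition (state w) q"
    using ok q by (simp add: transitions_ok_def st list_all_iff)
  finally show "card {m \<in> normals - descents w. w \<circ> reflection m \<in> pyr \<and>
        state (w \<circ> reflection m) = q} = transition (state w) q" .
qed

definition num :: "nat \<times> nat \<Rightarrow> nat \<Rightarrow> nat" where
  "num q n = card {w \<in> shell n. state w = q}"

text \<open>The factor on the left is the number of ascendants of a vertex in state
  \<open>q\<close>.\<close>

lemma num_Suc:
  assumes "q \<in> set states"
  shows "snd q * num q (Suc n) = (\<Sum>p\<in>set states. num p n * transition p q)"
proof -
  have "snd q * num q (Suc n) = (\<Sum>w\<in>shell n. transition (state w) q)"
    unfolding num_def shell_double_count
    using pyr_transitions(2)[OF _ assms] by (intro sum.cong) (auto simp: shell_def)
  also have "\<dots> = (\<Sum>p\<in>set states. \<Sum>w\<in>{w \<in> shell n. state w = p}. transition (state w) q)"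
    using finite_shell pyr_transitions(1)
    by (intro sum.group[symmetric]) (auto simp: shell_def)
  also have "\<dots> = (\<Sum>p\<in>set states. num p n * transition p q)"
  proof (rule sum.cong)
    fix p
    have "(\<Sum>w\<in>{w \<in> shell n. state w = p}. transition (state w) q)
        = (\<Sum>w\<in>{w \<in> shell n. state w = p}. transition p q)"
      by (rule sum.cong) auto
    then show "(\<Sum>w\<in>{w \<in> shell n. state w = p}. transition (state w) q)
        = num p n * transition p q"
      by (simp add: num_def)
  qed simp
  finally show ?thesis .
qed

lemma state_id: "state id = (3, 0)"
proof -
  have "card axes = 3"
    unfolding axes_def using card_image[OF inj_on_subset[OF inj_nrm, of "{..<3}"]] by simp
  then show ?thesis by (simp add: state_def pyr_id(2) descents_id)
qed

lemma num_0: "num q 0 = (if q = (3, 0) then 1 else 0)"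
proof -
  have "{w \<in> shell 0. state w = q} = (if q = (3, 0) then {id} else {})"
    by (auto simp: shell_0 state_id)
  then show ?thesis by (simp add: num_def)
qed

lemma num_recurrences:
  "num (2, 1) (Suc n) = num (2, 1) n + 3 * num (3, 0) n"
  "num (1, 1) (Suc n) = 2 * num (1, 1) n + num (1, 2) n"
  "2 * num (1, 2) (Suc n) = 2 * num (2, 1) n + 2 * num (1, 1) n + 2 * num (1, 2) n"
  "num (0, 1) (Suc n) = 6 * num (0, 1) n + 4 * num (0, 2) n + 3 * num (0, 3) n"
  "2 * num (0, 2) (Suc n) = num (1, 1) n + 5 * num (0, 1) n + 4 * num (0, 2) n + 3 * num (0, 3) n"
  "3 * num (0, 3) (Suc n) = num (1, 2) n + 2 * num (0, 2) n + 3 * num (0, 3) n"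
  using num_Suc[of "(2, 1)" n] num_Suc[of "(1, 1)" n] num_Suc[of "(1, 2)" n]
    num_Suc[of "(0, 1)" n] num_Suc[of "(0, 2)" n] num_Suc[of "(0, 3)" n]
  by (simp_all add: states_def transition_def)

text \<open>For the state (3, 0) the double count only says 0 = 0; what excludes it on later levels
  is that \<open>w \<noteq> id\<close> has a descent.\<close>

lemma num_30: "num (3, 0) (Suc n) = 0"
proof -
  have "w \<notin> shell (Suc n)" if "descents w = {}" for w
    using that descents_nonempty pyr_weyl len_id by (force simp: shell_def)
  moreover have "descents w = {}" if "state w = (3, 0)" for w
    using that finite_descents by (simp add: state_def)
  ultimately have "{w \<in> shell (Suc n). state w = (3, 0)} = {}" by blast
  then show ?thesis unfolding num_def by (simp only: card.empty)
qed

lemma num_21: "num (2, 1) (Suc n) = 3"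
  by (induction n) (simp_all only: num_recurrences num_0 num_30, simp_all)

lemma card_shell:
  "card (shell n) = (\<Sum>q\<in>set states. num q n)"
proof -
  have "card (shell n) = (\<Sum>w\<in>shell n. 1)" by simp
  also have "\<dots> = (\<Sum>q\<in>set states. \<Sum>w\<in>{w \<in> shell n. state w = q}. 1)"
    using finite_shell pyr_transitions(1)
    by (intro sum.group[symmetric]) (auto simp: shell_def)
  finally show ?thesis by (simp add: num_def)
qed

section \<open>The base cube and the symmetries of the honeycomb\<close>

definition ax :: "3 \<Rightarrow> point" where
  "ax i = (axis i 1, 0)"

lemma lorentz_ax: "lorentz (ax i) p = fst p $ i"
  by (simp add: ax_def lorentz_def inner_axis')

lemma axes_eq: "axes = range ax"
proof -
  have "{..<3} = {0, 1, 2 :: nat}" by auto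
  moreover have "range ax = {ax 1, ax 2, ax 3}" by (simp add: UNIV_3)
  moreover have "ax 1 = nrm 0" "ax 2 = nrm 1" "ax 3 = nrm 2"
    by (simp_all add: ax_def nrm_def normal_table_def zval_def pt_def prod_eq_iff vec_eq_iff
        forall_3 axis_def)
  ultimately show ?thesis unfolding axes_def by simp
qed

lemma axes_cases:
  assumes "a \<in> axes"
  obtains i where "a = ax i"
  using assms by (auto simp: axes_eq)

lemma ax_normals: "ax i \<in> normals"
  using axes_normals axes_eq by blast

lemma axes_orthogonal: "a \<in> axes \<Longrightarrow> b \<in> axes \<Longrightarrow> a \<noteq> b \<Longrightarrow> lorentz a b = 0"
  by (auto simp: axes_eq lorentz_ax) (auto simp: ax_def axis_def)

lemma reflection_ax:
  "fst (reflection (ax i) p) $ j = (if j = i then - fst p $ j else fst p $ j)"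
  "snd (reflection (ax i) p) = snd p"
proof -
  have "lorentz (ax i) (ax i) = 1" by (simp add: normals_unit ax_normals)
  then have "reflection (ax i) p = p - (2 * fst p $ i) *\<^sub>R ax i"
    by (simp add: reflection_def lorentz_ax lorentz_commute[of p])
  then show "fst (reflection (ax i) p) $ j = (if j = i then - fst p $ j else fst p $ j)"
    "snd (reflection (ax i) p) = snd p"
    by (auto simp: ax_def axis_def)
qed

text \<open>The sign changes of the three coordinates. They preserve the base cube and reach all its
  vertices from \<open>apex\<close>; as words in the first three normals they lie in
  \<open>weyl\<close>.\<close>

inductive_set signs :: "(point \<Rightarrow> point) set" where
  id: "id \<in> signs"
| refl: "g \<in> signs \<Longrightarrow> a \<in> axes \<Longrightarrow> g \<circ> reflection a \<in> signs"

lemma signs_weyl: "g \<in> signs \<Longrightarrow> g \<in> weyl"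
proof (induction rule: signs.induct)
  case (refl g a)
  show ?case using refl(2) axes_normals by (intro weyl_comp[OF refl(3)] weyl_reflection) blast
qed (rule weyl_id)

lemma signs_axes:
  assumes "g \<in> signs" "a \<in> axes"
  shows "g a = a \<or> g a = - a"
  using assms
proof (induction arbitrary: a rule: signs.induct)
  case (refl g b)
  have b: "b \<in> normals" using refl axes_normals by blast
  show ?case
  proof (cases "a = b")
    case True
    then show ?thesis
      using refl.IH[OF refl.prems] normals_unit[OF b]
        isometry_simps(3)[OF weyl_isometry[OF signs_weyl[OF refl.hyps(1)]]]
      by (auto simp: reflection_self)
  next
    case False
    then show ?thesis
      using refl.IH[OF refl.prems] axes_orthogonal[OF refl.prems refl.hyps(2)]
      by (simp add: reflection_orthogonal)
  qed
qed simp

lemma signs_commute: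
  assumes "g \<in> signs" "a \<in> axes"
  shows "reflection a \<circ> g = g \<circ> reflection a"
  using signs_axes[OF assms] isometry_reflection[OF weyl_isometry[OF signs_weyl[OF assms(1)]], of a]
  by (auto simp: reflection_uminus)

lemma signs_left: "g \<in> signs \<Longrightarrow> a \<in> axes \<Longrightarrow> reflection a \<circ> g \<in> signs"
  using signs_commute signs.refl by simp

lemma sign_change:
  assumes "\<And>j. \<bar>fst p $ j\<bar> = \<bar>fst q $ j\<bar>" "snd p = snd q"
  obtains g where "g \<in> signs" "g q = p"
proof -
  \<comment> \<open>Induction over the set \<open>S\<close> of coordinates whose sign has already
    been corrected.\<close>
  have "\<exists>g\<in>signs. snd (g q) = snd q \<and> (\<forall>j. fst (g q) $ j = (if j \<in> S then fst p $ j else fst q $ j))"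
    if "finite S" for S
    using that
  proof (induction S rule: finite_induct)
    case empty
    then show ?case using signs.id by (intro bexI[of _ id]) auto
  next
    case (insert i S)
    then obtain g where g: "g \<in> signs" "snd (g q) = snd q"
      "\<And>j. fst (g q) $ j = (if j \<in> S then fst p $ j else fst q $ j)" by blast
    show ?case
    proof (cases "fst p $ i = fst q $ i")
      case True
      then show ?thesis using g by (intro bexI[of _ g]) auto
    next
      case False
      then have "fst p $ i = - fst q $ i" using assms(1)[of i] by (simp add: abs_eq_iff)
      then show ?thesis
        using g insert.hyps(2) signs_left[OF g(1), of "ax i"] axes_eq
        by (intro bexI[of _ "reflection (ax i) \<circ> g"]) (auto simp: reflection_ax)
    qed
  qed
  from this[of UNIV] obtain g where "g \<in> signs" "snd (g q) = snd q" "\<And>j. fst (g q) $ j = fst p $ j"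
    by auto
  then show thesis using that assms(2) by (auto simp: prod_eq_iff vec_eq_iff)
qed

lemma fst_apex: "fst apex $ j = - (half_width * snd apex)"
  using exhaust_3[of j] half_width_pos by (auto simp: apex_def pt_def)

text \<open>All three coordinates have the same square, so the equation of the hyperboloid fixes the
  height. Hence base vertices differ in signs only.\<close>

lemma base_vertices_height:
  assumes "p \<in> base_vertices"
  shows "(1 - 3 * half_width\<^sup>2) * (snd p)\<^sup>2 = 1"
proof -
  have *: "(fst p $ i)\<^sup>2 = half_width\<^sup>2 * (snd p)\<^sup>2" for i
    using assms by (metis (mono_tags, lifting) base_vertices_def mem_Collect_eq power2_abs power_mult_distrib)
  have "lorentz p p = (\<Sum>i\<in>UNIV. (fst p $ i)\<^sup>2) - (snd p)\<^sup>2"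
    by (simp add: lorentz_def inner_vec_def power2_eq_square)
  moreover have "lorentz p p = -1"
    using assms by (simp add: base_vertices_def hyperbolic_space_def)
  ultimately show ?thesis by (simp add: * algebra_simps)
qed

lemma apex_base_vertex: "apex \<in> base_vertices"
  using apex_in_hyperbolic_space half_width_pos
  by (auto simp: base_vertices_def fst_apex hyperbolic_space_def)

lemma base_vertices_height_eq:
  assumes "p \<in> base_vertices"
  shows "snd p = snd apex"
proof -
  have "(snd p)\<^sup>2 = (snd apex)\<^sup>2"
    using base_vertices_height[OF assms] base_vertices_height[OF apex_base_vertex] half_width_bound
    by (metis mult_cancel_left mult_zero_left zero_neq_one)
  then show ?thesis
    using assms apex_base_vertex
    by (simp add: base_vertices_def hyperbolic_space_def power2_eq_iff_nonneg)
qed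

lemma reflection_base_vertices:
  assumes "a \<in> axes" "p \<in> base_vertices"
  shows "reflection a p \<in> base_vertices"
proof -
  obtain i where i: "a = ax i" using axes_cases[OF assms(1)] .
  have "reflection (ax i) p \<in> hyperbolic_space"
    using assms(2) by (intro reflection_hyperbolic_space)
      (auto simp: base_vertices_def normals_unit ax_normals)
  then show ?thesis using assms(2) by (auto simp: base_vertices_def reflection_ax i)
qed

lemma reflection_base_cube:
  assumes "a \<in> axes" "p \<in> base_cube"
  shows "reflection a p \<in> base_cube"
proof -
  obtain i where i: "a = ax i" using axes_cases[OF assms(1)] .
  have *: "p \<in> base_cube \<longleftrightarrow> p \<in> hyperbolic_space \<and> (\<forall>j. \<bar>fst p $ j\<bar> \<le> half_width * snd p)" for p
  proof -
    obtain a b c d where "p = pt a b c d" using pt_cases .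
    then show ?thesis by (simp add: base_cube_pt fst_pt snd_pt forall_3)
  qed
  have "reflection (ax i) p \<in> hyperbolic_space"
    using assms(2) by (intro reflection_hyperbolic_space)
      (auto simp: base_cube_def normals_unit ax_normals)
  then show ?thesis using assms(2) by (auto simp: * reflection_ax i)
qed

lemma signs_image:
  assumes g: "g \<in> signs" and S: "\<And>a p. a \<in> axes \<Longrightarrow> p \<in> S \<Longrightarrow> reflection a p \<in> S"
  shows "g ` S = S"
  using g
proof (induction rule: signs.induct)
  case (refl g a)
  have "a \<in> normals" using refl(2) axes_normals by blast
  then have "reflection a ` S = S"
    using S[OF refl(2)] by (force simp: image_iff reflection_normal_involutive(1)
        intro: exI[of _ "reflection a _"])
  then show ?case using refl(3) by (simp only: image_comp[symmetric])
qed simp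

lemma signs_base_cube: "g \<in> signs \<Longrightarrow> g ` base_cube = base_cube"
  using signs_image reflection_base_cube by blast

lemma signs_base_vertices: "g \<in> signs \<Longrightarrow> g ` base_vertices = base_vertices"
  using signs_image reflection_base_vertices by blast

lemma base_vertices_eq: "base_vertices = {g apex |g. g \<in> signs}"
proof (intro subset_antisym subsetI)
  fix p assume p: "p \<in> base_vertices"
  obtain g where "g \<in> signs" "g apex = p"
  proof (rule sign_change)
    show "\<bar>fst p $ j\<bar> = \<bar>fst apex $ j\<bar>" for j
      using p apex_base_vertex base_vertices_height_eq[OF p] by (simp add: base_vertices_def)
  qed (use base_vertices_height_eq[OF p] in auto)
  then show "p \<in> {g apex |g. g \<in> signs}" by blast
qed (use signs_base_vertices apex_base_vertex in blast)

lemma base_edges_aux: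
  assumes "p \<in> base_vertices"
  shows "(p, q) \<in> base_edges \<longleftrightarrow> (\<exists>a\<in>axes. q = reflection a p)"
proof
  assume "(p, q) \<in> base_edges"
  then have q: "q \<in> base_vertices" and "card {i. fst p $ i \<noteq> fst q $ i} = 1"
    by (auto simp: base_edges_def)
  then obtain i where i: "{i. fst p $ i \<noteq> fst q $ i} = {i}"
    by (auto simp: card_1_singleton_iff)
  have *: "snd q = snd p"
    using base_vertices_height_eq assms q by simp
  then have "\<bar>fst p $ j\<bar> = \<bar>fst q $ j\<bar>" for j
    using assms q by (simp add: base_vertices_def)
  then have "fst q $ j = (if j = i then - fst p $ j else fst p $ j)" for j
    using i by (auto simp: abs_eq_iff set_eq_iff) (metis minus_minus)+
  then have "q = reflection (ax i) p"
    using * by (simp add: prod_eq_iff vec_eq_iff reflection_ax)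
  then show "\<exists>a\<in>axes. q = reflection a p" using axes_eq by blast
next
  assume "\<exists>a\<in>axes. q = reflection a p"
  then obtain a where a: "a \<in> axes" "q = reflection a p" by blast
  obtain i where i: "a = ax i" using axes_cases[OF a(1)] .
  have "\<bar>fst p $ i\<bar> = half_width * snd p" "0 < snd p"
    using assms by (simp_all add: base_vertices_def hyperbolic_space_def)
  then have "fst p $ i \<noteq> 0"
    using mult_pos_pos[OF half_width_pos, of "snd p"] by linarith
  then have "{j. fst p $ j \<noteq> fst q $ j} = {i}"
    using a(2) i by (auto simp: reflection_ax)
  then show "(p, q) \<in> base_edges"
    using assms reflection_base_vertices[OF a(1) assms] a(2) by (simp add: base_edges_def)
qed

text \<open>Sign changes commute with the reflections in the axes, so every oriented edge is the
  image of one that starts at \<open>apex\<close>.\<close>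

lemma base_edges_eq:
  "base_edges = {(g apex, g (reflection a apex)) |g a. g \<in> signs \<and> a \<in> axes}"
proof (intro subset_antisym subsetI)
  fix e assume e: "e \<in> base_edges"
  then obtain p q where pq: "e = (p, q)" "p \<in> base_vertices" by (auto simp: base_edges_def)
  then obtain a where a: "a \<in> axes" "q = reflection a p" using base_edges_aux e by blast
  obtain g where g: "g \<in> signs" "p = g apex" using pq(2) base_vertices_eq by blast
  have "q = g (reflection a apex)"
    using a g fun_cong[OF signs_commute[OF g(1) a(1)], of apex] by simp
  then show "e \<in> {(g apex, g (reflection a apex)) |g a. g \<in> signs \<and> a \<in> axes}"
    using pq g a by blast
next
  fix e assume "e \<in> {(g apex, g (reflection a apex)) |g a. g \<in> signs \<and> a \<in> axes}"
  then obtain g a where ga: "g \<in> signs" "a \<in> axes" "e = (g apex, g (reflection a apex))" by blast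
  have "g (reflection a apex) = reflection a (g apex)"
    using fun_cong[OF signs_commute[OF ga(1,2)], of apex] by simp
  then show "e \<in> base_edges"
    using base_edges_aux[of "g apex" "g (reflection a apex)"] ga base_vertices_eq by blast
qed

lemma signs_base_edges:
  assumes "g \<in> signs"
  shows "map_prod g g ` base_edges \<subseteq> base_edges"
proof -
  have comp: "g \<circ> f \<in> signs" if "f \<in> signs" for f
    using that
  proof (induction rule: signs.induct)
    case (refl f a)
    then show ?case using signs.refl[of "g \<circ> f" a] by (simp only: comp_assoc)
  qed (use assms in simp)
  show ?thesis
  proof
    fix e assume "e \<in> map_prod g g ` base_edges"
    then obtain f a where "f \<in> signs" "a \<in> axes" "e = ((g \<circ> f) apex, (g \<circ> f) (reflection a apex))"
      unfolding base_edges_eq by auto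
    then show "e \<in> base_edges" unfolding base_edges_eq using comp by blast
  qed
qed

lemma reflection_face_normals:
  assumes "a \<in> axes" "n \<in> face_normals"
  shows "reflection a n \<in> face_normals"
proof -
  obtain i where i: "a = ax i" using axes_cases[OF assms(1)] .
  obtain j where j: "n = (axis j 1, half_width) \<or> n = (- axis j 1, half_width)"
    using assms(2) by (auto simp: face_normals_eq)
  have "reflection (ax i) n = (axis j 1, half_width) \<or> reflection (ax i) n = (- axis j 1, half_width)"
    using j by (auto simp: prod_eq_iff vec_eq_iff reflection_ax axis_def)
  then show ?thesis by (auto simp: face_normals_eq i)
qed

lemma signs_face_normals: "g \<in> signs \<Longrightarrow> g ` face_normals = face_normals"
  using signs_image reflection_face_normals by blast

lemma face_normals_spacelike: "n \<in> face_normals \<Longrightarrow> lorentz n n > 0"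
proof -
  assume "n \<in> face_normals"
  then have "lorentz n n = 1 - half_width\<^sup>2"
    by (auto simp: face_normals_eq lorentz_def inner_axis_axis power2_eq_square)
  then show ?thesis using half_width_bound zero_le_power2[of half_width] by linarith
qed

lemma signs_base_faces:
  assumes "g \<in> signs" "F \<in> base_faces"
  shows "g ` F \<in> base_faces"
proof -
  obtain n where n: "n \<in> face_normals" "F = {p \<in> base_cube. lorentz p n = 0}"
    using assms(2) by (auto simp: base_faces_def)
  note iso = weyl_isometry[OF signs_weyl[OF assms(1)]]
  have "g ` F = {p \<in> base_cube. lorentz p (g n) = 0}"
  proof (intro subset_antisym subsetI)
    fix p assume "p \<in> g ` F"
    then obtain q where q: "q \<in> base_cube" "lorentz q n = 0" "p = g q" using n(2) by blast
    have "g q \<in> base_cube" using signs_base_cube[OF assms(1)] q(1) by blast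
    then show "p \<in> {p \<in> base_cube. lorentz p (g n) = 0}"
      using isometriesD(4)[OF iso, of q n] q by simp
  next
    fix p assume p: "p \<in> {p \<in> base_cube. lorentz p (g n) = 0}"
    then obtain q where q: "q \<in> base_cube" "p = g q"
      using signs_base_cube[OF assms(1)] by blast
    then have "q \<in> F"
      using p n isometriesD(4)[OF iso, of q n] by simp
    then show "p \<in> g ` F" using q(2) by blast
  qed
  moreover have "g n \<in> face_normals" using signs_face_normals[OF assms(1)] n(1) by blast
  ultimately show ?thesis unfolding base_faces_def by blast
qed

section \<open>Enlarging the face group by the midplane reflections of the base cube\<close>

definition mirrors :: "point set" where
  "mirrors = face_normals \<union> axes"

text \<open>The reflections in \<open>axes\<close> are added so that the group contains
  \<open>weyl\<close>. Since they map the base cube to itself, the cubes with their vertices, edges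
  and faces remain those given by \<open>face_group\<close>.\<close>

inductive_set honeycomb_group :: "(point \<Rightarrow> point) set" where
  id: "id \<in> honeycomb_group"
| refl: "g \<in> honeycomb_group \<Longrightarrow> n \<in> mirrors \<Longrightarrow> g \<circ> reflection n \<in> honeycomb_group"

lemma generator_spacelike: "n \<in> mirrors \<Longrightarrow> lorentz n n > 0"
proof -
  assume "n \<in> mirrors"
  then consider "n \<in> face_normals" | "n \<in> normals" using axes_normals by (auto simp: mirrors_def)
  then show ?thesis by cases (simp_all add: face_normals_spacelike normals_unit)
qed

lemma honeycomb_group_isometry: "g \<in> honeycomb_group \<Longrightarrow> g \<in> isometries"
  by (induction rule: honeycomb_group.induct)
    (blast intro: id_isometry comp_isometry reflection_isometry generator_spacelike)+

lemma honeycomb_group_comp: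
  assumes "g \<in> honeycomb_group" "h \<in> honeycomb_group"
  shows "g \<circ> h \<in> honeycomb_group"
  using assms(2)
proof (induction rule: honeycomb_group.induct)
  case (refl h n)
  then show ?case using honeycomb_group.refl[of "g \<circ> h" n] by (simp only: comp_assoc)
qed (use assms(1) in simp)

lemma honeycomb_group_reflection: "n \<in> mirrors \<Longrightarrow> reflection n \<in> honeycomb_group"
  using honeycomb_group.refl[OF honeycomb_group.id] by (simp only: id_comp)

lemma honeycomb_group_inv: "g \<in> honeycomb_group \<Longrightarrow> inv g \<in> honeycomb_group"
proof (induction rule: honeycomb_group.induct)
  case (refl g n)
  have "inv (g \<circ> reflection n) = inv (reflection n) \<circ> inv g"
    using o_inv_distrib isometriesD(2) honeycomb_group_isometry[OF refl(1)]
      reflection_isometry[OF generator_spacelike[OF refl(2)]] by blast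
  also have "inv (reflection n) = reflection n"
    by (rule inv_reflection[OF generator_spacelike[OF refl(2)]])
  finally show ?case
    using honeycomb_group_comp[OF honeycomb_group_reflection[OF refl(2)] refl(3)] by (simp only:)
next
  case id
  show ?case unfolding inv_id_point by (rule honeycomb_group.id)
qed

lemma honeycomb_group_inv_comp:
  assumes "g \<in> honeycomb_group"
  shows "inv g (g p) = p" "g (inv g p) = p"
  using isometriesD(2)[OF honeycomb_group_isometry[OF assms]]
  by (auto simp: bij_is_inj bij_is_surj surj_f_inv_f)

lemma mirrorsI: "n \<in> face_normals \<Longrightarrow> n \<in> mirrors" "n \<in> axes \<Longrightarrow> n \<in> mirrors"
  by (simp_all add: mirrors_def)

lemma signs_honeycomb_group: "g \<in> signs \<Longrightarrow> g \<in> honeycomb_group"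
  by (induction rule: signs.induct) (blast intro: honeycomb_group.intros mirrorsI)+

lemma face_group_honeycomb_group: "g \<in> face_group \<Longrightarrow> g \<in> honeycomb_group"
  by (induction rule: face_group.induct) (blast intro: honeycomb_group.intros mirrorsI)+

text \<open>Sign changes permute the face normals, so they can be collected at the right end of a
  word.\<close>

lemma honeycomb_group_face_group:
  assumes "g \<in> honeycomb_group"
  obtains f k where "f \<in> face_group" "k \<in> signs" "g = f \<circ> k"
proof -
  have "\<exists>f\<in>face_group. \<exists>k\<in>signs. g = f \<circ> k"
    using assms
  proof (induction rule: honeycomb_group.induct)
    case id
    then show ?case using face_group.id signs.id by (intro bexI[of _ id]) auto
  next
    case (refl g n)
    then obtain f k where fk: "f \<in> face_group" "k \<in> signs" "g = f \<circ> k" by blast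
    show ?case
    proof (cases "n \<in> axes")
      case True
      then show ?thesis
        using fk signs.refl[OF fk(2) True] by (metis comp_assoc)
    next
      case False
      then have "k n \<in> face_normals" using signs_face_normals[OF fk(2)] refl(2) by (auto simp: mirrors_def)
      moreover have "g \<circ> reflection n = f \<circ> reflection (k n) \<circ> k"
        using isometry_reflection[OF weyl_isometry[OF signs_weyl[OF fk(2)]], of n]
        by (simp only: fk(3) comp_assoc)
      ultimately show ?thesis using fk face_group.refl by blast
    qed
  qed
  then show thesis using that by blast
qed

lemma cubes_eq: "cubes = {g ` base_cube |g. g \<in> honeycomb_group}"
proof (intro subset_antisym subsetI)
  fix Q assume "Q \<in> {g ` base_cube |g. g \<in> honeycomb_group}"
  then obtain g where g: "g \<in> honeycomb_group" "Q = g ` base_cube" by blast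
  obtain f k where "f \<in> face_group" "k \<in> signs" "g = f \<circ> k"
    using honeycomb_group_face_group[OF g(1)] .
  then show "Q \<in> cubes"
    unfolding cubes_def using g(2) signs_base_cube by (metis (mono_tags) CollectI image_comp)
qed (use face_group_honeycomb_group in \<open>auto simp: cubes_def\<close>)

lemma cube_vertices_iff:
  "u \<in> cube_vertices Q \<longleftrightarrow>
     (\<exists>g\<in>honeycomb_group. g ` base_cube = Q \<and> u \<in> g ` base_vertices)"
proof
  assume "\<exists>g\<in>honeycomb_group. g ` base_cube = Q \<and> u \<in> g ` base_vertices"
  then obtain g where g: "g \<in> honeycomb_group" "g ` base_cube = Q" "u \<in> g ` base_vertices" by blast
  obtain f k where fk: "f \<in> face_group" "k \<in> signs" "g = f \<circ> k"
    using honeycomb_group_face_group[OF g(1)] .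
  have "f ` base_cube = Q" "u \<in> f ` base_vertices"
    using g fk signs_base_cube[OF fk(2)] signs_base_vertices[OF fk(2)]
    by (simp_all only: image_comp[symmetric])
  then show "u \<in> cube_vertices Q" using fk(1) unfolding cube_vertices_def by blast
qed (use face_group_honeycomb_group in \<open>auto simp: cube_vertices_def\<close>)

lemma cube_edges_iff:
  "e \<in> cube_edges Q \<longleftrightarrow>
     (\<exists>g\<in>honeycomb_group. g ` base_cube = Q \<and> e \<in> map_prod g g ` base_edges)"
proof
  assume "\<exists>g\<in>honeycomb_group. g ` base_cube = Q \<and> e \<in> map_prod g g ` base_edges"
  then obtain g where g: "g \<in> honeycomb_group" "g ` base_cube = Q" "e \<in> map_prod g g ` base_edges"
    by blast
  obtain e' where e': "e' \<in> base_edges" "e = map_prod g g e'" using g(3) by (rule imageE)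
  obtain f k where fk: "f \<in> face_group" "k \<in> signs" "g = f \<circ> k"
    using honeycomb_group_face_group[OF g(1)] .
  have "f ` base_cube = Q"
    using g(2) fk signs_base_cube[OF fk(2)] by (simp only: image_comp[symmetric])
  moreover have "map_prod k k e' \<in> base_edges" using signs_base_edges[OF fk(2)] e'(1) by blast
  moreover have "e = map_prod f f (map_prod k k e')"
    by (simp add: e'(2) fk(3) map_prod_def split_beta)
  ultimately show "e \<in> cube_edges Q" using fk(1) unfolding cube_edges_def by blast
qed (use face_group_honeycomb_group in \<open>auto simp: cube_edges_def\<close>)

lemma cube_faces_iff:
  "F \<in> cube_faces Q \<longleftrightarrow>
     (\<exists>g\<in>honeycomb_group. g ` base_cube = Q \<and> (\<exists>F0\<in>base_faces. F = g ` F0))"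
proof
  assume "\<exists>g\<in>honeycomb_group. g ` base_cube = Q \<and> (\<exists>F0\<in>base_faces. F = g ` F0)"
  then obtain g F0 where g: "g \<in> honeycomb_group" "g ` base_cube = Q" "F0 \<in> base_faces" "F = g ` F0"
    by blast
  obtain f k where fk: "f \<in> face_group" "k \<in> signs" "g = f \<circ> k"
    using honeycomb_group_face_group[OF g(1)] .
  have "f ` base_cube = Q" "F = f ` (k ` F0)"
    using g fk signs_base_cube[OF fk(2)] by (simp_all only: image_comp[symmetric])
  then show "F \<in> cube_faces Q"
    using fk(1) signs_base_faces[OF fk(2) g(3)] unfolding cube_faces_def by blast
qed (use face_group_honeycomb_group in \<open>auto simp: cube_faces_def\<close>)

section \<open>The symmetries fixing a vertex\<close>

text \<open>The face of the base cube through \<open>apex\<close> that is orthogonal to the coordinate axis \<open>k + 1\<close>.\<close>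

definition face_normal :: "nat \<Rightarrow> point" where
  "face_normal k = pt (if k = 0 then -1 else 0) (if k = 1 then -1 else 0)
     (if k = 2 then -1 else 0) (2 * phi - 3)"

text \<open>For \<open>k = 0\<close> the reflection adds (phi + 1) (a + d) times
  \<open>face_normal 0\<close>; the pairs (-1, -1) and (-1, 1) are - (phi + 1) and (phi + 1) (2 phi
  - 3) = phi - 1. The other axes are analogous.\<close>

fun face_reflection :: "nat \<Rightarrow> zvec \<Rightarrow> zvec" where
  "face_reflection k (a, b, c, d) =
     (if k = 0 then (zadd a (zmul (-1, -1) (zadd a d)), b, c, zadd d (zmul (-1, 1) (zadd a d)))
      else if k = 1 then (a, zadd b (zmul (-1, -1) (zadd b d)), c, zadd d (zmul (-1, 1) (zadd b d)))
      else (a, b, zadd c (zmul (-1, -1) (zadd c d)), zadd d (zmul (-1, 1) (zadd c d))))"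

text \<open>The action of the three face reflections at \<open>apex\<close> on the twelve vertices
  of the icosahedron.\<close>

definition face_permutation :: "nat \<Rightarrow> nat \<Rightarrow> nat" where
  "face_permutation k i = [[3, 1, 2, 0, 8, 7, 9, 5, 4, 6, 10, 11], [0, 4, 2, 8, 1, 6, 5, 10, 3, 9, 7, 11], [0, 1, 5, 7, 6, 2, 4, 3, 11, 9, 10, 8]] ! k ! i"

lemma face_reflection_table:
  "\<forall>k\<in>set [0..<3]. \<forall>i\<in>set [0..<12]. face_permutation k i < 12 \<and>
     face_reflection k (normal_table ! i) = normal_table ! face_permutation k i"
  by code_simp

lemma pt_half_width: "(axis i 1, half_width) = pt (if i = 1 then 1 else 0) (if i = 2 then 1 else 0)
     (if i = 3 then 1 else 0) (2 * phi - 3)"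
    "(- axis i 1, half_width) = pt (if i = 1 then -1 else 0) (if i = 2 then -1 else 0)
     (if i = 3 then -1 else 0) (2 * phi - 3)"
proof -
  have "(2 * phi - 3) / half_width = half_width"
    using half_width_pos half_width_phi by (simp add: divide_eq_eq power2_eq_square)
  then show "(axis i 1, half_width) = pt (if i = 1 then 1 else 0) (if i = 2 then 1 else 0)
     (if i = 3 then 1 else 0) (2 * phi - 3)"
    "(- axis i 1, half_width) = pt (if i = 1 then -1 else 0) (if i = 2 then -1 else 0)
     (if i = 3 then -1 else 0) (2 * phi - 3)"
    using exhaust_3[of i] by (auto simp: pt_def prod_eq_iff vec_eq_iff forall_3 axis_def)
qed

lemma face_normal_eq:
  "face_normal 0 = (- axis 1 1, half_width)" "face_normal 1 = (- axis 2 1, half_width)"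
  "face_normal 2 = (- axis 3 1, half_width)"
  by (simp_all add: face_normal_def pt_half_width)

lemma face_normal_mem:
  assumes "k < 3"
  shows "face_normal k \<in> face_normals"
proof -
  have "k = 0 \<or> k = 1 \<or> k = 2" using assms by auto
  then show ?thesis using face_normal_eq by (auto simp: face_normals_eq)
qed

lemma reflection_face_normal:
  assumes "k < 3"
  shows "reflection (face_normal k) (zpt v) = zpt (face_reflection k v)"
proof -
  obtain a b c d where v: "v = (a, b, c, d)" by (cases v rule: prod_cases4)
  define s where "s = (if k = 0 then zval a else if k = 1 then zval b else zval c) + zval d"
  have "lorentz (face_normal k) (face_normal k) = 4 - 2 * phi"
    using assms by (auto simp: face_normal_def lorentz_pt algebra_simps phi_mult)
  moreover have "lorentz (zpt v) (face_normal k) = - s"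
    using assms by (auto simp: face_normal_def v lorentz_pt s_def algebra_simps phi_mult)
  moreover have "2 * - s / (4 - 2 * phi) = - ((phi + 1) * s)"
    using phi_gt by (simp add: divide_simps) (simp add: algebra_simps phi_mult)
  ultimately have "reflection (face_normal k) (zpt v) = zpt v + ((phi + 1) * s) *\<^sub>R face_normal k"
    by (simp add: reflection_def)
  also have "\<dots> = zpt (face_reflection k v)"
    using assms
    by (auto simp: v face_normal_def pt_arith pt_eq_iff zval_zadd zval_zmul zval_def[of "(-1, -1)"]
        zval_def[of "(-1, 1)"] s_def algebra_simps phi_mult)
  finally show ?thesis .
qed

lemma reflection_face_normal_nrm:
  assumes "k < 3" "i < 12"
  shows "reflection (face_normal k) (nrm i) = nrm (face_permutation k i)" "face_permutation k i < 12"
  using face_reflection_table assms by (auto simp: nrm_def reflection_face_normal)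

text \<open>The symmetries of the dodecahedron around \<open>apex\<close>, given by what they
  preserve rather than by generators.\<close>

definition stabilizer :: "(point \<Rightarrow> point) set" where
  "stabilizer = {g \<in> isometries. g apex = apex \<and> g ` normals = normals}"

lemma stabilizerD:
  assumes "g \<in> stabilizer"
  shows "g \<in> isometries" "g apex = apex" "g ` normals = normals" "n \<in> normals \<Longrightarrow> g n \<in> normals"
  using assms by (auto simp: stabilizer_def)

lemma stabilizer_comp:
  assumes "g \<in> stabilizer" "h \<in> stabilizer"
  shows "g \<circ> h \<in> stabilizer"
proof -
  have "(g \<circ> h) ` normals = normals"
    by (simp only: image_comp[symmetric] stabilizerD(3)[OF assms(1)] stabilizerD(3)[OF assms(2)])
  then show ?thesis
    using assms comp_isometry[of g h] by (simp add: stabilizer_def)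
qed

lemma stabilizer_id: "id \<in> stabilizer"
  by (simp add: stabilizer_def id_isometry)

lemma face_reflection_stabilizer:
  assumes "k < 3"
  shows "reflection (face_normal k) \<in> stabilizer"
proof -
  note sp = face_normals_spacelike[OF face_normal_mem[OF assms]]
  have sub: "reflection (face_normal k) n \<in> normals" if "n \<in> normals" for n
    using that reflection_face_normal_nrm[OF assms] by (auto simp: normals_def)
  have "normals \<subseteq> reflection (face_normal k) ` normals"
  proof
    fix n assume "n \<in> normals"
    then have "reflection (face_normal k) n \<in> normals"
        "n = reflection (face_normal k) (reflection (face_normal k) n)"
      using sub reflection_involutive[OF sp] by simp_all
    then show "n \<in> reflection (face_normal k) ` normals" by (rule rev_image_eqI)
  qed
  moreover have "lorentz apex (face_normal k) = 0"
  proof -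
    have "lorentz (pt (-1) (-1) (-1) 1) (face_normal k) = 0"
      using assms by (auto simp: face_normal_def lorentz_pt algebra_simps phi_mult)
    then show ?thesis by (simp add: apex_def lorentz_simps)
  qed
  ultimately show ?thesis
    using sub reflection_isometry[OF sp] by (auto simp: stabilizer_def reflection_orthogonal)
qed

text \<open>The twenty cubes at \<open>apex\<close>: the words in the reflections in the faces of the base cube at
  \<open>apex\<close> that carry the base cube to them.\<close>

definition cube_words :: "nat list list" where
  "cube_words = [[], [0], [1], [2], [1, 0], [2, 0], [0, 1], [2, 1], [0, 2], [1, 2], [2, 1, 0], [1, 2, 0], [2, 0, 1], [0, 2, 1], [1, 0, 2], [0, 1, 2], [0, 2, 1, 0], [0, 1, 2, 0], [1, 2, 0, 1], [1, 0, 2, 1, 0]]"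

text \<open>The twenty triangles of the icosahedron graph: the three edges at \<open>apex\<close> of
  a cube have pairwise orthogonal bisectors.\<close>

definition cube_axes :: "nat list list" where
  "cube_axes = [[0, 1, 2], [3, 1, 2], [0, 4, 2], [0, 1, 5], [8, 4, 2], [7, 1, 5], [3, 8, 2], [0, 6, 5], [3, 1, 7], [0, 4, 6], [11, 6, 5], [10, 4, 6], [7, 11, 5], [3, 9, 7], [8, 4, 10], [3, 8, 9], [11, 9, 7], [10, 8, 9], [10, 11, 6], [11, 9, 10]]"

lemma cube_words_axes: "map (\<lambda>ks. map (foldr face_permutation ks) [0, 1, 2]) cube_words = cube_axes"
  by code_simp

text \<open>A set of axes and a direction compatible with all of them lie in one triangle, hence
  belong to a common cube at \<open>apex\<close>.\<close>

lemma cube_axes_table: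
  "list_all (\<lambda>I. list_all (\<lambda>n. list_all (\<lambda>x. n = x \<or> adjacent n x) I \<longrightarrow>
     list_ex (\<lambda>t. list_all (\<lambda>x. List.member t x) (n # I)) cube_axes) [0..<12]) (subseqs [0, 1, 2])"
  by code_simp

lemma cube_words_range: "list_all (list_all (\<lambda>k. k < 3)) cube_words"
  by code_simp

lemma face_word:
  assumes "list_all (\<lambda>k. k < 3) ks"
  shows "\<exists>g\<in>stabilizer. g \<in> honeycomb_group \<and>
      (\<forall>i<12. g (nrm i) = nrm (foldr face_permutation ks i) \<and> foldr face_permutation ks i < 12)"
  using assms
proof (induction ks)
  case Nil
  show ?case
  proof (rule bexI)
    show "id \<in> honeycomb_group \<and> (\<forall>i<12. id (nrm i) = nrm (foldr face_permutation [] i)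
        \<and> foldr face_permutation [] i < 12)"
      by (intro conjI honeycomb_group.id) simp
  qed (rule stabilizer_id)
next
  case (Cons k ks)
  then have k: "k < 3" by simp
  obtain h where h: "h \<in> stabilizer" "h \<in> honeycomb_group" "\<And>i. i < 12 \<Longrightarrow>
      h (nrm i) = nrm (foldr face_permutation ks i) \<and> foldr face_permutation ks i < 12"
    using Cons by auto
  show ?case
  proof (rule bexI)
    show "reflection (face_normal k) \<circ> h \<in> stabilizer"
      using stabilizer_comp[OF face_reflection_stabilizer[OF k] h(1)] .
    have "reflection (face_normal k) \<circ> h \<in> honeycomb_group"
      by (intro honeycomb_group_comp honeycomb_group_reflection h(2) mirrorsI face_normal_mem k)
    then show "reflection (face_normal k) \<circ> h \<in> honeycomb_group \<and>
        (\<forall>i<12. (reflection (face_normal k) \<circ> h) (nrm i) = nrm (foldr face_permutation (k # ks) i)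
          \<and> foldr face_permutation (k # ks) i < 12)"
      using h(3) reflection_face_normal_nrm[OF k] by (intro conjI allI impI) simp_all
  qed
qed

text \<open>Provides a cube at \<open>apex\<close> whose edge normals include \<open>n\<close> and
  all of \<open>I\<close>. With \<open>I\<close> the walls of a vertex it will become a cube of the
  pyramid; with \<open>I\<close> empty it shows that every normal is the image of an axis.\<close>

lemma cube_at_apex:
  assumes I: "I \<subseteq> axes" and n: "n \<in> normals" and orth: "\<And>x. x \<in> I \<Longrightarrow> n = x \<or> lorentz n x = 0"
  obtains g where "g \<in> stabilizer" "g \<in> honeycomb_group" "insert n I \<subseteq> g ` axes"
proof -
  define J where "J = {i. i < 3 \<and> nrm i \<in> I}"
  have J: "I = nrm ` J" using I by (auto simp: J_def axes_def)
  have "J \<in> Pow {0, 1, 2}" by (auto simp: J_def numeral_eq_Suc less_Suc_eq)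
  moreover have "\<forall>J\<in>Pow {0, 1, 2::nat}. \<exists>L\<in>set (subseqs [0, 1, 2]). set L = J"
    by (simp add: Pow_insert)
  ultimately have "\<exists>L\<in>set (subseqs [0, 1, 2]). set L = J" by (rule bspec[rotated])
  then obtain L where L: "L \<in> set (subseqs [0, 1, 2])" "set L = J" by (elim bexE)
  obtain m where m: "m < 12" "n = nrm m" using n by (auto simp: normals_def)
  have "m = x \<or> adjacent m x" if "x \<in> set L" for x
  proof -
    have x: "x < 12" "nrm x \<in> I" using that L(2) by (auto simp: J_def)
    show ?thesis
      using orth[OF x(2)] m nrm_eq_iff[OF m(1) x(1)] lorentz_nrm_0[OF m(1) x(1)] by auto
  qed
  then obtain t where t: "t \<in> set cube_axes" "\<forall>x\<in>set (m # L). x \<in> set t"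
    using cube_axes_table[unfolded list_all_iff list_ex_iff, rule_format, OF L(1), of m] m(1)
    by auto
  then obtain ks where ks: "ks \<in> set cube_words"
      "\<forall>x\<in>set (m # L). x \<in> set (map (foldr face_permutation ks) [0, 1, 2])"
    unfolding cube_words_axes[symmetric] set_map[of _ cube_words] by (elim imageE) blast
  have "list_all (\<lambda>k. k < 3) ks" using cube_words_range ks(1) by (auto simp: list_all_iff)
  then obtain g where g: "g \<in> stabilizer" "g \<in> honeycomb_group"
      "\<And>i. i < 12 \<Longrightarrow> g (nrm i) = nrm (foldr face_permutation ks i)"
    using face_word by blast
  have "insert n I \<subseteq> g ` axes"
  proof
    fix p assume "p \<in> insert n I"
    then obtain x where x: "x \<in> set (m # L)" "p = nrm x" using m(2) J L(2) by auto
    then obtain i where i: "i \<in> set [0, 1, 2]" "x = foldr face_permutation ks i"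
      using ks(2) by auto
    then have i3: "i < 3" by auto
    then have "p = g (nrm i)" using g(3)[of i] x(2) i(2) by simp
    moreover have "nrm i \<in> axes" using i3 by (auto simp: axes_def)
    ultimately show "p \<in> g ` axes" by blast
  qed
  then show thesis using that g by blast
qed

text \<open>Each of the twelve normals is the image of an axis, so its reflection is a conjugate of
  a generator.\<close>

lemma weyl_honeycomb_group:
  assumes "w \<in> weyl"
  shows "w \<in> honeycomb_group"
proof -
  have refl: "reflection n \<in> honeycomb_group" if "n \<in> normals" for n
  proof -
    have "\<exists>g\<in>honeycomb_group. n \<in> g ` axes"
      by (rule cube_at_apex[of "{}" n]) (use that in blast)+
    then obtain g where g: "g \<in> honeycomb_group" "n \<in> g ` axes" by blast
    then obtain a where a: "a \<in> axes" "n = g a" by blast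
    have "reflection n \<circ> (g \<circ> inv g) = g \<circ> reflection a \<circ> inv g"
      using isometry_reflection[OF honeycomb_group_isometry[OF g(1)], of a] a(2)
      by (simp only: comp_assoc[symmetric])
    moreover have "g \<circ> inv g = id" using honeycomb_group_inv_comp(2)[OF g(1)] by auto
    moreover have "g \<circ> reflection a \<circ> inv g \<in> honeycomb_group"
      by (intro honeycomb_group_comp honeycomb_group_reflection mirrorsI a honeycomb_group_inv g)
    ultimately show ?thesis by simp
  qed
  have "w \<in> words k \<Longrightarrow> w \<in> honeycomb_group" for k
  proof (induction k arbitrary: w)
    case 0
    then have "w = id" by simp
    then show ?case by (simp only: honeycomb_group.id)
  next
    case (Suc k)
    then obtain n v where nv: "n \<in> normals" "v \<in> words k" "w = reflection n \<circ> v" by auto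
    show ?case unfolding nv(3) by (intro honeycomb_group_comp refl nv Suc.IH)
  qed
  then show ?thesis using len_words[OF assms] .
qed

text \<open>The products of this form are closed under right multiplication by the generators. A
  midplane reflection passes the stabilizer element as another midplane reflection; a reflection in
  a face at \<open>apex\<close> is absorbed by the stabilizer; the opposite face is the image of one
  at \<open>apex\<close> under the reflection in an axis.\<close>

lemma honeycomb_group_cases:
  assumes "g \<in> honeycomb_group"
  obtains w h where "w \<in> weyl" "h \<in> stabilizer" "g = w \<circ> h"
proof -
  define S where "S = {w \<circ> h |w h. w \<in> weyl \<and> h \<in> stabilizer}"
  have S1: "g \<circ> reflection a \<in> S" if gS: "g \<in> S" and a: "a \<in> normals" for g a
  proof -
    obtain w h where wh: "w \<in> weyl" "h \<in> stabilizer" "g = w \<circ> h" using gS unfolding S_def by blast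
    have "g \<circ> reflection a = (w \<circ> reflection (h a)) \<circ> h"
      using isometry_reflection[OF stabilizerD(1)[OF wh(2)], of a] by (simp only: wh(3) comp_assoc)
    moreover have "w \<circ> reflection (h a) \<in> weyl"
      using weyl_comp[OF wh(1) weyl_reflection[OF stabilizerD(4)[OF wh(2) a]]] .
    ultimately show ?thesis using wh(2) unfolding S_def by blast
  qed
  have S2: "g \<circ> reflection (face_normal k) \<in> S" if gS: "g \<in> S" and k: "k < 3" for g k
  proof -
    obtain w h where wh: "w \<in> weyl" "h \<in> stabilizer" "g = w \<circ> h" using gS unfolding S_def by blast
    have "g \<circ> reflection (face_normal k) = w \<circ> (h \<circ> reflection (face_normal k))"
      by (simp only: wh(3) comp_assoc)
    then show ?thesis
      using wh stabilizer_comp[OF wh(2) face_reflection_stabilizer[OF k]] unfolding S_def by blast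
  qed
  have faces: "\<exists>k<3. n = face_normal k \<or> (\<exists>a\<in>axes. n = reflection a (face_normal k))"
    if n: "n \<in> face_normals" for n
  proof -
    obtain j where j: "n = (axis j 1, half_width) \<or> n = (- axis j 1, half_width)"
      using n by (auto simp: face_normals_eq)
    obtain k where k: "k < 3" "face_normal k = (- axis j 1, half_width)"
    proof -
      consider "j = 1" | "j = 2" | "j = 3" using exhaust_3[of j] by blast
      then show thesis
        by cases (use face_normal_eq that[of 0] that[of 1] that[of 2] in simp_all)
    qed
    have "reflection (ax j) (- axis j 1, half_width) = (axis j 1, half_width)"
      by (auto simp: prod_eq_iff vec_eq_iff reflection_ax axis_def)
    then have "n = face_normal k \<or> n = reflection (ax j) (face_normal k)"
      using j k(2) by auto
    then show ?thesis using k(1) axes_eq by blast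
  qed
  have "g \<in> S" using assms
  proof (induction rule: honeycomb_group.induct)
    case id
    have "id = id \<circ> (id :: point \<Rightarrow> point)" by simp
    then show ?case unfolding S_def using weyl_id stabilizer_id by blast
  next
    case (refl g n)
    show ?case
    proof (cases "n \<in> axes")
      case True
      then show ?thesis using S1[OF refl(3)] axes_normals by blast
    next
      case False
      then obtain k where k: "k < 3" "n = face_normal k \<or> (\<exists>a\<in>axes. n = reflection a (face_normal k))"
        using faces[of n] refl(2) unfolding mirrors_def by blast
      show ?thesis
      proof (cases "n = face_normal k")
        case True
        then show ?thesis using S2[OF refl(3) k(1)] by (simp only:)
      next
        case False
        then obtain a where a: "a \<in> axes" "n = reflection a (face_normal k)" using k(2) by blast
        have aN: "a \<in> normals" using a axes_normals by blast
        have "reflection n = reflection a \<circ> reflection (face_normal k) \<circ> reflection a"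
          using isometry_reflection[OF reflection_normal_isometry[OF aN], of "face_normal k"]
            reflection_normal_involutive(4)[OF aN] a(2) by simp
        then have "g \<circ> reflection n = g \<circ> reflection a \<circ> reflection (face_normal k) \<circ> reflection a"
          by (simp only: comp_assoc)
        then show ?thesis using S1[OF S2[OF S1[OF refl(3) aN] k(1)] aN] by (simp only:)
      qed
    qed
  qed
  then show thesis using that unfolding S_def by blast
qed

text \<open>On the octant where the three coordinates lie between -d and 0, the twelve inequalities
  are combinations of these bounds with the multipliers 1 and \<open>phi\<close>. So this octant of
  the cube lies in the dodecahedron around \<open>apex\<close>.\<close>

lemma base_cube_apex_chamber:
  assumes "p \<in> base_cube" "\<And>j. fst p $ j \<le> 0" "n \<in> normals"
  shows "lorentz n p \<le> 0"
proof -
  obtain a b c d where p: "p = pt a b c d" using pt_cases .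
  have abc: "a \<le> 0" "b \<le> 0" "c \<le> 0" "- d \<le> a" "- d \<le> b" "- d \<le> c"
    using assms(1) assms(2)[of 1] assms(2)[of 2] assms(2)[of 3]
    by (auto simp: p base_cube_pt fst_pt)
  then have d: "0 \<le> d" by linarith
  have phi: "phi * (- d) \<le> phi * a" "phi * (- d) \<le> phi * b" "phi * (- d) \<le> phi * c" "0 \<le> phi * d"
    using mult_left_mono[OF abc(4), of phi] mult_left_mono[OF abc(5), of phi]
      mult_left_mono[OF abc(6), of phi] phi_gt d by simp_all
  obtain i where i: "i < 12" "n = nrm i" using assms(3) by (auto simp: normals_def)
  have "\<forall>i\<in>set [0..<12]. lorentz (nrm i) (pt a b c d) \<le> 0"
    using abc d phi
    by (simp add: upt_rec numeral_eq_Suc[symmetric])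
      (simp add: nrm_def normal_table_def lorentz_pt zval_def algebra_simps phi_mult)
  then show ?thesis using i p by simp
qed

text \<open>A sign change moves the vertex into the octant of \<open>apex\<close>, where freeness
  makes it equal to \<open>apex\<close>.\<close>

lemma vertex_in_base_cube:
  assumes "w \<in> weyl" "w apex \<in> base_cube"
  shows "w apex \<in> base_vertices"
proof -
  obtain g where g: "g \<in> signs" "g (w apex) = ((\<chi> j. - \<bar>fst (w apex) $ j\<bar>), snd (w apex))"
    by (rule sign_change[of "((\<chi> j. - \<bar>fst (w apex) $ j\<bar>), snd (w apex))" "w apex"]) auto
  have gc: "g (w apex) \<in> base_cube" using signs_base_cube[OF g(1)] assms(2) by blast
  have "g \<circ> w = id"
  proof (rule weyl_free)
    show "g \<circ> w \<in> weyl" using weyl_comp[OF signs_weyl[OF g(1)] assms(1)] .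
    show "lorentz m ((g \<circ> w) apex) \<le> 0" if "m \<in> normals" for m
      using base_cube_apex_chamber[OF gc _ that] g(2) by simp
  qed
  then have "g (w apex) = apex" by (metis comp_apply id_apply)
  then have "g (w apex) \<in> g ` base_vertices"
    using apex_base_vertex signs_base_vertices[OF g(1)] by simp
  then show ?thesis
    using inj_image_mem_iff[OF isometriesD(3)[OF weyl_isometry[OF signs_weyl[OF g(1)]]]] by blast
qed

lemma honeycomb_group_apex:
  assumes "g \<in> honeycomb_group"
  obtains w where "w \<in> weyl" "g apex = w apex"
  using honeycomb_group_cases[OF assms] stabilizerD(2) by (metis comp_apply)

lemma honeycomb_vertex_in_base_cube:
  assumes "g \<in> honeycomb_group" "g apex \<in> base_cube"
  shows "g apex \<in> base_vertices"
  using honeycomb_group_apex[OF assms(1)] vertex_in_base_cube assms(2) by metis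

text \<open>The distance of two base vertices determines in how many coordinates they differ. Hence
  every isometry that maps base vertices to base vertices preserves adjacency.\<close>

lemma base_vertices_lorentz:
  assumes p: "p \<in> base_vertices" and q: "q \<in> base_vertices"
  shows "lorentz p q = lorentz apex apex
    - 2 * (half_width * snd apex)\<^sup>2 * card {i. fst p $ i \<noteq> fst q $ i}"
proof -
  define r where "r = half_width * snd apex"
  have "fst p $ i * fst q $ i = r\<^sup>2 - (if fst p $ i \<noteq> fst q $ i then 2 * r\<^sup>2 else 0)" for i
  proof -
    have "\<bar>fst p $ i\<bar> = r" "\<bar>fst q $ i\<bar> = r"
      using p q base_vertices_height_eq[OF p] base_vertices_height_eq[OF q]
      by (simp_all add: base_vertices_def r_def)
    then have "fst p $ i = r \<or> fst p $ i = - r" "fst q $ i = r \<or> fst q $ i = - r"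
      by linarith+
    then show ?thesis by (elim disjE) (simp_all add: power2_eq_square)
  qed
  then have "fst p \<bullet> fst q = (\<Sum>i\<in>UNIV. r\<^sup>2 - (if fst p $ i \<noteq> fst q $ i then 2 * r\<^sup>2 else 0))"
    by (simp add: inner_vec_def)
  also have "\<dots> = 3 * r\<^sup>2 - 2 * r\<^sup>2 * card {i. fst p $ i \<noteq> fst q $ i}"
    by (simp add: sum_subtractf sum.If_cases)
  finally have "lorentz p q = 3 * r\<^sup>2 - 2 * r\<^sup>2 * card {i. fst p $ i \<noteq> fst q $ i} - (snd apex)\<^sup>2"
    using base_vertices_height_eq[OF p] base_vertices_height_eq[OF q]
    by (simp add: lorentz_def power2_eq_square)
  moreover have "fst apex \<bullet> fst apex = 3 * r\<^sup>2"
    by (simp add: inner_vec_def fst_apex r_def power2_eq_square)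
  ultimately show ?thesis
    by (simp add: lorentz_def r_def power2_eq_square)
qed

lemma base_cube_apex: "apex \<in> base_cube"
proof -
  obtain a b c d where a: "apex = pt a b c d" using pt_cases .
  have "snd apex > 0" using apex_in_hyperbolic_space by (simp add: hyperbolic_space_def)
  then show ?thesis
    using apex_in_hyperbolic_space fst_apex[of 1] fst_apex[of 2] fst_apex[of 3] half_width_pos
    by (simp add: a base_cube_pt fst_pt snd_pt)
qed

lemma base_cube_stabilizer_edges:
  assumes g: "g \<in> honeycomb_group" "g ` base_cube = base_cube"
  shows "map_prod g g ` base_edges \<subseteq> base_edges"
proof
  have v: "g p \<in> base_vertices" if p: "p \<in> base_vertices" for p
  proof -
    obtain f where f: "f \<in> signs" "p = f apex" using p base_vertices_eq by blast
    have "p \<in> base_cube" using f signs_base_cube[OF f(1)] base_cube_apex by blast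
    then have "(g \<circ> f) apex \<in> base_cube" using g(2) f(2) by auto
    then show ?thesis
      using honeycomb_vertex_in_base_cube[OF honeycomb_group_comp[OF g(1)
            signs_honeycomb_group[OF f(1)]]] f(2) by simp
  qed
  fix e assume "e \<in> map_prod g g ` base_edges"
  then obtain p q where pq: "(p, q) \<in> base_edges" "e = (g p, g q)" by auto
  then have pv: "p \<in> base_vertices" "q \<in> base_vertices" "card {i. fst p $ i \<noteq> fst q $ i} = 1"
    by (auto simp: base_edges_def)
  have "half_width * snd apex \<noteq> 0"
    using half_width_pos apex_in_hyperbolic_space by (simp add: hyperbolic_space_def)
  then have "card {i. fst (g p) $ i \<noteq> fst (g q) $ i} = card {i. fst p $ i \<noteq> fst q $ i}"
    using isometriesD(4)[OF honeycomb_group_isometry[OF g(1)], of p q]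
      base_vertices_lorentz[OF v[OF pv(1)] v[OF pv(2)]] base_vertices_lorentz[OF pv(1,2)] by simp
  then show "e \<in> base_edges" using pq(2) pv v by (simp add: base_edges_def)
qed

text \<open>\<open>cube_edges\<close> collects the edges over all group elements with the same image
  of the base cube. Two such elements differ by a symmetry of the base cube, which preserves the
  base edges, so one of them suffices.\<close>

lemma cube_edges_image:
  assumes "h \<in> honeycomb_group"
  shows "cube_edges (h ` base_cube) = map_prod h h ` base_edges"
proof (intro subset_antisym subsetI)
  fix e assume "e \<in> cube_edges (h ` base_cube)"
  then obtain g where g: "g \<in> honeycomb_group" "g ` base_cube = h ` base_cube"
    "e \<in> map_prod g g ` base_edges" unfolding cube_edges_iff by blast
  obtain e' where e': "e' \<in> base_edges" "e = map_prod g g e'" using g(3) by (rule imageE)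
  define k where "k = inv h \<circ> g"
  have k: "k \<in> honeycomb_group"
    unfolding k_def by (intro honeycomb_group_comp honeycomb_group_inv assms g)
  have "k ` base_cube = inv h ` h ` base_cube" unfolding k_def using g(2) by (simp only: image_comp[symmetric])
  also have "\<dots> = base_cube"
    by (simp add: image_image honeycomb_group_inv_comp(1)[OF assms])
  finally have "map_prod k k e' \<in> base_edges" using base_cube_stabilizer_edges[OF k] e'(1) by blast
  moreover have "e = map_prod h h (map_prod k k e')"
    by (simp add: e'(2) k_def map_prod_def split_beta honeycomb_group_inv_comp(2)[OF assms])
  ultimately show "e \<in> map_prod h h ` base_edges" by blast
qed (use assms cube_edges_iff in blast)

section \<open>The pyramid in terms of the Coxeter group\<close>

lemma lorentz_reflection_difference:
  assumes "a \<in> axes"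
  shows "lorentz p (reflection a x) = lorentz p x - 2 * lorentz x a * lorentz p a"
  using normals_unit[of a] axes_normals assms
  by (auto simp: reflection_def lorentz_simps)

text \<open>The four parallel edges of the cube share one bisector, the coordinate plane orthogonal
  to \<open>a\<close>.\<close>

lemma bisector_base_edge:
  assumes "f \<in> signs" "a \<in> axes"
  shows "bisector (f apex) (f (reflection a apex)) = {p \<in> hyperbolic_space. lorentz p a = 0}"
proof -
  have aN: "a \<in> normals" using assms(2) axes_normals by blast
  have "lorentz (f apex) (f a) \<noteq> 0"
    using lorentz_normal_apex_neg[OF aN] lorentz_weyl[OF signs_weyl[OF assms(1)]]
    by (simp add: lorentz_commute)
  then have "lorentz (f apex) a \<noteq> 0"
    using signs_axes[OF assms] by (auto simp: lorentz_simps)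
  moreover have "f (reflection a apex) = reflection a (f apex)"
    using fun_cong[OF signs_commute[OF assms], of apex] by simp
  ultimately show ?thesis
    using assms(2) by (simp add: bisector_def lorentz_reflection_difference)
qed

lemma nearer_apex:
  assumes "a \<in> axes"
  shows "nearer apex (reflection a apex) = {p \<in> hyperbolic_space. lorentz p a < 0}"
    "nearer (reflection a apex) apex = {p \<in> hyperbolic_space. lorentz p a > 0}"
proof -
  have "lorentz apex a < 0"
    using lorentz_normal_apex_neg[of a] axes_normals assms by (simp add: lorentz_commute subset_iff)
  then show "nearer apex (reflection a apex) = {p \<in> hyperbolic_space. lorentz p a < 0}"
    "nearer (reflection a apex) apex = {p \<in> hyperbolic_space. lorentz p a > 0}"
    using assms by (auto simp: nearer_def lorentz_reflection_difference zero_less_mult_iff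
        mult_less_0_iff)
qed

lemma isometry_halfspace_image:
  assumes "g \<in> isometries"
  shows "g ` {p \<in> hyperbolic_space. P (lorentz p n)} = {p \<in> hyperbolic_space. P (lorentz p (g n))}"
proof (intro subset_antisym subsetI)
  fix p assume p: "p \<in> {p \<in> hyperbolic_space. P (lorentz p (g n))}"
  then obtain q where q: "q \<in> hyperbolic_space" "p = g q"
    using isometriesD(5)[OF assms] by blast
  then have "q \<in> {p \<in> hyperbolic_space. P (lorentz p n)}"
    using p isometriesD(4)[OF assms, of q n] by simp
  then show "p \<in> g ` {p \<in> hyperbolic_space. P (lorentz p n)}" using q(2) by blast
next
  fix p assume "p \<in> g ` {p \<in> hyperbolic_space. P (lorentz p n)}"
  then obtain q where "q \<in> hyperbolic_space" "P (lorentz q n)" "p = g q" by blast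
  then show "p \<in> {p \<in> hyperbolic_space. P (lorentz p (g n))}"
    using isometriesD(4)[OF assms, of q n] isometriesD(6)[OF assms, of q] by simp
qed

lemma honeycomb_group_vertex:
  assumes "k \<in> honeycomb_group" "f \<in> signs"
  obtains w s where "w \<in> weyl" "s \<in> stabilizer" "k \<circ> f = w \<circ> s" "k (f apex) = w apex"
proof -
  obtain w s where ws: "w \<in> weyl" "s \<in> stabilizer" "k \<circ> f = w \<circ> s"
    using honeycomb_group_cases[OF honeycomb_group_comp[OF assms(1) signs_honeycomb_group[OF assms(2)]]] .
  moreover have "k (f apex) = w apex"
    using fun_cong[OF ws(3), of apex] stabilizerD(2)[OF ws(2)] by simp
  ultimately show thesis using that by blast
qed

text \<open>With \<open>k b = w n\<close>, the midpoint of the edge from \<open>w apex\<close> to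
  \<open>w (reflection n apex)\<close> lies on both mirrors. So \<open>a\<close> takes opposite
  values at the endpoints and separates them.\<close>

lemma common_mirror:
  assumes k: "k \<in> honeycomb_group" and a: "a \<in> axes" and b: "b \<in> axes"
    and eq: "{p \<in> hyperbolic_space. lorentz p (k b) = 0} = {p \<in> hyperbolic_space. lorentz p a = 0}"
  shows "k b = a \<or> k b = - a"
proof -
  have aN: "a \<in> normals" and bN: "b \<in> normals" using a b axes_normals by blast+
  obtain w s where ws: "w \<in> weyl" "s \<in> stabilizer" "k = w \<circ> s"
    using honeycomb_group_cases[OF k] .
  define n where "n = s b"
  have n: "n \<in> normals" "k b = w n" using stabilizerD(4)[OF ws(2) bN] ws(3) by (simp_all add: n_def)
  have y: "w (reflection n apex) \<in> hyperbolic_space"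
    using weyl_hyperbolic[OF weyl_comp[OF ws(1) weyl_reflection[OF n(1)]]] by simp
  obtain c where c: "c > 0" "c *\<^sub>R (w apex + w (reflection n apex)) \<in> hyperbolic_space"
    using midpoint_in_hyperbolic_space[OF weyl_hyperbolic[OF ws(1)] y] .
  have "lorentz (w apex + w (reflection n apex)) (w n) = lorentz n apex + lorentz n (reflection n apex)"
    using lorentz_weyl[OF ws(1)] by (simp only: lorentz_simps lorentz_commute[of _ "w n"])
  also have "\<dots> = 0"
    using normals_unit[OF n(1)] by (simp add: lorentz_reflection_normal_left[OF n(1)])
  finally have "c *\<^sub>R (w apex + w (reflection n apex)) \<in> {p \<in> hyperbolic_space. lorentz p (k b) = 0}"
    using c(2) n(2) by (simp only: mem_Collect_eq lorentz_simps(5) mult_zero_right)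
  then have "lorentz (c *\<^sub>R (w apex + w (reflection n apex))) a = 0" using eq by blast
  then have "lorentz (w apex + w (reflection n apex)) a = 0"
    using c(1) by (simp only: lorentz_simps(5) mult_eq_0_iff) simp
  then have "lorentz a (w apex) + lorentz a (w (reflection n apex)) = 0"
    by (simp only: lorentz_simps(2) lorentz_commute[of _ a])
  then have "w n = a \<or> w n = - a"
    by (intro separating_wall[OF ws(1) aN n(1)]) linarith
  then show ?thesis by (simp only: n(2))
qed

text \<open>After division by the last coordinate the cube is the convex hull of its vertices; the
  vertex \<open>v\<close>, with signs opposite to those of \<open>z\<close>, is where the functional
  is smallest.\<close>

lemma base_cube_convex:
  assumes pos: "\<And>v. v \<in> base_vertices \<Longrightarrow> lorentz z v > 0" and p: "p \<in> base_cube"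
  shows "lorentz z p > 0"
proof -
  define t where "t = snd apex"
  have t: "t > 0" using apex_in_hyperbolic_space by (simp add: t_def hyperbolic_space_def)
  define v :: point where "v = ((\<chi> j. if fst z $ j > 0 then - (half_width * t) else half_width * t), t)"
  obtain f where f: "f \<in> signs" "f apex = v"
    by (rule sign_change[of v apex]) (auto simp: v_def fst_apex t_def)
  have "v \<in> base_vertices" using f base_vertices_eq by blast
  moreover have "lorentz z v = - t * ((\<Sum>j\<in>UNIV. \<bar>fst z $ j\<bar> * half_width) + snd z)"
  proof -
    have "fst z $ j * fst v $ j = - t * (\<bar>fst z $ j\<bar> * half_width)" for j
      by (simp add: v_def)
    then have "fst z \<bullet> fst v = - t * (\<Sum>j\<in>UNIV. \<bar>fst z $ j\<bar> * half_width)"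
      unfolding sum_distrib_left by (simp add: inner_vec_def)
    then show ?thesis by (simp add: lorentz_def v_def algebra_simps)
  qed
  ultimately have neg: "(\<Sum>j\<in>UNIV. \<bar>fst z $ j\<bar> * half_width) + snd z < 0"
    using pos[of v] t by (simp add: mult_less_0_iff)
  obtain a b c d where "p = pt a b c d" using pt_cases .
  then have bound: "\<bar>fst p $ j\<bar> \<le> half_width * snd p" and sp: "snd p > 0" for j
    using p exhaust_3[of j] by (auto simp: base_cube_pt fst_pt snd_pt hyperbolic_space_def)
  have "(\<Sum>j\<in>UNIV. - (\<bar>fst z $ j\<bar> * half_width) * snd p) \<le> (\<Sum>j\<in>UNIV. fst z $ j * fst p $ j)"
  proof (rule sum_mono)
    fix j
    have "\<bar>fst z $ j * fst p $ j\<bar> \<le> \<bar>fst z $ j\<bar> * (half_width * snd p)"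
      unfolding abs_mult using bound by (intro mult_left_mono) auto
    then show "- (\<bar>fst z $ j\<bar> * half_width) * snd p \<le> fst z $ j * fst p $ j"
      by (simp add: algebra_simps abs_le_iff)
  qed
  moreover have "(\<Sum>j\<in>UNIV. - (\<bar>fst z $ j\<bar> * half_width) * snd p)
      = - (\<Sum>j\<in>UNIV. \<bar>fst z $ j\<bar> * half_width) * snd p"
    unfolding sum_distrib_right sum_negf[symmetric] by simp
  moreover have "lorentz z p = (\<Sum>j\<in>UNIV. fst z $ j * fst p $ j) - snd z * snd p"
    by (simp add: lorentz_def inner_vec_def)
  ultimately have "- ((\<Sum>j\<in>UNIV. \<bar>fst z $ j\<bar> * half_width) + snd z) * snd p \<le> lorentz z p"
    unfolding minus_add_distrib distrib_right by linarith
  moreover have "- ((\<Sum>j\<in>UNIV. \<bar>fst z $ j\<bar> * half_width) + snd z) * snd p > 0"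
    using neg sp by (intro mult_pos_pos) auto
  ultimately show ?thesis by linarith
qed

text \<open>Walk through the vertices of the cube along its edges: a change of side would make one
  of its midplanes the midplane of \<open>a\<close>, against \<open>nc\<close>. Convexity then
  covers the whole cube.\<close>

lemma cube_on_one_side:
  assumes k: "k \<in> honeycomb_group" and a: "a \<in> axes" and pos: "lorentz a (k apex) > 0"
    and nc: "\<And>b. b \<in> axes \<Longrightarrow> k b \<noteq> a \<and> k b \<noteq> - a" and p: "p \<in> base_cube"
  shows "lorentz a (k p) > 0"
proof -
  have aN: "a \<in> normals" using a axes_normals by blast
  have vert: "lorentz a (k (f apex)) > 0" if "f \<in> signs" for f
    using that
  proof (induction rule: signs.induct)
    case id
    then show ?case using pos by simp
  next
    case (refl f b)
    have bN: "b \<in> normals" using refl(2) axes_normals by blast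
    obtain w s where ws: "w \<in> weyl" "s \<in> stabilizer" "k \<circ> f = w \<circ> s" "k (f apex) = w apex"
      using honeycomb_group_vertex[OF k refl(1)] .
    have sb: "s b \<in> normals" using stabilizerD(4)[OF ws(2) bN] .
    have "s (reflection b apex) = reflection (s b) apex"
      using fun_cong[OF isometry_reflection[OF stabilizerD(1)[OF ws(2)], of b], of apex]
        stabilizerD(2)[OF ws(2)] by simp
    then have e: "k (f (reflection b apex)) = w (reflection (s b) apex)"
      using fun_cong[OF ws(3), of "reflection b apex"] by simp
    have kfb: "k (f b) = w (s b)" using fun_cong[OF ws(3), of b] by simp
    have "w (s b) \<noteq> - a"
    proof
      assume "w (s b) = - a"
      then have "k (f b) = - a" using kfb by simp
      then have "k b = - a \<or> k b = a"
        using signs_axes[OF refl(1,2)] isometry_simps(3)[OF honeycomb_group_isometry[OF k], of b]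
        by (auto simp: minus_equation_iff)
      then show False using nc[OF refl(2)] by blast
    qed
    then show ?case
      using crossing_wall[OF ws(1) sb aN] refl(3) ws(4) e by auto
  qed
  have eq: "lorentz a (k q) = lorentz (inv k a) q" for q
    using isometriesD(4)[OF honeycomb_group_isometry[OF k], of "inv k a" q]
    by (simp add: honeycomb_group_inv_comp(2)[OF k])
  have "lorentz (inv k a) p > 0"
  proof (rule base_cube_convex[OF _ p])
    fix v assume "v \<in> base_vertices"
    then obtain f where "f \<in> signs" "v = f apex" using base_vertices_eq by blast
    then show "lorentz (inv k a) v > 0" using vert eq by metis
  qed
  then show ?thesis using eq by simp
qed

definition meets_pyramid :: "(point \<Rightarrow> point) \<Rightarrow> bool" where
  "meets_pyramid k \<longleftrightarrow> (\<forall>a\<in>axes. (\<exists>b\<in>axes. k b = a \<or> k b = - a)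
     \<or> (\<forall>p\<in>base_cube. lorentz a (k p) > 0))"

text \<open>Both \<open>w n\<close> and \<open>a\<close> are negative at \<open>w apex\<close>, so
  the sign is positive; \<open>normal_type_preserved\<close> then gives
  \<open>n = a\<close>.\<close>

lemma normal_fixed_sign:
  assumes w: "w \<in> weyl" and n: "n \<in> normals" "a \<in> normals" and e: "w n = a \<or> w n = - a"
    and neg: "lorentz a (w apex) < 0"
  shows "w a = a"
proof -
  have "w n \<noteq> - a"
  proof
    assume "w n = - a"
    then have "lorentz a (w apex) = - lorentz (w n) (w apex)" by (simp add: lorentz_simps)
    then show False
      using neg lorentz_weyl[OF w, of n apex] lorentz_normal_apex_neg[OF n(1)] by simp
  qed
  then have "w n = a" using e by blast
  then show ?thesis using normal_type_preserved[OF w n] by simp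
qed

text \<open>In the layer of \<open>a\<close>, a vertex on the negative side of the midplane
  satisfies \<open>w a = a\<close> by \<open>normal_fixed_sign\<close>; all other vertices concerned
  are positive for \<open>a\<close>.\<close>

lemma meets_pyramid_vertex:
  assumes k: "k \<in> honeycomb_group" and f: "f \<in> signs" and w: "w \<in> weyl" "k (f apex) = w apex"
    and m: "meets_pyramid k"
  shows "w \<in> pyr"
proof -
  obtain w' s where ws': "w' \<in> weyl" "s \<in> stabilizer" "k \<circ> f = w' \<circ> s" "k (f apex) = w' apex"
    using honeycomb_group_vertex[OF k f] .
  have ww: "w' = w" using weyl_apex_inj[OF ws'(1) w(1)] ws'(4) w(2) by simp
  have "lorentz a (w apex) > 0 \<or> a \<in> walls w" if a: "a \<in> axes" for a
  proof (cases "\<exists>b\<in>axes. k b = a \<or> k b = - a")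
    case True
    then obtain b where b: "b \<in> axes" "k b = a \<or> k b = - a" by blast
    have aN: "a \<in> normals" and sb: "s b \<in> normals"
      using a b(1) axes_normals stabilizerD(4)[OF ws'(2)] by blast+
    have "w (s b) = k (f b)" using fun_cong[OF ws'(3), of b] ww by simp
    then have "w (s b) = a \<or> w (s b) = - a"
      using b(2) signs_axes[OF f b(1)] isometry_simps(3)[OF honeycomb_group_isometry[OF k], of b]
      by auto
    then have "lorentz a (w apex) < 0 \<Longrightarrow> w a = a"
      using normal_fixed_sign[OF w(1) sb aN] by blast
    then show ?thesis
      using vertex_not_on_wall[OF w(1) aN] a
      by (cases "lorentz a (w apex) < 0") (auto simp: walls_def)
  next
    case False
    moreover have "f apex \<in> base_cube"
      using signs_base_cube[OF f] base_cube_apex by blast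
    ultimately show ?thesis using m a w(2) unfolding meets_pyramid_def by metis
  qed
  then show ?thesis using w(1) by (simp add: pyr_def)
qed

text \<open>A cube at \<open>apex\<close> whose edge normals include \<open>n\<close> and the walls
  of \<open>w\<close> is moved by \<open>w\<close>. It lies in the layer of each wall; for any other
  axis its vertex \<open>w apex\<close> is on the positive side, and the cube either has that
  midplane or does not cross it.\<close>

lemma cube_in_pyramid:
  assumes w: "w \<in> pyr" and n: "n \<in> normals" "\<And>a. a \<in> walls w \<Longrightarrow> n = a \<or> lorentz n a = 0"
  obtains k b where "k \<in> honeycomb_group" "b \<in> axes" "k apex = w apex"
    "k (reflection b apex) = w (reflection n apex)" "meets_pyramid k" "k b = w n"
proof -
  note wW = pyr_weyl[OF w]
  have "walls w \<subseteq> axes" by (auto simp: walls_def)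
  then obtain s where s: "s \<in> stabilizer" "s \<in> honeycomb_group" "insert n (walls w) \<subseteq> s ` axes"
    using cube_at_apex[of "walls w" n] n by blast
  define k where "k = w \<circ> s"
  have k: "k \<in> honeycomb_group"
    unfolding k_def by (intro honeycomb_group_comp weyl_honeycomb_group wW s)
  obtain b where b: "b \<in> axes" "n = s b" using s(3) by blast
  have ka: "k apex = w apex" using stabilizerD(2)[OF s(1)] by (simp add: k_def)
  have "s (reflection b apex) = reflection n apex"
    using fun_cong[OF isometry_reflection[OF stabilizerD(1)[OF s(1)], of b], of apex]
      stabilizerD(2)[OF s(1)] b(2) by simp
  then have kb: "k (reflection b apex) = w (reflection n apex)" by (simp add: k_def)
  have "meets_pyramid k"
    unfolding meets_pyramid_def
  proof
    fix a assume a: "a \<in> axes"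
    show "(\<exists>b\<in>axes. k b = a \<or> k b = - a) \<or> (\<forall>p\<in>base_cube. lorentz a (k p) > 0)"
    proof (cases "a \<in> walls w")
      case True
      then obtain c where "c \<in> axes" "a = s c" using s(3) by blast
      moreover have "w a = a" using True by (simp add: walls_def)
      ultimately have "k c = a" by (simp add: k_def)
      then show ?thesis using \<open>c \<in> axes\<close> by blast
    next
      case False
      then have "lorentz a (k apex) > 0" using walls_iff(2)[OF w a] ka by simp
      then show ?thesis using cube_on_one_side[OF k a] by blast
    qed
  qed
  moreover have "k b = w n" using b(2) by (simp add: k_def)
  ultimately show thesis by (rule that[OF k b(1) ka kb])
qed

section \<open>Transport to an arbitrary cube and vertex\<close>

context
  fixes h :: "point \<Rightarrow> point"
  assumes h: "h \<in> honeycomb_group"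
begin

abbreviation "hQ \<equiv> h ` base_cube"
abbreviation "hV \<equiv> h apex"

lemma h_iso: "h \<in> isometries"
  by (rule honeycomb_group_isometry[OF h])

lemma h_eq_iff: "h x = h y \<longleftrightarrow> x = y"
  by (rule inj_eq[OF isometriesD(3)[OF h_iso]])

lemma h_image_subset: "h ` A \<subseteq> h ` B \<longleftrightarrow> A \<subseteq> B"
  by (rule inj_image_subset_iff[OF isometriesD(3)[OF h_iso]])

lemma h_image_eq: "h ` A = h ` B \<longleftrightarrow> A = B"
  by (rule inj_image_eq_iff[OF isometriesD(3)[OF h_iso]])

lemma edges_at_V: "(hV, W) \<in> cube_edges hQ \<longleftrightarrow> (\<exists>a\<in>axes. W = h (reflection a apex))"
proof
  assume "(hV, W) \<in> cube_edges hQ"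
  then obtain p q where pq: "(p, q) \<in> base_edges" "h apex = h p" "W = h q"
    unfolding cube_edges_image[OF h] by auto
  then have "(apex, q) \<in> base_edges" by (simp add: h_eq_iff)
  then obtain a where "a \<in> axes" "q = reflection a apex"
    using base_edges_aux[OF apex_base_vertex] by blast
  then show "\<exists>a\<in>axes. W = h (reflection a apex)" using pq(3) by blast
next
  assume "\<exists>a\<in>axes. W = h (reflection a apex)"
  then obtain a where "a \<in> axes" "W = h (reflection a apex)" by blast
  moreover from this have "(apex, reflection a apex) \<in> base_edges"
    using base_edges_aux[OF apex_base_vertex] by blast
  ultimately show "(hV, W) \<in> cube_edges hQ"
    unfolding cube_edges_image[OF h] by (metis map_prod_imageI)
qed

lemma midplanes_image:
  assumes k: "k \<in> honeycomb_group"
  shows "M \<in> midplanes (h ` k ` base_cube) \<longleftrightarrow>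
    (\<exists>b\<in>axes. M = h ` {p \<in> hyperbolic_space. lorentz p (k b) = 0})"
proof -
  have hk: "h \<circ> k \<in> honeycomb_group" using honeycomb_group_comp[OF h k] .
  have bis: "bisector (h (k (f apex))) (h (k (f (reflection b apex))))
      = h ` {p \<in> hyperbolic_space. lorentz p (k b) = 0}" if "f \<in> signs" "b \<in> axes" for f b
  proof -
    have "bisector (h (k (f apex))) (h (k (f (reflection b apex))))
        = h ` k ` {p \<in> hyperbolic_space. lorentz p b = 0}"
      unfolding isometry_bisector[OF h_iso] isometry_bisector[OF honeycomb_group_isometry[OF k]]
        bisector_base_edge[OF that] ..
    then show ?thesis
      using isometry_halfspace_image[OF honeycomb_group_isometry[OF k], of "\<lambda>x. x = 0" b] by simp
  qed
  have e: "(x, y) \<in> cube_edges (h ` k ` base_cube) \<longleftrightarrow>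
      (\<exists>f\<in>signs. \<exists>b\<in>axes. x = h (k (f apex)) \<and> y = h (k (f (reflection b apex))))" for x y
    using cube_edges_image[OF hk] unfolding base_edges_eq image_comp[symmetric]
    by (force simp: image_iff)
  show ?thesis
  proof
    assume "M \<in> midplanes (h ` k ` base_cube)"
    then obtain x y where "M = bisector x y" "(x, y) \<in> cube_edges (h ` k ` base_cube)"
      unfolding midplanes_def by blast
    moreover from this obtain f b where "f \<in> signs" "b \<in> axes" "x = h (k (f apex))"
        "y = h (k (f (reflection b apex)))" unfolding e by blast
    ultimately show "\<exists>b\<in>axes. M = h ` {p \<in> hyperbolic_space. lorentz p (k b) = 0}"
      using bis[of f b] by blast
  next
    assume "\<exists>b\<in>axes. M = h ` {p \<in> hyperbolic_space. lorentz p (k b) = 0}"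
    then obtain b where b: "b \<in> axes" "M = h ` {p \<in> hyperbolic_space. lorentz p (k b) = 0}"
      by blast
    then have "M = bisector (h (k (id apex))) (h (k (id (reflection b apex))))"
      using bis[OF signs.id b(1)] by simp
    moreover have "(h (k (id apex)), h (k (id (reflection b apex)))) \<in> cube_edges (h ` k ` base_cube)"
      unfolding e using signs.id b(1) by blast
    ultimately show "M \<in> midplanes (h ` k ` base_cube)"
      unfolding midplanes_def by blast
  qed
qed

lemma image_in_cubes: "k \<in> honeycomb_group \<Longrightarrow> h ` k ` base_cube \<in> cubes"
  unfolding cubes_eq image_comp using honeycomb_group_comp[OF h] by blast

text \<open>By \<open>common_mirror\<close> equal midplanes have equal normals up to sign, which
  turns the layer into an equation between normals.\<close>

lemma layer_iff:
  assumes k: "k \<in> honeycomb_group" and a: "a \<in> axes"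
  shows "h ` k ` base_cube \<in> layer (bisector hV (h (reflection a apex))) \<longleftrightarrow>
    (\<exists>b\<in>axes. k b = a \<or> k b = - a)"
proof -
  have M: "bisector hV (h (reflection a apex)) = h ` {p \<in> hyperbolic_space. lorentz p a = 0}"
    unfolding isometry_bisector[OF h_iso] using bisector_base_edge[OF signs.id a] by simp
  have "h ` k ` base_cube \<in> cubes" by (rule image_in_cubes[OF k])
  then have "h ` k ` base_cube \<in> layer (bisector hV (h (reflection a apex))) \<longleftrightarrow>
      (\<exists>b\<in>axes. {p \<in> hyperbolic_space. lorentz p a = 0} = {p \<in> hyperbolic_space. lorentz p (k b) = 0})"
    unfolding layer_def M by (simp add: midplanes_image[OF k] h_image_eq)
  also have "\<dots> \<longleftrightarrow> (\<exists>b\<in>axes. k b = a \<or> k b = - a)"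
  proof (rule bex_cong[OF HOL.refl])
    fix b assume b: "b \<in> axes"
    show "{p \<in> hyperbolic_space. lorentz p a = 0} = {p \<in> hyperbolic_space. lorentz p (k b) = 0}
        \<longleftrightarrow> k b = a \<or> k b = - a"
      using common_mirror[OF k a b] by (auto simp: lorentz_simps)
  qed
  finally show ?thesis .
qed

lemma inner_cubes_iff:
  assumes k: "k \<in> honeycomb_group" and a: "a \<in> axes"
  shows "h ` k ` base_cube \<in> inner_cubes hV (h (reflection a apex)) \<longleftrightarrow>
    (\<exists>b\<in>axes. k b = a \<or> k b = - a) \<or> (\<forall>p\<in>base_cube. lorentz a (k p) > 0)"
proof -
  have "h ` k ` base_cube \<in> cubes" by (rule image_in_cubes[OF k])
  moreover have "h ` k ` base_cube \<subseteq> nearer (h (reflection a apex)) hV \<longleftrightarrow>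
      (\<forall>p\<in>base_cube. lorentz a (k p) > 0)"
    unfolding isometry_nearer[OF h_iso] nearer_apex[OF a] h_image_subset
    using isometriesD(6)[OF honeycomb_group_isometry[OF k]]
    by (auto simp: base_cube_def lorentz_commute[of a])
  ultimately show ?thesis
    unfolding inner_cubes_def by (simp add: layer_iff[OF k a])
qed

lemma pyramid_iff:
  assumes k: "k \<in> honeycomb_group"
  shows "h ` k ` base_cube \<in> pyramid hQ hV \<longleftrightarrow> meets_pyramid k"
proof -
  have "h ` k ` base_cube \<in> cubes" by (rule image_in_cubes[OF k])
  moreover have "(\<forall>W. (hV, W) \<in> cube_edges hQ \<longrightarrow> h ` k ` base_cube \<in> inner_cubes hV W) \<longleftrightarrow>
      (\<forall>a\<in>axes. h ` k ` base_cube \<in> inner_cubes hV (h (reflection a apex)))"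
    unfolding edges_at_V by blast
  ultimately show ?thesis
    unfolding pyramid_def meets_pyramid_def by (simp add: inner_cubes_iff[OF k])
qed

lemma factor_h:
  assumes "g \<in> honeycomb_group"
  obtains k where "k \<in> honeycomb_group" "g = h \<circ> k"
proof -
  have "g = h \<circ> (inv h \<circ> g)"
    by (rule ext) (simp add: honeycomb_group_inv_comp(2)[OF h])
  then show thesis
    using that honeycomb_group_comp[OF honeycomb_group_inv[OF h] assms] by blast
qed

text \<open>A vertex belongs to the pyramid through a cube, and \<open>cube_in_pyramid\<close> asks
  for an admissible direction: a wall of \<open>w\<close> is one, and any normal is if there are no
  walls.\<close>

lemma walls_neighbour: "\<exists>n\<in>normals. \<forall>a\<in>walls w. n = a \<or> lorentz n a = 0"
proof (cases "walls w = {}")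
  case True
  then show ?thesis using ax_normals[of 1] by blast
next
  case False
  then obtain n where "n \<in> walls w" by blast
  then show ?thesis
    using axes_normals axes_orthogonal unfolding walls_def by blast
qed

lemma pyramid_vertices_eq: "pyramid_vertices hQ hV = {h (w apex) |w. w \<in> pyr}"
proof (intro subset_antisym subsetI)
  fix u assume "u \<in> pyramid_vertices hQ hV"
  then obtain C where C: "C \<in> pyramid hQ hV" "u \<in> cube_vertices C"
    by (auto simp: pyramid_vertices_def)
  then obtain g v where g: "g \<in> honeycomb_group" "g ` base_cube = C" "v \<in> base_vertices" "u = g v"
    unfolding cube_vertices_iff by blast
  obtain k where k: "k \<in> honeycomb_group" "g = h \<circ> k" using factor_h[OF g(1)] .
  obtain f where f: "f \<in> signs" "v = f apex" using g(3) base_vertices_eq by blast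
  obtain w s where w: "w \<in> weyl" "k (f apex) = w apex"
    using honeycomb_group_vertex[OF k(1) f(1)] by blast
  have "h ` k ` base_cube \<in> pyramid hQ hV" using C(1) g(2) k(2) by (simp only: image_comp)
  then have "w \<in> pyr"
    using meets_pyramid_vertex[OF k(1) f(1) w] pyramid_iff[OF k(1)] by blast
  moreover have "u = h (w apex)" using g(4) k(2) f(2) w(2) by simp
  ultimately show "u \<in> {h (w apex) |w. w \<in> pyr}" by blast
next
  fix u assume "u \<in> {h (w apex) |w. w \<in> pyr}"
  then obtain w where w: "w \<in> pyr" "u = h (w apex)" by blast
  obtain n where n: "n \<in> normals" "\<And>a. a \<in> walls w \<Longrightarrow> n = a \<or> lorentz n a = 0"
    using walls_neighbour[of w] by blast
  obtain k b where k: "k \<in> honeycomb_group" "k apex = w apex" "meets_pyramid k"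
    using cube_in_pyramid[OF w(1) n] by blast
  have "u \<in> cube_vertices (h ` k ` base_cube)"
    unfolding cube_vertices_iff
  proof (intro bexI conjI)
    show "(h \<circ> k) ` base_cube = h ` k ` base_cube" by (simp only: image_comp)
    have "u = (h \<circ> k) apex" using w(2) k(2) by simp
    then show "u \<in> (h \<circ> k) ` base_vertices" using apex_base_vertex by blast
  qed (rule honeycomb_group_comp[OF h k(1)])
  then show "u \<in> pyramid_vertices hQ hV"
    using pyramid_iff[OF k(1)] k(3) unfolding pyramid_vertices_def by blast
qed

text \<open>The graph is the full subgraph of the Cayley graph on \<open>pyr\<close>. If both ends
  lie in \<open>pyr\<close>, then \<open>n\<close> is compatible with the walls of \<open>w\<close>,
  and \<open>cube_in_pyramid\<close> finds a cube of the pyramid with this edge.\<close>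

lemma pyramid_edges_iff:
  assumes w: "w \<in> weyl"
  shows "(h (w apex), y) \<in> pyramid_edges hQ hV \<longleftrightarrow>
    w \<in> pyr \<and> (\<exists>n\<in>normals. w \<circ> reflection n \<in> pyr \<and> y = h (w (reflection n apex)))"
proof
  assume "(h (w apex), y) \<in> pyramid_edges hQ hV"
  then obtain C where C: "C \<in> pyramid hQ hV" "(h (w apex), y) \<in> cube_edges C"
    by (auto simp: pyramid_edges_def)
  then obtain g where g: "g \<in> honeycomb_group" "g ` base_cube = C"
      "(h (w apex), y) \<in> map_prod g g ` base_edges"
    unfolding cube_edges_iff by (elim bexE conjE) (rule that)
  obtain k where k: "k \<in> honeycomb_group" "g = h \<circ> k" using factor_h[OF g(1)] .
  obtain f b where f: "f \<in> signs" "b \<in> axes" "h (w apex) = g (f apex)"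
      "y = g (f (reflection b apex))"
    using g(3) unfolding base_edges_eq by auto
  have bN: "b \<in> normals" using f(2) axes_normals by blast
  obtain w' s where ws: "w' \<in> weyl" "s \<in> stabilizer" "k \<circ> f = w' \<circ> s" "k (f apex) = w' apex"
    using honeycomb_group_vertex[OF k(1) f(1)] .
  have "w apex = w' apex" using f(3) k(2) ws(4) h_eq_iff by simp
  then have ww: "w' = w" using weyl_apex_inj[OF w ws(1)] by simp
  have n: "s b \<in> normals" using stabilizerD(4)[OF ws(2) bN] .
  have "s (reflection b apex) = reflection (s b) apex"
    using fun_cong[OF isometry_reflection[OF stabilizerD(1)[OF ws(2)], of b], of apex]
      stabilizerD(2)[OF ws(2)] by simp
  then have e: "k (f (reflection b apex)) = w (reflection (s b) apex)"
    using fun_cong[OF ws(3), of "reflection b apex"] ww by simp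
  have "h ` k ` base_cube \<in> pyramid hQ hV" using C(1) g(2) k(2) by (simp only: image_comp)
  then have m: "meets_pyramid k" using pyramid_iff[OF k(1)] by blast
  have "w \<in> pyr" using meets_pyramid_vertex[OF k(1) f(1) w _ m] ws(4) ww by simp
  moreover have "w \<circ> reflection (s b) \<in> pyr"
    using meets_pyramid_vertex[OF k(1) signs.refl[OF f(1,2)] weyl_comp[OF w weyl_reflection[OF n]] _ m] e
    by simp
  moreover have "y = h (w (reflection (s b) apex))" using f(4) k(2) e by simp
  ultimately show "w \<in> pyr \<and> (\<exists>n\<in>normals. w \<circ> reflection n \<in> pyr \<and> y = h (w (reflection n apex)))"
    using n by blast
next
  assume "w \<in> pyr \<and> (\<exists>n\<in>normals. w \<circ> reflection n \<in> pyr \<and> y = h (w (reflection n apex)))"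
  then obtain n where wP: "w \<in> pyr" and n: "n \<in> normals" "w \<circ> reflection n \<in> pyr"
    "y = h (w (reflection n apex))" by blast
  have "n = a \<or> lorentz n a = 0" if "a \<in> walls w" for a
  proof (cases "n \<in> descents w")
    case True
    then show ?thesis using walls_orthogonal_descents[OF w that] by blast
  next
    case False
    then show ?thesis using pyr_ascent(1)[OF wP n(1)] n(2) that by blast
  qed
  then obtain k b where k: "k \<in> honeycomb_group" "b \<in> axes" "k apex = w apex"
      "k (reflection b apex) = w (reflection n apex)" "meets_pyramid k"
    using cube_in_pyramid[OF wP n(1)] by blast
  have "(apex, reflection b apex) \<in> base_edges"
    using base_edges_aux[OF apex_base_vertex] k(2) by blast
  moreover have "(h (w apex), y) = map_prod (h \<circ> k) (h \<circ> k) (apex, reflection b apex)"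
    using k(3,4) n(3) by simp
  ultimately have "(h (w apex), y) \<in> cube_edges ((h \<circ> k) ` base_cube)"
    unfolding cube_edges_image[OF honeycomb_group_comp[OF h k(1)]] by (rule rev_image_eqI)
  then show "(h (w apex), y) \<in> pyramid_edges hQ hV"
    using pyramid_iff[OF k(1)] k(5) unfolding pyramid_edges_def image_comp[symmetric] by blast
qed

text \<open>A honeycomb vertex on a face of a cube is a vertex of that cube, and its lying nearer to
  \<open>hV\<close> fixes the sign of the normal. Conversely, \<open>w\<close> carries the face of
  the base cube through \<open>apex\<close> orthogonal to the axis of \<open>a\<close> to a face
  that lies on the near side, in a cube of the layer.\<close>

lemma honeycomb_plane_iff:
  assumes w: "w \<in> weyl" and a: "a \<in> axes"
  shows "h (w apex) \<in> honeycomb_plane hV (h (reflection a apex)) \<longleftrightarrow> w a = a"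
proof
  have aN: "a \<in> normals" using a axes_normals by blast
  assume "h (w apex) \<in> honeycomb_plane hV (h (reflection a apex))"
  then obtain F C where F: "h (w apex) \<in> F" "F \<subseteq> nearer hV (h (reflection a apex))"
      "C \<in> layer (bisector hV (h (reflection a apex)))" "F \<in> cube_faces C"
    unfolding honeycomb_plane_def by blast
  obtain g F0 where g: "g \<in> honeycomb_group" "g ` base_cube = C" "F0 \<in> base_faces" "F = g ` F0"
    using F(4) unfolding cube_faces_iff by blast
  obtain k where k: "k \<in> honeycomb_group" "g = h \<circ> k" using factor_h[OF g(1)] .
  obtain p where p: "p \<in> F0" "h (w apex) = g p" using F(1) g(4) by blast
  have wp: "w apex = k p" using p(2) k(2) h_eq_iff by simp
  have "p \<in> base_cube" using p(1) g(3) by (auto simp: base_faces_def)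
  moreover have pk: "p = (inv k \<circ> w) apex"
    using wp honeycomb_group_inv_comp(1)[OF k(1)] by simp
  ultimately have "p \<in> base_vertices"
    using honeycomb_vertex_in_base_cube[OF honeycomb_group_comp[OF honeycomb_group_inv[OF k(1)]
          weyl_honeycomb_group[OF w]]] by simp
  then obtain f where f: "f \<in> signs" "p = f apex" using base_vertices_eq by blast
  obtain w' s where ws: "w' \<in> weyl" "s \<in> stabilizer" "k \<circ> f = w' \<circ> s" "k (f apex) = w' apex"
    using honeycomb_group_vertex[OF k(1) f(1)] .
  have ww: "w' = w" using weyl_apex_inj[OF ws(1) w] ws(4) wp f(2) by simp
  have "h ` k ` base_cube \<in> layer (bisector hV (h (reflection a apex)))"
    using F(3) g(2) k(2) by (simp only: image_comp)
  then obtain b where b: "b \<in> axes" "k b = a \<or> k b = - a" using layer_iff[OF k(1) a] by blast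
  have sb: "s b \<in> normals" using b(1) axes_normals stabilizerD(4)[OF ws(2)] by blast
  have "h (w apex) \<in> h ` {p \<in> hyperbolic_space. lorentz p a < 0}"
    using F(1,2) unfolding isometry_nearer[OF h_iso] nearer_apex[OF a] by blast
  then have neg: "lorentz a (w apex) < 0"
    by (auto simp: h_eq_iff lorentz_commute[of a])
  have "w (s b) = k (f b)" using fun_cong[OF ws(3), of b] ww by simp
  then have "w (s b) = a \<or> w (s b) = - a"
    using b(2) signs_axes[OF f(1) b(1)] isometry_simps(3)[OF honeycomb_group_isometry[OF k(1)], of b]
    by auto
  then show "w a = a" using normal_fixed_sign[OF w sb aN _ neg] by blast
next
  have aN: "a \<in> normals" using a axes_normals by blast
  assume wa: "w a = a"
  define k where "k = w"
  have k: "k \<in> honeycomb_group" using weyl_honeycomb_group[OF w] by (simp add: k_def)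
  obtain i where i: "a = ax i" using axes_cases[OF a] .
  define F where "F = {p \<in> base_cube. lorentz p (- axis i 1, half_width) = 0}"
  have F: "F \<in> base_faces" unfolding base_faces_def F_def face_normals_eq by blast
  have fn: "lorentz p (- axis i 1, half_width) = - (fst p $ i) - half_width * snd p" for p
    by (simp add: lorentz_def inner_axis)
  have "h ` k ` F \<subseteq> nearer hV (h (reflection a apex))"
    unfolding isometry_nearer[OF h_iso] nearer_apex[OF a] h_image_subset
  proof
    fix q assume "q \<in> k ` F"
    then obtain p where p: "p \<in> F" "q = k p" by blast
    then have pH: "p \<in> hyperbolic_space" by (auto simp: F_def base_cube_def)
    have "half_width * snd p > 0"
      using pH half_width_pos by (auto simp: hyperbolic_space_def)
    then have "lorentz a p < 0"
      using p(1) fn by (simp add: F_def i lorentz_ax)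
    moreover have "lorentz q a = lorentz p a"
      using lorentz_weyl[OF w, of p a] wa p(2) by (simp add: k_def)
    ultimately show "q \<in> {p \<in> hyperbolic_space. lorentz p a < 0}"
      using isometriesD(6)[OF honeycomb_group_isometry[OF k], of p] pH p(2)
      by (simp add: lorentz_commute)
  qed
  moreover have "h ` k ` base_cube \<in> layer (bisector hV (h (reflection a apex)))"
    unfolding layer_iff[OF k a] using a wa k_def by blast
  moreover have "h ` k ` F \<in> cube_faces (h ` k ` base_cube)"
    unfolding cube_faces_iff
  proof (intro bexI conjI)
    show "(h \<circ> k) ` base_cube = h ` k ` base_cube" "h ` k ` F = (h \<circ> k) ` F"
      by (simp_all only: image_comp)
  qed (rule F honeycomb_group_comp[OF h k])+
  moreover have "h (w apex) \<in> h ` k ` F"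
    using base_cube_apex fn[of apex] by (auto simp: F_def fst_apex k_def)
  ultimately show "h (w apex) \<in> honeycomb_plane hV (h (reflection a apex))"
    unfolding honeycomb_plane_def by blast
qed

lemma on_wall_iff:
  assumes "w \<in> weyl"
  shows "on_wall hQ hV (h (w apex)) \<longleftrightarrow> walls w \<noteq> {}"
  unfolding on_wall_def edges_at_V using honeycomb_plane_iff[OF assms] by (auto simp: walls_def)

text \<open>The bound is an inequality because the vertex \<open>hV\<close> itself lies on all three
  planes.\<close>

lemma on_axis_iff:
  assumes "w \<in> weyl"
  shows "on_axis hQ hV (h (w apex)) \<longleftrightarrow> card (walls w) \<ge> 2"
proof -
  have neq: "h (reflection a apex) \<noteq> h (reflection b apex)" if ab: "a \<in> axes" "b \<in> axes" "a \<noteq> b" for a b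
  proof
    assume "h (reflection a apex) = h (reflection b apex)"
    then have "reflection a apex = reflection b apex" by (simp add: h_eq_iff)
    moreover have N: "a \<in> normals" "b \<in> normals" using ab axes_normals by blast+
    ultimately have "reflection a = reflection b"
      using weyl_apex_inj weyl_reflection by blast
    then have "reflection b a = - a"
      using reflection_self[of a] normals_unit[OF N(1)] by simp
    then have "a = - a" using axes_orthogonal[OF ab] by (simp add: reflection_orthogonal)
    then show False using normals_unit[OF N(1)] lorentz_simps(7)[of a a] by simp
  qed
  have "on_axis hQ hV (h (w apex)) \<longleftrightarrow> (\<exists>a\<in>axes. \<exists>b\<in>axes. a \<noteq> b \<and> w a = a \<and> w b = b)"
  proof
    assume "on_axis hQ hV (h (w apex))"
    then obtain a b where ab: "a \<in> axes" "b \<in> axes" "h (reflection a apex) \<noteq> h (reflection b apex)"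
        "h (w apex) \<in> honeycomb_plane hV (h (reflection a apex))"
        "h (w apex) \<in> honeycomb_plane hV (h (reflection b apex))"
      unfolding on_axis_def edges_at_V by blast
    have "w a = a" "w b = b"
      using ab(4,5) honeycomb_plane_iff[OF assms ab(1)] honeycomb_plane_iff[OF assms ab(2)]
      by blast+
    moreover have "a \<noteq> b" using ab(3) by auto
    ultimately show "\<exists>a\<in>axes. \<exists>b\<in>axes. a \<noteq> b \<and> w a = a \<and> w b = b"
      using ab(1,2) by blast
  next
    assume "\<exists>a\<in>axes. \<exists>b\<in>axes. a \<noteq> b \<and> w a = a \<and> w b = b"
    then obtain a b where ab: "a \<in> axes" "b \<in> axes" "a \<noteq> b" "w a = a" "w b = b" by blast
    have "h (w apex) \<in> honeycomb_plane hV (h (reflection a apex))"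
        "h (w apex) \<in> honeycomb_plane hV (h (reflection b apex))"
      using ab(4,5) honeycomb_plane_iff[OF assms ab(1)] honeycomb_plane_iff[OF assms ab(2)]
      by blast+
    then show "on_axis hQ hV (h (w apex))"
      unfolding on_axis_def edges_at_V using neq[OF ab(1-3)] ab(1,2) by blast
  qed
  also have "\<dots> \<longleftrightarrow> (\<exists>a\<in>walls w. \<exists>b\<in>walls w. a \<noteq> b)"
    unfolding walls_def by blast
  also have "\<dots> \<longleftrightarrow> card (walls w) \<ge> 2"
  proof -
    have "finite (walls w)" by (simp add: walls_def axes_def)
    then have "card (walls w) \<le> 1 \<longleftrightarrow> (\<forall>a\<in>walls w. \<forall>b\<in>walls w. a = b)"
      by (metis card_le_Suc0_iff_eq One_nat_def)
    moreover have "card (walls w) \<ge> 2 \<longleftrightarrow> \<not> card (walls w) \<le> 1" by linarith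
    ultimately show ?thesis by blast
  qed
  finally show ?thesis .
qed

section \<open>Graph distance within the pyramid\<close>

lemma pyramid_paths_bound:
  "(hV, u) \<in> pyramid_edges hQ hV ^^ n \<Longrightarrow> \<exists>w\<in>pyr. u = h (w apex) \<and> len w \<le> n"
proof (induction n arbitrary: u)
  case 0
  then have "u = h (id apex)" by simp
  then show ?case using pyr_id(1) len_id by (metis le_refl)
next
  case (Suc n)
  then obtain v where v: "(hV, v) \<in> pyramid_edges hQ hV ^^ n" "(v, u) \<in> pyramid_edges hQ hV" by auto
  obtain w where w: "w \<in> pyr" "v = h (w apex)" "len w \<le> n" using Suc.IH[OF v(1)] by blast
  obtain m where m: "m \<in> normals" "w \<circ> reflection m \<in> pyr" "u = h (w (reflection m apex))"
    using v(2) unfolding w(2) pyramid_edges_iff[OF pyr_weyl[OF w(1)]] by blast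
  have "u = h ((w \<circ> reflection m) apex)" using m(3) by simp
  moreover have "len (w \<circ> reflection m) \<le> Suc n"
    using len_right[OF pyr_weyl[OF w(1)] m(1)] w(3) by simp
  ultimately show ?case using m(2) by blast
qed

text \<open>Removing a descent never leaves the pyramid, so a shortest word can be walked inside it.
  Hence the restriction to the pyramid does not lengthen distances.\<close>

lemma pyramid_path_exists:
  assumes "w \<in> pyr"
  shows "(hV, h (w apex)) \<in> pyramid_edges hQ hV ^^ len w"
  using assms
proof (induction "len w" arbitrary: w rule: less_induct)
  case less
  note wW = pyr_weyl[OF less.prems]
  show ?case
  proof (cases "w = id")
    case True
    then show ?thesis by (simp add: len_id)
  next
    case False
    then obtain m where m: "m \<in> descents w" using descents_nonempty[OF wW] by blast
    then have mN: "m \<in> normals" by (simp add: descents_def)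
    define v where "v = w \<circ> reflection m"
    have v: "v \<in> pyr" using pyr_descent[OF less.prems m] by (simp only: v_def)
    have l: "len w = Suc (len v)" using len_descent(1)[OF wW mN m] by (simp only: v_def)
    have vm: "v \<circ> reflection m = w"
      unfolding v_def by (rule reflection_normal_involutive(4)[OF mN])
    have "(h (v apex), h (w apex)) \<in> pyramid_edges hQ hV"
      unfolding pyramid_edges_iff[OF pyr_weyl[OF v]]
    proof (intro conjI v bexI[OF _ mN])
      show "v \<circ> reflection m \<in> pyr" unfolding vm by (rule less.prems)
      show "h (w apex) = h (v (reflection m apex))" using fun_cong[OF vm, of apex] by simp
    qed
    moreover have "(hV, h (v apex)) \<in> pyramid_edges hQ hV ^^ len v"
      using less.hyps[OF _ v] l by simp
    ultimately show ?thesis unfolding l by auto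
  qed
qed

lemma level_eq: "level hQ hV n = (\<lambda>w. h (w apex)) ` shell n"
proof (intro subset_antisym subsetI)
  fix u assume u: "u \<in> level hQ hV n"
  then have path: "(hV, u) \<in> pyramid_edges hQ hV ^^ n"
    and min: "\<And>m. m < n \<Longrightarrow> (hV, u) \<notin> pyramid_edges hQ hV ^^ m"
    by (auto simp: level_def)
  obtain w where w: "w \<in> pyr" "u = h (w apex)" "len w \<le> n" using pyramid_paths_bound[OF path] by blast
  have "\<not> len w < n" using min[of "len w"] pyramid_path_exists[OF w(1)] w(2) by blast
  then have "w \<in> shell n" using w by (simp add: shell_def)
  then show "u \<in> (\<lambda>w. h (w apex)) ` shell n" using w(2) by blast
next
  fix u assume "u \<in> (\<lambda>w. h (w apex)) ` shell n"
  then obtain w where w: "w \<in> pyr" "len w = n" "u = h (w apex)" by (auto simp: shell_def)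
  have "(hV, u) \<notin> pyramid_edges hQ hV ^^ m" if "m < n" for m
  proof
    assume "(hV, u) \<in> pyramid_edges hQ hV ^^ m"
    then obtain w' where w': "w' \<in> pyr" "u = h (w' apex)" "len w' \<le> m"
      using pyramid_paths_bound by blast
    have "w' = w"
      using weyl_apex_inj[OF pyr_weyl[OF w'(1)] pyr_weyl[OF w(1)]] w(3) w'(2) by (simp add: h_eq_iff)
    then show False using w' w(2) that by simp
  qed
  moreover have "u \<in> pyramid_vertices hQ hV" unfolding pyramid_vertices_eq using w by blast
  ultimately show "u \<in> level hQ hV n"
    using pyramid_path_exists[OF w(1)] w(2,3) by (simp add: level_def)
qed

lemma vertex_inj: "inj_on (\<lambda>w. h (w apex)) weyl"
  using weyl_apex_inj by (auto simp: inj_on_def h_eq_iff)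

lemma shell_weyl: "w \<in> shell n \<Longrightarrow> w \<in> weyl"
  by (simp add: shell_def pyr_weyl)

lemma card_vertices:
  assumes "S \<subseteq> shell n"
  shows "card ((\<lambda>w. h (w apex)) ` S) = card S"
  using assms shell_weyl by (intro card_image inj_on_subset[OF vertex_inj]) blast

text \<open>By freeness every ascendant comes from \<open>w \<circ> reflection m\<close> with
  \<open>m\<close> a descent; distinct descents are orthogonal and so have distinct
  reflections.\<close>

lemma card_ascendants:
  assumes w: "w \<in> shell (Suc n)"
  shows "card (ascendants hQ hV (Suc n) (h (w apex))) = card (descents w)"
proof -
  have wP: "w \<in> pyr" "len w = Suc n" using w by (auto simp: shell_def)
  note wW = pyr_weyl[OF wP(1)]
  have edge: "(h (v apex), h (w apex)) \<in> pyramid_edges hQ hV \<and> v \<in> shell n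
      \<longleftrightarrow> v \<in> (\<lambda>m. w \<circ> reflection m) ` descents w" for v
  proof
    assume a: "(h (v apex), h (w apex)) \<in> pyramid_edges hQ hV \<and> v \<in> shell n"
    then have v: "v \<in> weyl" "len v = n" by (auto simp: shell_def pyr_weyl)
    obtain m where m: "m \<in> normals" "h (w apex) = h (v (reflection m apex))"
      using a pyramid_edges_iff[OF v(1)] by blast
    then have "w = v \<circ> reflection m"
      using weyl_apex_inj[OF wW weyl_comp[OF v(1) weyl_reflection[OF m(1)]]] by (simp add: h_eq_iff)
    then have wm: "w \<circ> reflection m = v" using reflection_normal_involutive(4)[OF m(1)] by simp
    then have "m \<in> descents w" using len_descent(2)[OF wW m(1)] v(2) wP(2) by fastforce
    then show "v \<in> (\<lambda>m. w \<circ> reflection m) ` descents w" using wm by blast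
  next
    assume "v \<in> (\<lambda>m. w \<circ> reflection m) ` descents w"
    then obtain m where m: "m \<in> descents w" "v = w \<circ> reflection m" by blast
    then have mN: "m \<in> normals" by (simp add: descents_def)
    have v: "v \<in> pyr" using pyr_descent[OF wP(1) m(1)] m(2) by simp
    have vm: "v \<circ> reflection m = w"
      unfolding m(2) by (rule reflection_normal_involutive(4)[OF mN])
    have "(h (v apex), h (w apex)) \<in> pyramid_edges hQ hV"
      unfolding pyramid_edges_iff[OF pyr_weyl[OF v]]
    proof (intro conjI v bexI[OF _ mN])
      show "v \<circ> reflection m \<in> pyr" unfolding vm by (rule wP(1))
      show "h (w apex) = h (v (reflection m apex))" using fun_cong[OF vm, of apex] by simp
    qed
    moreover have "len v = n" using len_descent(1)[OF wW mN m(1)] wP(2) m(2) by simp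
    ultimately show "(h (v apex), h (w apex)) \<in> pyramid_edges hQ hV \<and> v \<in> shell n"
      using v by (simp add: shell_def)
  qed
  have "ascendants hQ hV (Suc n) (h (w apex))
      = (\<lambda>v. h (v apex)) ` (\<lambda>m. w \<circ> reflection m) ` descents w"
    unfolding ascendants_def diff_Suc_1 level_eq using edge by blast
  moreover have "card \<dots> = card ((\<lambda>m. w \<circ> reflection m) ` descents w)"
    using edge by (intro card_vertices[of _ n]) blast
  moreover have "card ((\<lambda>m. w \<circ> reflection m) ` descents w) = card (descents w)"
  proof (rule card_image, rule inj_onI)
    fix m m' assume m: "m \<in> descents w" "m' \<in> descents w" "w \<circ> reflection m = w \<circ> reflection m'"
    have N: "m \<in> normals" "m' \<in> normals" using m descents_normals by blast+
    have r: "reflection m = reflection m'"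
      using m(3) weyl_inv_comp(1)[OF wW] by (metis comp_apply ext)
    show "m = m'"
    proof (rule ccontr)
      assume "m \<noteq> m'"
      then have "reflection m' m = m"
        using descents_orthogonal[OF wW m(1,2)] by (simp add: reflection_orthogonal)
      then have "- m = m" using r reflection_self[of m] normals_unit[OF N(1)] by simp
      then show False using normals_unit[OF N(1)] lorentz_simps(7)[of m m] by simp
    qed
  qed
  ultimately show ?thesis by simp
qed

lemma card_level: "card (level hQ hV n) = card (shell n)"
  unfolding level_eq by (rule card_vertices[of _ n]) simp

lemma card_level_filter:
  assumes "\<And>w. w \<in> shell n \<Longrightarrow> P (h (w apex)) \<longleftrightarrow> R w"
  shows "card {u \<in> level hQ hV n. P u} = card {w \<in> shell n. R w}"
proof -
  have "{u \<in> level hQ hV n. P u} = (\<lambda>w. h (w apex)) ` {w \<in> shell n. R w}"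
    unfolding level_eq using assms by blast
  then show ?thesis using card_vertices[of "{w \<in> shell n. R w}" n] by simp
qed

section \<open>Vertex types as states\<close>

lemma finite_walls: "finite (walls w)"
  by (simp add: walls_def axes_def)

lemma shell_Suc_states:
  assumes "w \<in> shell (Suc n)"
  shows "state w \<in> {(2, 1), (1, 1), (1, 2), (0, 1), (0, 2), (0, 3)}"
proof -
  have w: "w \<in> pyr" "w \<noteq> id" using assms len_id by (auto simp: shell_def)
  have "descents w \<noteq> {}" using descents_nonempty[OF pyr_weyl[OF w(1)] w(2)] .
  then have "state w \<noteq> (3, 0)" using finite_descents by (simp add: state_def)
  then show ?thesis using pyr_transitions(1)[OF w(1)] by (simp add: states_def)
qed

text \<open>The walls distinguish axes, planes and interior, and the descents count the ascendants.
  On positive levels two or more walls occur only in the state (2, 1), which is type 1.\<close>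

lemma card_types_Suc:
  "card (type_1 hQ hV (Suc n)) = num (2, 1) (Suc n)"
  "card (type_A hQ hV (Suc n)) = num (1, 2) (Suc n)"
  "card (type_B hQ hV (Suc n)) = num (1, 1) (Suc n)"
  "card (type_C hQ hV (Suc n)) = num (0, 3) (Suc n)"
  "card (type_D hQ hV (Suc n)) = num (0, 2) (Suc n)"
  "card (type_E hQ hV (Suc n)) = num (0, 1) (Suc n)"
proof -
  have st: "on_wall hQ hV (h (w apex)) \<longleftrightarrow> fst (state w) \<noteq> 0"
    "on_axis hQ hV (h (w apex)) \<longleftrightarrow> fst (state w) \<ge> 2"
    "card (ascendants hQ hV (Suc n) (h (w apex))) = snd (state w)"
    "state w \<in> {(2, 1), (1, 1), (1, 2), (0, 1), (0, 2), (0, 3)}"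
    if "w \<in> shell (Suc n)" for w
    using that on_wall_iff[OF shell_weyl[OF that]] on_axis_iff[OF shell_weyl[OF that]]
      card_ascendants[OF that] shell_Suc_states[OF that] finite_walls
    by (simp_all add: state_def)
  show "card (type_1 hQ hV (Suc n)) = num (2, 1) (Suc n)"
    unfolding type_1_def num_def by (rule card_level_filter) (use st in fastforce)
  show "card (type_A hQ hV (Suc n)) = num (1, 2) (Suc n)"
    unfolding type_A_def num_def by (rule card_level_filter) (use st in fastforce)
  show "card (type_B hQ hV (Suc n)) = num (1, 1) (Suc n)"
    unfolding type_B_def num_def by (rule card_level_filter) (use st in fastforce)
  show "card (type_C hQ hV (Suc n)) = num (0, 3) (Suc n)"
    unfolding type_C_def num_def by (rule card_level_filter) (use st in fastforce)
  show "card (type_D hQ hV (Suc n)) = num (0, 2) (Suc n)"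
    unfolding type_D_def num_def by (rule card_level_filter) (use st in fastforce)
  show "card (type_E hQ hV (Suc n)) = num (0, 1) (Suc n)"
    unfolding type_E_def num_def by (rule card_level_filter) (use st in fastforce)
qed

lemma card_types_0:
  "card (type_A hQ hV 0) = 0" "card (type_B hQ hV 0) = 0" "card (type_C hQ hV 0) = 0"
  "card (type_D hQ hV 0) = 0" "card (type_E hQ hV 0) = 0"
proof -
  have l: "level hQ hV 0 = {hV}" unfolding level_eq shell_0 by simp
  \<comment> \<open>On level 0 the definition of \<open>ascendants\<close> refers to level 0 again,
    since \<open>0 - 1 = 0\<close> for naturals; so the absence of a loop at \<open>hV\<close> is
    what makes the set empty.\<close>
  have "(hV, hV) \<notin> pyramid_edges hQ hV"
  proof
    assume "(hV, hV) \<in> pyramid_edges hQ hV"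
    then obtain m where m: "m \<in> normals" "h apex = h (reflection m apex)"
      using pyramid_edges_iff[OF weyl_id, of hV] by auto
    then have "apex = reflection m apex" by (simp add: h_eq_iff)
    then have "lorentz m apex = - lorentz m apex"
      using lorentz_reflection_normal_left[OF m(1), of m apex] normals_unit[OF m(1)] by simp
    then show False using lorentz_normal_apex_neg[OF m(1)] by simp
  qed
  then have "ascendants hQ hV 0 hV = {}" by (auto simp: ascendants_def l)
  then show "card (type_A hQ hV 0) = 0" "card (type_B hQ hV 0) = 0" "card (type_C hQ hV 0) = 0"
    "card (type_D hQ hV 0) = 0" "card (type_E hQ hV 0) = 0"
    by (auto simp: type_A_def type_B_def type_C_def type_D_def type_E_def l)
qed

end

section \<open>The explicit formulas\<close>

text \<open>On the planes, (b, a) evolves by the matrix with rows (2, 1) and (1, 1), whose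
  eigenvalues are \<alpha>1 and \<alpha>2, with inflow 3 from the axes. The interior matrix has
  characteristic polynomial (z - 1) (z^2 - 8 z + 1). For its eigenvalue 1, the combination e - 2 d -
  3 c changes by - (a + b) in each step; the constant parts 3 and -3 of a and b cancel, so no term
  linear in n arises.\<close>

lemma closed_forms:
  fixes \<alpha>1 \<alpha>2 \<alpha>3 \<alpha>4 :: real
  assumes \<alpha>: "\<alpha>1 = (3 + sqrt 5) / 2" "\<alpha>2 = (3 - sqrt 5) / 2" "\<alpha>3 = 4 + sqrt 15" "\<alpha>4 = 4 - sqrt 15"
    and "n \<ge> 1"
  shows "real (num (1, 2) n)
      = (- 9/2 + 21/10 * sqrt 5) * \<alpha>1 ^ n + (- 9/2 - 21/10 * sqrt 5) * \<alpha>2 ^ n + 3 \<and>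
    real (num (1, 1) n) = (3 - 6/5 * sqrt 5) * \<alpha>1 ^ n + (3 + 6/5 * sqrt 5) * \<alpha>2 ^ n - 3 \<and>
    real (num (0, 3) n)
      = (- 33/10 + 3/2 * sqrt 5) * \<alpha>1 ^ n + (- 33/10 - 3/2 * sqrt 5) * \<alpha>2 ^ n
        + (122/15 - 21/10 * sqrt 15) * \<alpha>3 ^ n + (122/15 + 21/10 * sqrt 15) * \<alpha>4 ^ n + 1/3 \<and>
    real (num (0, 2) n)
      = (27/5 - 12/5 * sqrt 5) * \<alpha>1 ^ n + (27/5 + 12/5 * sqrt 5) * \<alpha>2 ^ n
        + (- 213/20 + 11/4 * sqrt 15) * \<alpha>3 ^ n + (- 213/20 - 11/4 * sqrt 15) * \<alpha>4 ^ n - 3/2 \<and>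
    real (num (0, 1) n)
      = (- 21/10 + 9/10 * sqrt 5) * \<alpha>1 ^ n + (- 21/10 - 9/10 * sqrt 5) * \<alpha>2 ^ n
        + (31/10 - 4/5 * sqrt 15) * \<alpha>3 ^ n + (31/10 + 4/5 * sqrt 15) * \<alpha>4 ^ n + 1"
  using assms(5)
proof (induction n rule: nat_induct_at_least)
  case base
  \<comment> \<open>Level 1 consists of the three axis vertices alone.\<close>
  have z: "num (1, 2) 1 = 0" "num (1, 1) 1 = 0" "num (0, 3) 1 = 0" "num (0, 2) 1 = 0" "num (0, 1) 1 = 0"
    unfolding One_nat_def using num_recurrences[of 0] by (simp_all add: num_0)
  define x y where "x = sqrt (5 :: real)" and "y = sqrt (15 :: real)"
  have s: "x * x = 5" "x * (x * z) = 5 * z" "y * y = 15" "y * (y * z) = 15 * z" for z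
    by (simp_all add: x_def y_def mult.assoc[symmetric])
  show ?case unfolding z \<alpha> x_def[symmetric] y_def[symmetric] power_one_right
    by (intro conjI) (simp_all add: field_simps s)
next
  case (Suc n)
  define x y where "x = sqrt (5 :: real)" and "y = sqrt (15 :: real)"
  have s: "x * x = 5" "x * (x * z) = 5 * z" "y * y = 15" "y * (y * z) = 15 * z" for z
    by (simp_all add: x_def y_def mult.assoc[symmetric])
  define X1 X2 X3 X4 where "X1 = \<alpha>1 ^ n" and "X2 = \<alpha>2 ^ n" and "X3 = \<alpha>3 ^ n" and "X4 = \<alpha>4 ^ n"
  have X: "\<alpha>1 ^ Suc n = (3 + x) / 2 * X1" "\<alpha>2 ^ Suc n = (3 - x) / 2 * X2"
    "\<alpha>3 ^ Suc n = (4 + y) * X3" "\<alpha>4 ^ Suc n = (4 - y) * X4"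
    by (simp_all add: X1_def X2_def X3_def X4_def \<alpha> x_def y_def)
  note IH = Suc.IH[folded x_def y_def X1_def X2_def X3_def X4_def]
  \<comment> \<open>The value 3 for the axis vertices is available from level 1 on only.\<close>
  obtain m where m: "n = Suc m" using Suc.hyps by (cases n) auto
  have r: "real (num (1, 1) (Suc n)) = 2 * real (num (1, 1) n) + real (num (1, 2) n)"
    "real (num (1, 2) (Suc n)) = 3 + real (num (1, 1) n) + real (num (1, 2) n)"
    "real (num (0, 1) (Suc n))
      = 6 * real (num (0, 1) n) + 4 * real (num (0, 2) n) + 3 * real (num (0, 3) n)"
    "real (num (0, 2) (Suc n)) = (real (num (1, 1) n) + 5 * real (num (0, 1) n)
      + 4 * real (num (0, 2) n) + 3 * real (num (0, 3) n)) / 2"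
    "real (num (0, 3) (Suc n)) = (real (num (1, 2) n) + 2 * real (num (0, 2) n)
      + 3 * real (num (0, 3) n)) / 3"
  proof -
    have "2 * real (num (0, 2) (Suc n)) = real (num (1, 1) n) + 5 * real (num (0, 1) n)
      + 4 * real (num (0, 2) n) + 3 * real (num (0, 3) n)"
      using num_recurrences(5)[of n] by linarith
    then show "real (num (0, 2) (Suc n)) = (real (num (1, 1) n) + 5 * real (num (0, 1) n)
      + 4 * real (num (0, 2) n) + 3 * real (num (0, 3) n)) / 2" by simp
    have "3 * real (num (0, 3) (Suc n)) = real (num (1, 2) n) + 2 * real (num (0, 2) n)
      + 3 * real (num (0, 3) n)"
      using num_recurrences(6)[of n] by linarith
    then show "real (num (0, 3) (Suc n)) = (real (num (1, 2) n) + 2 * real (num (0, 2) n)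
      + 3 * real (num (0, 3) n)) / 3" by simp
  qed (use num_recurrences(1-4)[of n] num_21[of m, folded m] in linarith)+
  show ?case
    unfolding r X x_def[symmetric] y_def[symmetric] using IH
    by (elim conjE, intro conjI) (simp_all add: field_simps s)
qed

text \<open>The coefficients are those of (z - 1) (z^2 - 3 z + 1) (z^2 - 8 z + 1) = z^5 - 12 z^4 +
  37 z^3 - 37 z^2 + 12 z - 1, where z - 1 accounts for the constant \<open>t\<close>. The closed
  form starts at 1, hence the recurrence at 6.\<close>

lemma recurrence_of_closed_form:
  fixes x :: "nat \<Rightarrow> nat" and p q r s t \<alpha>1 \<alpha>2 \<alpha>3 \<alpha>4 :: real
  assumes "\<alpha>1 = (3 + sqrt 5) / 2" "\<alpha>2 = (3 - sqrt 5) / 2" "\<alpha>3 = 4 + sqrt 15" "\<alpha>4 = 4 - sqrt 15"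
    and x: "\<And>n. n \<ge> 1 \<Longrightarrow> real (x n) = p * \<alpha>1 ^ n + q * \<alpha>2 ^ n + r * \<alpha>3 ^ n + s * \<alpha>4 ^ n + t"
    and n: "n \<ge> 6"
  shows "int (x n) = 12 * int (x (n - 1)) - 37 * int (x (n - 2)) + 37 * int (x (n - 3))
                  - 12 * int (x (n - 4)) + int (x (n - 5))"
proof -
  obtain m where m: "n = m + 6" using n by (metis add.commute le_Suc_ex)
  have quad: "z * z * z * z * z = 12 * (z * z * z * z) - 37 * (z * z * z) + 37 * (z * z) - 12 * z + 1"
    if "z * z = 3 * z - 1 \<or> z * z = 8 * z - 1" for z :: real
    using that by algebra
  have pow: "z ^ (m + 6) = 12 * z ^ (m + 5) - 37 * z ^ (m + 4) + 37 * z ^ (m + 3) - 12 * z ^ (m + 2)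
      + z ^ (m + 1)"
    if "z * z = 3 * z - 1 \<or> z * z = 8 * z - 1" for z :: real
  proof -
    have "z ^ (m + 6) = z ^ (m + 1) * (z * z * z * z * z)"
      by (simp add: power_add eval_nat_numeral)
    also have "\<dots> = z ^ (m + 1) * (12 * (z * z * z * z) - 37 * (z * z * z) + 37 * (z * z) - 12 * z + 1)"
      using quad[OF that] by simp
    also have "\<dots> = 12 * z ^ (m + 5) - 37 * z ^ (m + 4) + 37 * z ^ (m + 3) - 12 * z ^ (m + 2)
        + z ^ (m + 1)"
      by (simp add: power_add eval_nat_numeral algebra_simps)
    finally show ?thesis .
  qed
  have roots: "\<alpha>1 * \<alpha>1 = 3 * \<alpha>1 - 1" "\<alpha>2 * \<alpha>2 = 3 * \<alpha>2 - 1" "\<alpha>3 * \<alpha>3 = 8 * \<alpha>3 - 1"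
    "\<alpha>4 * \<alpha>4 = 8 * \<alpha>4 - 1"
    unfolding assms(1-4) by (simp_all add: field_simps)
  have "real (x (m + 6)) = 12 * real (x (m + 5)) - 37 * real (x (m + 4)) + 37 * real (x (m + 3))
      - 12 * real (x (m + 2)) + real (x (m + 1))"
    using x[of "m + 6"] x[of "m + 5"] x[of "m + 4"] x[of "m + 3"] x[of "m + 2"] x[of "m + 1"]
      pow[of \<alpha>1] pow[of \<alpha>2] pow[of \<alpha>3] pow[of \<alpha>4] roots
    by (simp add: algebra_simps del: power_Suc)
  then have "int (x (m + 6)) = 12 * int (x (m + 5)) - 37 * int (x (m + 4)) + 37 * int (x (m + 3))
      - 12 * int (x (m + 2)) + int (x (m + 1))"
    by linarith
  moreover have "n - 1 = m + 5" "n - 2 = m + 4" "n - 3 = m + 3" "n - 4 = m + 2" "n - 5 = m + 1"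
    using m by simp_all
  ultimately show ?thesis by (simp only: m)
qed

text \<open>The coefficients are those of (z - 1) (z^2 - 3 z + 1) = z^3 - 4 z^2 + 4 z - 1.\<close>

lemma short_recurrence_of_closed_form:
  fixes x :: "nat \<Rightarrow> nat" and p q t \<alpha>1 \<alpha>2 :: real
  assumes "\<alpha>1 = (3 + sqrt 5) / 2" "\<alpha>2 = (3 - sqrt 5) / 2"
    and x: "\<And>n. n \<ge> 1 \<Longrightarrow> real (x n) = p * \<alpha>1 ^ n + q * \<alpha>2 ^ n + t"
    and n: "n \<ge> 4"
  shows "int (x n) = 4 * int (x (n - 1)) - 4 * int (x (n - 2)) + int (x (n - 3))"
proof -
  obtain m where m: "n = m + 4" using n by (metis add.commute le_Suc_ex)
  have pow: "z ^ (m + 4) = 4 * z ^ (m + 3) - 4 * z ^ (m + 2) + z ^ (m + 1)"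
    if "z * z = 3 * z - 1" for z :: real
  proof -
    have "z ^ (m + 4) = z ^ (m + 1) * (z * z * z)"
      by (simp add: power_add eval_nat_numeral)
    also have "z * z * z = 4 * (z * z) - 4 * z + 1"
      using that by algebra
    also have "z ^ (m + 1) * \<dots> = 4 * z ^ (m + 3) - 4 * z ^ (m + 2) + z ^ (m + 1)"
      by (simp add: power_add eval_nat_numeral algebra_simps)
    finally show ?thesis .
  qed
  have roots: "\<alpha>1 * \<alpha>1 = 3 * \<alpha>1 - 1" "\<alpha>2 * \<alpha>2 = 3 * \<alpha>2 - 1"
    unfolding assms(1,2) by (simp_all add: field_simps)
  have "real (x (m + 4)) = 4 * real (x (m + 3)) - 4 * real (x (m + 2)) + real (x (m + 1))"
    using x[of "m + 4"] x[of "m + 3"] x[of "m + 2"] x[of "m + 1"] pow[OF roots(1)] pow[OF roots(2)]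
    by (simp add: algebra_simps del: power_Suc)
  then have "int (x (m + 4)) = 4 * int (x (m + 3)) - 4 * int (x (m + 2)) + int (x (m + 1))"
    by linarith
  moreover have "n - 1 = m + 3" "n - 2 = m + 2" "n - 3 = m + 1"
    using m by simp_all
  ultimately show ?thesis by (simp only: m)
qed

theorem theorem2:
  fixes Q :: "point set" and V :: point
    and a b c d e s :: "nat \<Rightarrow> nat"
    and \<alpha>1 \<alpha>2 \<alpha>3 \<alpha>4 :: real
  assumes "Q \<in> cubes" and "V \<in> cube_vertices Q"
    and "\<And>n. a n = card (type_A Q V n)"
    and "\<And>n. b n = card (type_B Q V n)"
    and "\<And>n. c n = card (type_C Q V n)"
    and "\<And>n. d n = card (type_D Q V n)"
    and "\<And>n. e n = card (type_E Q V n)"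
    and "\<And>n. s n = card (level Q V n)"
    and "\<alpha>1 = (3 + sqrt 5) / 2" and "\<alpha>2 = (3 - sqrt 5) / 2"
    and "\<alpha>3 = 4 + sqrt 15" and "\<alpha>4 = 4 - sqrt 15"
  shows "(\<forall>x\<in>{a, b, c, d, e}. x 0 = 0 \<and> x 1 = 0)
    \<and> (\<forall>n\<ge>1. card (type_1 Q V n) = 3)
    \<and> (s 0 = 1)
    \<and> (\<forall>n\<ge>1. s n = a n + b n + c n + d n + e n + 3)
    \<and> (\<forall>x\<in>{a, b, c, d, e, s}. \<forall>n\<ge>6.
      int (x n) = 12 * int (x (n - 1)) - 37 * int (x (n - 2)) + 37 * int (x (n - 3))
                  - 12 * int (x (n - 4)) + int (x (n - 5)))
    \<and> (\<forall>x\<in>{a, b}. \<forall>n\<ge>4.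
      int (x n) = 4 * int (x (n - 1)) - 4 * int (x (n - 2)) + int (x (n - 3)))
    \<and> (\<forall>n\<ge>1. real (a n) = (- 9/2 + 21/10 * sqrt 5) * \<alpha>1 ^ n + (- 9/2 - 21/10 * sqrt 5) * \<alpha>2 ^ n + 3)
    \<and> (\<forall>n\<ge>1. real (b n) = (3 - 6/5 * sqrt 5) * \<alpha>1 ^ n + (3 + 6/5 * sqrt 5) * \<alpha>2 ^ n - 3)
    \<and> (\<forall>n\<ge>1. real (c n) =
      (- 33/10 + 3/2 * sqrt 5) * \<alpha>1 ^ n + (- 33/10 - 3/2 * sqrt 5) * \<alpha>2 ^ n
      + (122/15 - 21/10 * sqrt 15) * \<alpha>3 ^ n + (122/15 + 21/10 * sqrt 15) * \<alpha>4 ^ n + 1/3)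
    \<and> (\<forall>n\<ge>1. real (d n) =
      (27/5 - 12/5 * sqrt 5) * \<alpha>1 ^ n + (27/5 + 12/5 * sqrt 5) * \<alpha>2 ^ n
      + (- 213/20 + 11/4 * sqrt 15) * \<alpha>3 ^ n + (- 213/20 - 11/4 * sqrt 15) * \<alpha>4 ^ n - 3/2)
    \<and> (\<forall>n\<ge>1. real (e n) =
      (- 21/10 + 9/10 * sqrt 5) * \<alpha>1 ^ n + (- 21/10 - 9/10 * sqrt 5) * \<alpha>2 ^ n
      + (31/10 - 4/5 * sqrt 15) * \<alpha>3 ^ n + (31/10 + 4/5 * sqrt 15) * \<alpha>4 ^ n + 1)
    \<and> (\<forall>n\<ge>1. real (s n) =
      (- 3/2 + 9/10 * sqrt 5) * \<alpha>1 ^ n + (- 3/2 - 9/10 * sqrt 5) * \<alpha>2 ^ n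
      + (7/12 - 3/20 * sqrt 15) * \<alpha>3 ^ n + (7/12 + 3/20 * sqrt 15) * \<alpha>4 ^ n + 17/6)"
proof -
  obtain g v where g: "g \<in> honeycomb_group" "g ` base_cube = Q" "v \<in> base_vertices" "V = g v"
    using assms(2) unfolding cube_vertices_iff by blast
  obtain f where f: "f \<in> signs" "v = f apex" using g(3) base_vertices_eq by blast
  \<comment> \<open>The sign change \<open>f\<close> maps the base cube to itself and
    \<open>apex\<close> to the chosen base vertex, so \<open>h\<close> carries the base cube to
    \<open>Q\<close> and \<open>apex\<close> to \<open>V\<close> simultaneously.\<close>
  define h where "h = g \<circ> f"
  have h: "h \<in> honeycomb_group"
    unfolding h_def by (rule honeycomb_group_comp[OF g(1) signs_honeycomb_group[OF f(1)]])
  have Q: "Q = h ` base_cube"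
    unfolding h_def image_comp[symmetric] signs_base_cube[OF f(1)] g(2) ..
  have V: "V = h apex" using g(4) f(2) by (simp add: h_def)
  note types = card_types_Suc[OF h, folded Q V] card_types_0[OF h, folded Q V]
  note \<alpha> = assms(9-12)
  have nums: "a n = num (1, 2) n" "b n = num (1, 1) n" "c n = num (0, 3) n" "d n = num (0, 2) n"
      "e n = num (0, 1) n" "card (type_1 Q V n) = 3" if "n \<ge> 1" for n
    using that types num_21 by (cases n; simp add: assms(3-7))+
  have s0: "s 0 = 1" using card_level[OF h, of 0, folded Q V] by (simp add: assms(8) shell_0)
  have s_sum: "s n = a n + b n + c n + d n + e n + 3" if n: "n \<ge> 1" for n
  proof -
    obtain m where m: "n = Suc m" using n by (cases n) auto
    have "s n = (\<Sum>q\<in>set states. num q n)"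
      using card_level[OF h, of n, folded Q V] card_shell[of n] by (simp only: assms(8))
    also have "\<dots> = num (3, 0) n + (num (2, 1) n + (num (1, 1) n + (num (1, 2) n
        + (num (0, 1) n + (num (0, 2) n + num (0, 3) n)))))"
      by (simp add: states_def)
    also have "\<dots> = 0 + (3 + (b n + (a n + (e n + (d n + c n)))))"
      by (simp only: nums[OF n] num_30[of m, folded m] num_21[of m, folded m])
    finally show ?thesis by simp
  qed
  have zero: "x 0 = 0 \<and> x 1 = 0" if "x \<in> {a, b, c, d, e}" for x
  proof -
    have "num (1, 2) 1 = 0" "num (1, 1) 1 = 0" "num (0, 3) 1 = 0" "num (0, 2) 1 = 0" "num (0, 1) 1 = 0"
      unfolding One_nat_def using num_recurrences[of 0] by (simp_all add: num_0)
    then have "a 1 = 0" "b 1 = 0" "c 1 = 0" "d 1 = 0" "e 1 = 0" using nums[of 1] by simp_all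
    moreover have "a 0 = 0" "b 0 = 0" "c 0 = 0" "d 0 = 0" "e 0 = 0" using types by (simp_all add: assms(3-7))
    ultimately show ?thesis using that by auto
  qed
  have forms: "real (a n) = (- 9/2 + 21/10 * sqrt 5) * \<alpha>1 ^ n + (- 9/2 - 21/10 * sqrt 5) * \<alpha>2 ^ n + 3"
    "real (b n) = (3 - 6/5 * sqrt 5) * \<alpha>1 ^ n + (3 + 6/5 * sqrt 5) * \<alpha>2 ^ n - 3"
    "real (c n) =
      (- 33/10 + 3/2 * sqrt 5) * \<alpha>1 ^ n + (- 33/10 - 3/2 * sqrt 5) * \<alpha>2 ^ n
      + (122/15 - 21/10 * sqrt 15) * \<alpha>3 ^ n + (122/15 + 21/10 * sqrt 15) * \<alpha>4 ^ n + 1/3"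
    "real (d n) =
      (27/5 - 12/5 * sqrt 5) * \<alpha>1 ^ n + (27/5 + 12/5 * sqrt 5) * \<alpha>2 ^ n
      + (- 213/20 + 11/4 * sqrt 15) * \<alpha>3 ^ n + (- 213/20 - 11/4 * sqrt 15) * \<alpha>4 ^ n - 3/2"
    "real (e n) =
      (- 21/10 + 9/10 * sqrt 5) * \<alpha>1 ^ n + (- 21/10 - 9/10 * sqrt 5) * \<alpha>2 ^ n
      + (31/10 - 4/5 * sqrt 15) * \<alpha>3 ^ n + (31/10 + 4/5 * sqrt 15) * \<alpha>4 ^ n + 1"
    if "n \<ge> 1" for n
    using closed_forms[OF \<alpha> that] by (simp_all only: nums[OF that])
  \<comment> \<open>The constant is 3 - 3 + 1/3 - 3/2 + 1 + 3, the last summand being the axis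
    vertices.\<close>
  have form_s: "real (s n) =
      (- 3/2 + 9/10 * sqrt 5) * \<alpha>1 ^ n + (- 3/2 - 9/10 * sqrt 5) * \<alpha>2 ^ n
      + (7/12 - 3/20 * sqrt 15) * \<alpha>3 ^ n + (7/12 + 3/20 * sqrt 15) * \<alpha>4 ^ n + 17/6"
    if "n \<ge> 1" for n
    unfolding s_sum[OF that] of_nat_add forms[OF that] by (simp add: algebra_simps)
  note rec = recurrence_of_closed_form[OF \<alpha>]
  have long: "\<forall>x\<in>{a, b, c, d, e, s}. \<forall>n\<ge>6.
      int (x n) = 12 * int (x (n - 1)) - 37 * int (x (n - 2)) + 37 * int (x (n - 3))
                  - 12 * int (x (n - 4)) + int (x (n - 5))"
  proof (intro ballI allI impI)
    fix x and n :: nat assume x: "x \<in> {a, b, c, d, e, s}" and n: "n \<ge> 6"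
    \<comment> \<open>For \<open>a\<close> and \<open>b\<close> the coefficients of the powers of
      \<alpha>3 and \<alpha>4 are zero, which brings all six sequences to one form.\<close>
    have "\<exists>p q r u t. \<forall>n\<ge>1. real (x n) = p * \<alpha>1 ^ n + q * \<alpha>2 ^ n + r * \<alpha>3 ^ n + u * \<alpha>4 ^ n + t"
    proof -
      consider "x = a" | "x = b" | "x = c" | "x = d" | "x = e" | "x = s" using x by auto
      then show ?thesis
      proof cases
        case 1
        show ?thesis unfolding 1
          by (rule exI[of _ "- 9/2 + 21/10 * sqrt 5"], rule exI[of _ "- 9/2 - 21/10 * sqrt 5"],
              rule exI[of _ 0], rule exI[of _ 0], rule exI[of _ 3]) (simp add: forms(1))
      next
        case 2
        show ?thesis unfolding 2
          by (rule exI[of _ "3 - 6/5 * sqrt 5"], rule exI[of _ "3 + 6/5 * sqrt 5"],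
              rule exI[of _ 0], rule exI[of _ 0], rule exI[of _ "-3"]) (simp add: forms(2))
      next
        case 3
        show ?thesis unfolding 3 using forms(3) by blast
      next
        case 4
        show ?thesis unfolding 4 using forms(4) diff_conv_add_uminus by metis
      next
        case 5
        show ?thesis unfolding 5 using forms(5) by blast
      next
        case 6
        show ?thesis unfolding 6 using form_s by blast
      qed
    qed
    then obtain p q r u t
      where "\<And>n. n \<ge> 1 \<Longrightarrow> real (x n) = p * \<alpha>1 ^ n + q * \<alpha>2 ^ n + r * \<alpha>3 ^ n + u * \<alpha>4 ^ n + t"
      by blast
    then show "int (x n) = 12 * int (x (n - 1)) - 37 * int (x (n - 2)) + 37 * int (x (n - 3))
                  - 12 * int (x (n - 4)) + int (x (n - 5))"
      using rec n by blast
  qed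
  have short_a: "int (a n) = 4 * int (a (n - 1)) - 4 * int (a (n - 2)) + int (a (n - 3))"
    if "n \<ge> 4" for n
    using short_recurrence_of_closed_form[OF \<alpha>(1,2) forms(1) that] .
  have short_b: "int (b n) = 4 * int (b (n - 1)) - 4 * int (b (n - 2)) + int (b (n - 3))"
    if "n \<ge> 4" for n
    using short_recurrence_of_closed_form[OF \<alpha>(1,2) forms(2)[unfolded diff_conv_add_uminus[of _ 3]] that] .
  have short: "\<forall>x\<in>{a, b}. \<forall>n\<ge>4.
      int (x n) = 4 * int (x (n - 1)) - 4 * int (x (n - 2)) + int (x (n - 3))"
  proof (intro ballI allI impI)
    fix x and n :: nat assume "x \<in> {a, b}" and n: "n \<ge> 4"
    then consider "x = a" | "x = b" by auto
    then show "int (x n) = 4 * int (x (n - 1)) - 4 * int (x (n - 2)) + int (x (n - 3))"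
      by cases (simp_all only: short_a[OF n] short_b[OF n])
  qed
  show ?thesis
    by (intro conjI; (rule s0 | rule long | rule short | (rule ballI, rule zero, assumption)
      | (intro allI impI, (rule nums(6) | rule s_sum | rule forms | rule form_s), assumption)))
qed

end
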